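(* Let $f$ be a transcendental meromorphic function in $\mathbb{C}$ and let $P[f]=\sum_{j=1}^{t} b_j M_j[f]$, with $M_j[f]=(f)^{q_{0j}}(f^{(1)})^{q_{1j}}\cdots(f^{(k)})^{q_{kj}}$, be a homogeneous differential polynomial generated by $f$, of degree $d(P)$, where $k\ (\geq 1)$ is the highest order of the derivative of $f$ in $P[f]$. Suppose that $q_{0j}\geq 1$, $q_{ij}\geq 0$ $(i=1,2,\ldots,k-1)$ and $q_{kj}\geq 1$ are integers for all $1\leq j\leq t$. Let $\nu=\max_{1\leq j\leq t}\{q_{1j}+2q_{2j}+\cdots+kq_{kj}\}$ and $q_{\ast}=\min_{1\leq j\leq t} q_{0j}$. If $d(P)+kq_{\ast}>2(k+1)+\nu$, then either (i) $P[f]\equiv 0$, or (ii) $$T(r,f)\leq \frac{k+1}{d(P)+kq_{\ast}-\nu-2(k+1)}\,\overline{N}\left(r,\frac{1}{P[f]-1}\right)+S(r,f),$$ where $S(r,f)=o(T(r,f))$ as $r\to\infty$, $r\notin E$, for some set $E$ of positive real numbers of finite linear measure.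
   Context: Standard notation of Nevanlinna theory is used: $T(r,f)$ is the Nevanlinna characteristic and $\overline{N}(r,g)$ is the reduced integrated counting function of the poles of $g$ (each counted once, ignoring multiplicity), so that $\overline{N}(r,\frac{1}{g-1})$ counts the distinct $1$-points of $g$. A meromorphic function $f$ in $\mathbb{C}$ is transcendental if it is not rational (equivalently, $T(r,f)\neq O(\log r)$). $S(r,f)$ denotes any quantity satisfying $S(r,f)=o(T(r,f))$ as $r\to\infty$ outside a set of positive reals of finite linear measure, not necessarily the same at each occurrence. Differential polynomial: for non-negative integers $q_{0j},\ldots,q_{kj}$, the expression $M_j[f]=(f)^{q_{0j}}(f^{(1)})^{q_{1j}}\cdots(f^{(k)})^{q_{kj}}$ is a differential monomial of degree $d(M_j)=\sum_{i=0}^{k}q_{ij}$. A differential polynomial generated by $f$ is a sum $P[f]=\sum_{j=1}^{t}b_jM_j[f]$, where the $b_j$ are meromorphic functions with $T(r,b_j)=S(r,f)$ for $j=1,\ldots,t$. It is homogeneous if all the degrees $d(M_j)$, $1\le j\le t$, are equal; the common value is its degree $d(P)$. *)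

theory Defs
  imports "HOL-Complex_Analysis.Complex_Analysis" "HOL-Library.Landau_Symbols"
begin

text \<open>
  Meromorphic functions are represented as in the library: their values on a sparse set (in
  particular at poles) are irrelevant. The notions below depend only on the function up to a
  sparse set, and identities between meromorphic functions are stated up to a sparse set.
\<close>

definition rational_meromorphic :: "(complex \<Rightarrow> complex) \<Rightarrow> bool" where
  "rational_meromorphic f \<longleftrightarrow>
     (\<exists>p q :: complex poly. q \<noteq> 0 \<and> (\<forall>\<^sub>\<approx>z\<in>UNIV. f z = poly p z / poly q z))"

definition transcendental_meromorphic :: "(complex \<Rightarrow> complex) \<Rightarrow> bool" where
  "transcendental_meromorphic f \<longleftrightarrow> f meromorphic_on UNIV \<and> \<not> rational_meromorphic f"


definition log_plus :: "real \<Rightarrow> real" where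
  "log_plus x = ln (max 1 x)"

definition proximity :: "(complex \<Rightarrow> complex) \<Rightarrow> real \<Rightarrow> real" where
  "proximity f r = 1 / (2 * pi) * integral {0..2 * pi} (\<lambda>\<theta>. log_plus (norm (f (r * cis \<theta>))))"

definition poles_within :: "(complex \<Rightarrow> complex) \<Rightarrow> real \<Rightarrow> complex set" where
  "poles_within f r = {z. norm z \<le> r \<and> is_pole f z}"

text \<open>At a pole, the library's order function is minus the multiplicity of the pole.\<close>

definition pole_count :: "(complex \<Rightarrow> complex) \<Rightarrow> real \<Rightarrow> real" where
  "pole_count f r = (\<Sum>z\<in>poles_within f r. real_of_int (- zorder f z))"

definition reduced_pole_count :: "(complex \<Rightarrow> complex) \<Rightarrow> real \<Rightarrow> real" where
  "reduced_pole_count f r = real (card (poles_within f r))"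

definition integrated_count :: "(real \<Rightarrow> real) \<Rightarrow> real \<Rightarrow> real" where
  "integrated_count n r = integral {0..r} (\<lambda>t. (n t - n 0) / t) + n 0 * ln r"

definition counting_N :: "(complex \<Rightarrow> complex) \<Rightarrow> real \<Rightarrow> real" where
  "counting_N f = integrated_count (pole_count f)"

definition reduced_counting_N :: "(complex \<Rightarrow> complex) \<Rightarrow> real \<Rightarrow> real" where
  "reduced_counting_N f = integrated_count (reduced_pole_count f)"

definition nevanlinna_T :: "(complex \<Rightarrow> complex) \<Rightarrow> real \<Rightarrow> real" where
  "nevanlinna_T f r = proximity f r + counting_N f r"

text \<open>
  The quantity \<open>s\<close> is an \<open>S(r,f)\<close>. The exceptional set \<open>E\<close> may depend on \<open>s\<close>;
  membership in \<open>lmeasurable\<close> means Lebesgue measurable of finite measure.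
\<close>

definition small_quantity :: "(complex \<Rightarrow> complex) \<Rightarrow> (real \<Rightarrow> real) \<Rightarrow> bool" where
  "small_quantity f s \<longleftrightarrow>
     (\<exists>E \<in> lmeasurable. E \<subseteq> {0<..} \<and> s \<in> o[inf at_top (principal (- E))](nevanlinna_T f))"


text \<open>
  \<open>q i\<close> is the exponent of the \<open>i\<close>-th derivative in a monomial; for a family of monomials
  \<open>q i j\<close> is the exponent of the \<open>i\<close>-th derivative in the \<open>j\<close>-th one.
\<close>

definition diff_monomial :: "nat \<Rightarrow> (nat \<Rightarrow> nat) \<Rightarrow> (complex \<Rightarrow> complex) \<Rightarrow> complex \<Rightarrow> complex" where
  "diff_monomial k q f z = (\<Prod>i\<le>k. ((deriv ^^ i) f z) ^ q i)"

definition monomial_degree :: "nat \<Rightarrow> (nat \<Rightarrow> nat) \<Rightarrow> nat" where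
  "monomial_degree k q = (\<Sum>i\<le>k. q i)"

definition diff_poly ::
  "nat \<Rightarrow> nat \<Rightarrow> (nat \<Rightarrow> complex \<Rightarrow> complex) \<Rightarrow> (nat \<Rightarrow> nat \<Rightarrow> nat) \<Rightarrow>
     (complex \<Rightarrow> complex) \<Rightarrow> complex \<Rightarrow> complex" where
  "diff_poly k t b q f z = (\<Sum>j=1..t. b j z * diff_monomial k (\<lambda>i. q i j) f z)"

end

theory Submission
  imports Defs
begin

text \<open>
  Put \<open>m = min q\<^sub>0\<^sub>j\<close>. Every monomial satisfies \<open>d - q\<^sub>0\<^sub>j \<le> \<Sum>i q\<^sub>i\<^sub>j \<le> \<nu>\<close>, so the constant of the theorem is at
  least \<open>1 / (m - 2)\<close>, and it suffices to show \<open>(m - 2) T(r,f) \<le> N(r,1/(P - 1)) + S(r,f)\<close> with the reduced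
  counting function. By homogeneity \<open>P / f^d\<close> is a polynomial in the logarithmic derivatives
  \<open>f^(i) / f\<close> with small coefficients, hence has small proximity function; combined with the identity
  \<open>1 / P = 1 - (P'/P) ((P - 1)/P')\<close> and Jensen's formula for \<open>P' / (P - 1)\<close>, this bounds \<open>d T(r,f)\<close> by the
  integrated counting function of the weight \<open>d ord\<^sup>+ f - ord P' + ord (P - 1)\<close>, up to \<open>S(r,f)\<close>. Since \<open>P\<close>
  vanishes to order at least \<open>m p\<close> at a zero of \<open>f\<close> of order \<open>p\<close>, up to poles of the coefficients, the
  weight is at most \<open>(d - m + 1) ord\<^sup>+ f\<close> plus one at each pole of \<open>f\<close> and at each 1-point of \<open>P\<close>.

  All circles through zeros or singularities are put into the exceptional set, so every circle mean is
  the integral of a continuous function. The majorant of \<open>T\<close> in Borel's growth lemma is the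
  supremum of \<open>T\<close> over the remaining radii.
\<close>

section \<open>Weighted counting functions\<close>

text \<open>With D the denominator in the theorem, D \<le> (k + 1)(m - 2) follows from d \<le> m +
  \<nu>; this is how 1/(m - 2) compares with (k + 1)/D. The 2 in m - 2 has two sources. At a zero of
  f the order of P' is one less than that of P, and at a pole of P the quotient P'/(P - 1) has a
  simple pole; each costs at most one T. The same quotient has a simple pole at a 1-point of any
  multiplicity, which is why the reduced count appears.

  The logarithmic derivative estimate may be crude: any bound on |g'/g| that is polynomial in r and
  T(r,g) gives a log+ of size O(1 + ln r + ln T(r,g)). This is o(T(r,f)) when T(r,g) = O(T(r,f)),
  because f is transcendental. A uniform bound on whole circles is therefore affordable, at the
  price of removing small intervals around the moduli of zeros and poles.

  Constant P needs its own argument, because then P' vanishes identically.\<close>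

definition Nsum :: "(complex \<Rightarrow> real) \<Rightarrow> real \<Rightarrow> real" where
  "Nsum w r = (\<Sum>a | norm a \<le> r \<and> w a \<noteq> 0. w a * ln (r / (if a = 0 then 1 else norm a)))"

text \<open>A sum over an infinite set is 0 by convention, so the calculus of \<open>Nsum\<close> is
  safe only for weights with finitely many points in each disc.\<close>

definition locally_finite_weight :: "(complex \<Rightarrow> real) \<Rightarrow> bool" where
  "locally_finite_weight w \<longleftrightarrow> (\<forall>r. finite {a. norm a \<le> r \<and> w a \<noteq> 0})"

lemma Nsum_superset:
  assumes "finite S" "{a. norm a \<le> r \<and> w a \<noteq> 0} \<subseteq> S" "S \<subseteq> cball 0 r"
  shows "Nsum w r = (\<Sum>a\<in>S. w a * ln (r / (if a = 0 then 1 else norm a)))"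
  unfolding Nsum_def
  by (rule sum.mono_neutral_left) (use assms in \<open>auto simp: subset_iff\<close>)

lemma Nsum_cong:
  assumes "\<And>a. norm a \<le> r \<Longrightarrow> w a = v a"
  shows "Nsum w r = Nsum v r"
  unfolding Nsum_def using assms by (intro sum.cong) auto

lemma locally_finite_weight_add [intro]:
  assumes "locally_finite_weight w" "locally_finite_weight v"
  shows "locally_finite_weight (\<lambda>a. w a + v a)"
  unfolding locally_finite_weight_def
proof
  fix r
  have "{a. norm a \<le> r \<and> w a + v a \<noteq> 0} \<subseteq> {a. norm a \<le> r \<and> w a \<noteq> 0} \<union> {a. norm a \<le> r \<and> v a \<noteq> 0}"
    by auto
  then show "finite {a. norm a \<le> r \<and> w a + v a \<noteq> 0}"
    by (rule finite_subset) (use assms in \<open>auto simp: locally_finite_weight_def\<close>)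
qed

lemma locally_finite_weight_subset:
  assumes "locally_finite_weight w" "\<And>a. w a = 0 \<Longrightarrow> v a = 0"
  shows "locally_finite_weight v"
  unfolding locally_finite_weight_def
proof
  fix r
  have "{a. norm a \<le> r \<and> v a \<noteq> 0} \<subseteq> {a. norm a \<le> r \<and> w a \<noteq> 0}"
    using assms(2) by auto
  then show "finite {a. norm a \<le> r \<and> v a \<noteq> 0}"
    by (rule finite_subset) (use assms in \<open>auto simp: locally_finite_weight_def\<close>)
qed

lemma locally_finite_weight_cmult [intro]:
  "locally_finite_weight w \<Longrightarrow> locally_finite_weight (\<lambda>a. c * w a)"
  by (erule locally_finite_weight_subset) auto

lemma locally_finite_weight_0 [intro]: "locally_finite_weight (\<lambda>a. 0)"
  by (auto simp: locally_finite_weight_def)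

lemma locally_finite_weight_sum [intro]:
  "(\<And>j. j \<in> J \<Longrightarrow> locally_finite_weight (w j)) \<Longrightarrow> locally_finite_weight (\<lambda>a. \<Sum>j\<in>J. w j a)"
  by (induction J rule: infinite_finite_induct) auto

lemma Nsum_add:
  assumes "locally_finite_weight w" "locally_finite_weight v"
  shows "Nsum (\<lambda>a. w a + v a) r = Nsum w r + Nsum v r"
proof -
  let ?S = "{a. norm a \<le> r \<and> w a \<noteq> 0} \<union> {a. norm a \<le> r \<and> v a \<noteq> 0}"
  have fin: "finite ?S"
    using assms by (auto simp: locally_finite_weight_def)
  show ?thesis
    using fin by (subst (1 2 3) Nsum_superset[where S = ?S])
      (auto simp: algebra_simps sum.distrib)
qed

lemma Nsum_cmult: "Nsum (\<lambda>a. c * w a) r = c * Nsum w r"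
proof (cases "c = 0")
  case False
  then show ?thesis by (simp add: Nsum_def sum_distrib_left mult.assoc)
qed (simp add: Nsum_def)

lemma Nsum_0 [simp]: "Nsum (\<lambda>a. 0) r = 0"
  by (simp add: Nsum_def)

lemma Nsum_uminus: "Nsum (\<lambda>a. - w a) r = - Nsum w r"
  using Nsum_cmult[of "-1"] by simp

lemma Nsum_diff:
  assumes "locally_finite_weight w" "locally_finite_weight v"
  shows "Nsum (\<lambda>a. w a - v a) r = Nsum w r - Nsum v r"
  using Nsum_add[OF assms(1) locally_finite_weight_cmult[OF assms(2), of "-1"]]
  by (simp add: Nsum_uminus)

lemma Nsum_sum:
  assumes "\<And>j. j \<in> J \<Longrightarrow> locally_finite_weight (w j)"
  shows "Nsum (\<lambda>a. \<Sum>j\<in>J. w j a) r = (\<Sum>j\<in>J. Nsum (w j) r)"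
  using assms
  by (induction J rule: infinite_finite_induct) (auto simp: Nsum_add locally_finite_weight_sum)

text \<open>The factor of the point 0 is ln r, which is nonnegative only for
  \<open>r \<ge> 1\<close>.\<close>

lemma Nsum_mono:
  assumes "locally_finite_weight w" "locally_finite_weight v" "\<And>a. w a \<le> v a" "r \<ge> 1"
  shows "Nsum w r \<le> Nsum v r"
proof -
  let ?S = "{a. norm a \<le> r \<and> w a \<noteq> 0} \<union> {a. norm a \<le> r \<and> v a \<noteq> 0}"
  have fin: "finite ?S"
    using assms by (auto simp: locally_finite_weight_def)
  have "Nsum w r = (\<Sum>a\<in>?S. w a * ln (r / (if a = 0 then 1 else norm a)))"
    by (rule Nsum_superset[OF fin]) auto
  also have "\<dots> \<le> (\<Sum>a\<in>?S. v a * ln (r / (if a = 0 then 1 else norm a)))"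
    using assms(3,4) by (intro sum_mono mult_right_mono) (auto intro!: ln_ge_zero)
  also have "\<dots> = Nsum v r"
    by (rule Nsum_superset[OF fin, symmetric]) auto
  finally show ?thesis .
qed

lemma Nsum_nonneg:
  assumes "\<And>a. w a \<ge> 0" "r \<ge> 1"
  shows "Nsum w r \<ge> 0"
  unfolding Nsum_def
  using assms by (intro sum_nonneg mult_nonneg_nonneg) (auto intro!: ln_ge_zero)

text \<open>A point of modulus at most \<rho> has a factor of at least ln (R/\<rho>); at 0 the
  factor is ln R, which is why \<rho> is at least 1. In this way a number of points is bounded by an
  integrated count at a larger radius.\<close>

lemma Nsum_ge_count:
  assumes "locally_finite_weight w" "\<And>a. w a \<ge> 0" "1 \<le> \<rho>" "\<rho> \<le> R"
  shows "(\<Sum>a | norm a \<le> \<rho> \<and> w a \<noteq> 0. w a) * ln (R / \<rho>) \<le> Nsum w R"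
proof -
  let ?S = "{a. norm a \<le> R \<and> w a \<noteq> 0}" and ?T = "{a. norm a \<le> \<rho> \<and> w a \<noteq> 0}"
  have fin: "finite ?S"
    using assms by (auto simp: locally_finite_weight_def)
  have "(\<Sum>a\<in>?T. w a) * ln (R / \<rho>) \<le> (\<Sum>a\<in>?T. w a * ln (R / (if a = 0 then 1 else norm a)))"
    unfolding sum_distrib_right
    using assms by (intro sum_mono mult_left_mono) (auto simp: divide_left_mono field_simps)
  also have "\<dots> \<le> (\<Sum>a\<in>?S. w a * ln (R / (if a = 0 then 1 else norm a)))"
    using assms by (intro sum_mono2[OF fin] mult_nonneg_nonneg) (auto intro!: ln_ge_zero)
  finally show ?thesis by (simp add: Nsum_def)
qed

section \<open>The integrated counting function as a finite sum\<close>

lemma has_integral_inverse_truncated: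
  fixes s r :: real
  assumes "0 < s" "s \<le> r"
  shows "((\<lambda>t. if s \<le> t then 1 / t else 0) has_integral ln (r / s)) {0..r}"
proof -
  have "((\<lambda>t. 1 / t) has_integral (ln r - ln s)) {s..r}"
    using assms by (intro fundamental_theorem_of_calculus)
      (auto intro!: derivative_eq_intros simp: has_real_derivative_iff_has_vector_derivative[symmetric] field_simps)
  then have "((\<lambda>t. if t \<in> {s..r} then 1 / t else 0) has_integral (ln r - ln s)) {0..r}"
    by (subst has_integral_restrict) (use assms in auto)
  also have "ln r - ln s = ln (r / s)"
    using assms by (simp add: ln_div)
  finally show ?thesis
    by (rule has_integral_eq_rhs[OF has_integral_eq, rotated]) auto
qed

text \<open>n(t) - n(0) is a sum of step functions that jump at |a|, and the integral of dt/t from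
  |a| to r is ln (r/|a|). The point 0 drops out of the integral and returns through n(0) ln r,
  whence the special factor of \<open>Nsum\<close> at 0.\<close>

lemma integrated_count_eq_Nsum:
  assumes lf: "locally_finite_weight w" and r: "r > 0"
    and n: "\<And>t. n t = (\<Sum>a | norm a \<le> t \<and> w a \<noteq> 0. w a)"
  shows "integrated_count n r = Nsum w r"
proof -
  define S where "S = {a. norm a \<le> r \<and> w a \<noteq> 0} - {0}"
  have fin: "finite S"
    using lf by (auto simp: S_def locally_finite_weight_def)
  have n0: "n 0 = w 0"
  proof -
    have "{a. norm a \<le> 0 \<and> w a \<noteq> 0} = (if w 0 = 0 then {} else {0::complex})"
      by auto
    then show ?thesis by (simp add: n)
  qed
  have nt: "n t - n 0 = (\<Sum>a\<in>S. w a * (if norm a \<le> t then 1 else 0))" if "t \<in> {0..r}" for t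
  proof -
    have "n t = (\<Sum>a\<in>insert 0 S. w a * (if norm a \<le> t then 1 else 0))"
      unfolding n using that fin
      by (intro sum.mono_neutral_cong_left) (auto simp: S_def)
    also have "\<dots> = w 0 + (\<Sum>a\<in>S. w a * (if norm a \<le> t then 1 else 0))"
      using that fin by (subst sum.insert) (auto simp: S_def)
    finally show ?thesis by (simp add: n0)
  qed
  have "((\<lambda>t. \<Sum>a\<in>S. w a * (if norm a \<le> t then 1 / t else 0)) has_integral
           (\<Sum>a\<in>S. w a * ln (r / norm a))) {0..r}"
    by (intro has_integral_sum fin has_integral_mult_right has_integral_inverse_truncated)
      (auto simp: S_def)
  then have "((\<lambda>t. (n t - n 0) / t) has_integral (\<Sum>a\<in>S. w a * ln (r / norm a))) {0..r}"
    by (rule has_integral_eq[rotated]) (simp add: nt sum_divide_distrib, intro sum.cong, auto)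
  then have "integrated_count n r = (\<Sum>a\<in>S. w a * ln (r / norm a)) + w 0 * ln r"
    unfolding integrated_count_def by (simp add: integral_unique n0)
  also have "\<dots> = (\<Sum>a\<in>insert 0 S. w a * ln (r / (if a = 0 then 1 else norm a)))"
    using fin by (subst sum.insert) (auto simp: S_def intro!: sum.cong)
  also have "\<dots> = Nsum w r"
    using fin r by (intro Nsum_superset[symmetric]) (auto simp: S_def)
  finally show ?thesis .
qed

section \<open>Circle means and the Poisson formula\<close>

text \<open>Values at single points carry no information, so only punctured neighbourhoods are
  tested. For these functions \<open>zorder\<close> is meaningful at every point.\<close>

definition nonzero_mero :: "(complex \<Rightarrow> complex) \<Rightarrow> bool" where
  "nonzero_mero f \<longleftrightarrow> f meromorphic_on UNIV \<and> (\<forall>z. eventually (\<lambda>w. f w \<noteq> 0) (at z))"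

text \<open>The identity theorem on the plane: a meromorphic function either equals 0 off a sparse
  set or differs from 0 off a sparse set.\<close>

lemma nonzero_meroI:
  assumes "f meromorphic_on UNIV" "\<not> (\<forall>\<^sub>\<approx>z\<in>UNIV. f z = 0)"
  shows "nonzero_mero f"
  using meromorphic_imp_constant_or_avoid[OF assms(1), of 0] assms
  by (auto simp: nonzero_mero_def eventually_cosparse_open_eq)

lemma nonzero_mero_imp_meromorphic: "nonzero_mero f \<Longrightarrow> f meromorphic_on A"
  by (auto simp: nonzero_mero_def intro: meromorphic_on_subset)

lemma nonzero_mero_eventually: "nonzero_mero f \<Longrightarrow> eventually (\<lambda>w. f w \<noteq> 0) (at z)"
  by (simp add: nonzero_mero_def)

lemma nonzero_mero_frequently: "nonzero_mero f \<Longrightarrow> frequently (\<lambda>w. f w \<noteq> 0) (at z)"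
  by (simp add: nonzero_mero_def eventually_frequently)

lemma nonzero_mero_isolated:
  "nonzero_mero f \<Longrightarrow> isolated_singularity_at f z" "nonzero_mero f \<Longrightarrow> not_essential f z"
  using meromorphic_at_iff nonzero_mero_imp_meromorphic by blast+

lemma nonzero_mero_mult:
  assumes "nonzero_mero f" "nonzero_mero g"
  shows "nonzero_mero (\<lambda>z. f z * g z)"
proof -
  have "eventually (\<lambda>w. f w * g w \<noteq> 0) (at z)" for z
    using nonzero_mero_eventually[OF assms(1), of z] nonzero_mero_eventually[OF assms(2), of z]
    by eventually_elim auto
  then show ?thesis
    using assms by (auto simp: nonzero_mero_def intro!: meromorphic_intros)
qed

lemma nonzero_mero_inverse: "nonzero_mero f \<Longrightarrow> nonzero_mero (\<lambda>z. inverse (f z))"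
  by (auto simp: nonzero_mero_def intro!: meromorphic_intros)

lemma nonzero_mero_divide: "nonzero_mero f \<Longrightarrow> nonzero_mero g \<Longrightarrow> nonzero_mero (\<lambda>z. f z / g z)"
  using nonzero_mero_mult[OF _ nonzero_mero_inverse] by (simp add: divide_inverse)

lemma nonzero_mero_powi: "nonzero_mero f \<Longrightarrow> nonzero_mero (\<lambda>z. f z powi n)"
  unfolding nonzero_mero_def
proof (intro conjI allI)
  fix z assume *: "f meromorphic_on UNIV \<and> (\<forall>z. \<forall>\<^sub>F w in at z. f w \<noteq> 0)"
  then show "(\<lambda>z. f z powi n) meromorphic_on UNIV"
    by (intro meromorphic_intros) auto
  from * have "eventually (\<lambda>w. f w \<noteq> 0) (at z)" by blast
  then show "eventually (\<lambda>w. f w powi n \<noteq> 0) (at z)"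
    by eventually_elim auto
qed

lemma nonzero_mero_power: "nonzero_mero f \<Longrightarrow> nonzero_mero (\<lambda>z. f z ^ n)"
  using nonzero_mero_powi[of f "int n"] by simp

lemma nonzero_mero_const: "c \<noteq> 0 \<Longrightarrow> nonzero_mero (\<lambda>z. c)"
  by (auto simp: nonzero_mero_def)

lemma nonzero_mero_prod: "(\<And>i. i \<in> I \<Longrightarrow> nonzero_mero (g i)) \<Longrightarrow> nonzero_mero (\<lambda>z. \<Prod>i\<in>I. g i z)"
  by (induction I rule: infinite_finite_induct) (auto intro: nonzero_mero_mult nonzero_mero_const)

lemma nonzero_mero_analytic:
  assumes "g analytic_on UNIV" "g z0 \<noteq> 0"
  shows "nonzero_mero g"
proof (rule nonzero_meroI)
  show "g meromorphic_on UNIV" by (rule analytic_on_imp_meromorphic_on[OF assms(1)])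
  have "isCont g z0"
    using assms(1) analytic_at_imp_isCont analytic_on_subset by blast
  then have "g \<midarrow>z0\<rightarrow> g z0" by (rule isContD)
  then have "eventually (\<lambda>z. g z \<noteq> 0) (at z0)"
    using assms(2) by (rule tendsto_imp_eventually_ne)
  then have "frequently (\<lambda>z. g z \<noteq> 0) (at z0)"
    by (rule eventually_frequently[rotated]) simp
  then have "\<not> eventually (\<lambda>z. g z = 0) (at z0)"
    by (simp add: frequently_def)
  then show "\<not> (\<forall>\<^sub>\<approx>z\<in>UNIV. g z = 0)"
    by (auto simp: eventually_cosparse_open_eq)
qed

text \<open>Besides zeros and poles this contains the points where a removable singularity carries a
  wrong value; such points also have to be kept off the circles of integration.\<close>

definition singular_points :: "(complex \<Rightarrow> complex) \<Rightarrow> complex set" where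
  "singular_points f = {z. \<not> (f analytic_on {z} \<and> f z \<noteq> 0)}"

lemma finite_nonanalytic_cball:
  assumes "f meromorphic_on UNIV"
  shows "finite {z. norm z \<le> r \<and> \<not> f analytic_on {z}}"
proof -
  have "{z. \<not> f analytic_on {z}} sparse_in UNIV"
    using meromorphic_on_imp_analytic_cosparse[OF assms] by (simp add: eventually_cosparse)
  then have "{z. \<not> f analytic_on {z}} sparse_in cball 0 r"
    by (rule sparse_in_subset) auto
  from sparse_in_compact_finite[OF this] show ?thesis
    by (simp add: Int_def)
qed

lemma finite_singular_cball:
  assumes "nonzero_mero f"
  shows "finite (singular_points f \<inter> cball 0 r)"
proof -
  have "eventually (\<lambda>z. f analytic_on {z}) (cosparse UNIV)"
    by (rule meromorphic_on_imp_analytic_cosparse[OF nonzero_mero_imp_meromorphic[OF assms]])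
  moreover have "eventually (\<lambda>z. f z \<noteq> 0) (cosparse UNIV)"
    using assms by (simp add: eventually_cosparse_open_eq nonzero_mero_def)
  ultimately have "eventually (\<lambda>z. f analytic_on {z} \<and> f z \<noteq> 0) (cosparse UNIV)"
    by eventually_elim auto
  then have "singular_points f sparse_in UNIV"
    by (simp add: eventually_cosparse singular_points_def)
  then have "singular_points f sparse_in cball 0 r"
    by (rule sparse_in_subset) auto
  from sparse_in_compact_finite[OF this] show ?thesis
    by (simp add: Int_commute)
qed

lemma zorder_nonzero_imp_singular:
  assumes "nonzero_mero f" "zorder f z \<noteq> 0"
  shows "z \<in> singular_points f"
  using zorder_eq_0_iff[OF _ nonzero_mero_frequently[OF assms(1)], of z] assms(2)
  by (auto simp: singular_points_def)

lemma finite_zorder_cball: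
  assumes "nonzero_mero f"
  shows "finite {a. norm a \<le> r \<and> zorder f a \<noteq> 0}"
  by (rule finite_subset[OF _ finite_singular_cball[OF assms, of r]])
    (use zorder_nonzero_imp_singular[OF assms] in auto)

lemma locally_finite_weight_zorder:
  "nonzero_mero f \<Longrightarrow> locally_finite_weight (\<lambda>a. of_int (zorder f a))"
  using finite_zorder_cball by (auto simp: locally_finite_weight_def)

definition regular_radius :: "(complex \<Rightarrow> complex) \<Rightarrow> real \<Rightarrow> bool" where
  "regular_radius f r \<longleftrightarrow> r > 0 \<and> (\<forall>z. norm z = r \<longrightarrow> f analytic_on {z} \<and> f z \<noteq> 0)"

text \<open>The coefficients of P may vanish identically, and then no circle is regular for them.
  Continuity of log+ |b| on the circle only asks for analyticity.\<close>

definition analytic_radius :: "(complex \<Rightarrow> complex) \<Rightarrow> real \<Rightarrow> bool" where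
  "analytic_radius f r \<longleftrightarrow> r > 0 \<and> (\<forall>z. norm z = r \<longrightarrow> f analytic_on {z})"

lemma regular_imp_analytic_radius: "regular_radius f r \<Longrightarrow> analytic_radius f r"
  by (auto simp: regular_radius_def analytic_radius_def)

lemma regular_radius_pos: "regular_radius f r \<Longrightarrow> r > 0"
  by (simp add: regular_radius_def)

lemma countable_locally_finite:
  fixes A :: "complex set"
  assumes "\<And>r. finite (A \<inter> cball 0 r)"
  shows "countable A"
proof -
  have "A = (\<Union>n::nat. A \<inter> cball 0 (real n))"
  proof
    show "A \<subseteq> (\<Union>n::nat. A \<inter> cball 0 (real n))"
    proof
      fix a assume "a \<in> A"
      moreover obtain n where "norm a \<le> real n" using real_arch_simple by blast
      ultimately show "a \<in> (\<Union>n::nat. A \<inter> cball 0 (real n))" by auto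
    qed
  qed auto
  also have "countable \<dots>"
    using assms by (intro countable_UN countableI_type) (auto intro: countable_finite)
  finally show ?thesis .
qed

lemma countable_nonregular_radii:
  assumes "nonzero_mero f"
  shows "countable {r. r > 0 \<and> \<not> regular_radius f r}"
proof -
  have "countable (singular_points f)"
    by (rule countable_locally_finite[OF finite_singular_cball[OF assms]])
  then have "countable (norm ` singular_points f)" by simp
  then show ?thesis
    by (rule countable_subset[rotated]) (auto simp: regular_radius_def singular_points_def)
qed

lemma countable_nonanalytic_radii:
  assumes "f meromorphic_on UNIV"
  shows "countable {r. r > 0 \<and> \<not> analytic_radius f r}"
proof -
  have "countable {z. \<not> f analytic_on {z}}"
  proof (rule countable_locally_finite)
    show "finite ({z. \<not> f analytic_on {z}} \<inter> cball 0 r)" for r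
      using finite_nonanalytic_cball[OF assms, of r] by (simp add: Int_def conj_commute)
  qed
  then have "countable (norm ` {z. \<not> f analytic_on {z}})" by simp
  then show ?thesis
    by (rule countable_subset[rotated]) (auto simp: analytic_radius_def)
qed

lemma regular_radius_between:
  assumes "nonzero_mero f" "0 \<le> s" "s < t"
  obtains r where "s < r" "r < t" "regular_radius f r"
proof -
  have "uncountable ({s<..<t} - {r. r > 0 \<and> \<not> regular_radius f r})"
    using uncountable_open_interval[of s t] assms
    by (intro uncountable_minus_countable countable_nonregular_radii) auto
  then obtain r where "r \<in> {s<..<t} - {r. r > 0 \<and> \<not> regular_radius f r}"
    by (metis countable_empty equals0I)
  then show ?thesis using that assms by auto
qed

section \<open>Mean values over circles\<close>

definition circle_mean :: "(complex \<Rightarrow> real) \<Rightarrow> real \<Rightarrow> real" where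
  "circle_mean g r = 1 / (2 * pi) * integral {0..2 * pi} (\<lambda>\<theta>. g (r * cis \<theta>))"

lemma circle_integrable:
  fixes g :: "complex \<Rightarrow> 'a::banach"
  assumes "continuous_on (sphere 0 r) g" "r \<ge> 0"
  shows "(\<lambda>\<theta>. g (complex_of_real r * cis \<theta>)) integrable_on {0..2 * pi}"
proof (rule integrable_continuous_interval)
  show "continuous_on {0..2 * pi} (\<lambda>\<theta>. g (complex_of_real r * cis \<theta>))"
    by (rule continuous_on_compose2[OF assms(1)])
      (use assms(2) in \<open>auto intro!: continuous_intros simp: norm_mult\<close>)
qed

lemma circle_mean_const [simp]: "circle_mean (\<lambda>z. c) r = c"
  by (simp add: circle_mean_def)

lemma circle_mean_add:
  assumes "continuous_on (sphere 0 r) g" "continuous_on (sphere 0 r) h" "r \<ge> 0"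
  shows "circle_mean (\<lambda>z. g z + h z) r = circle_mean g r + circle_mean h r"
  using assms unfolding circle_mean_def
  by (subst integral_add) (auto intro: circle_integrable simp: distrib_left)

lemma circle_mean_diff:
  assumes "continuous_on (sphere 0 r) g" "continuous_on (sphere 0 r) h" "r \<ge> 0"
  shows "circle_mean (\<lambda>z. g z - h z) r = circle_mean g r - circle_mean h r"
  using assms unfolding circle_mean_def
  by (subst integral_diff) (auto intro: circle_integrable simp: right_diff_distrib)

lemma circle_mean_cmult: "circle_mean (\<lambda>z. c * g z) r = c * circle_mean g r"
  unfolding circle_mean_def by simp

lemma circle_mean_sum:
  assumes "\<And>i. i \<in> I \<Longrightarrow> continuous_on (sphere 0 r) (g i)" "r \<ge> 0"
  shows "circle_mean (\<lambda>z. \<Sum>i\<in>I. g i z) r = (\<Sum>i\<in>I. circle_mean (g i) r)"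
  using assms
proof (induction I rule: infinite_finite_induct)
  case (insert x F)
  then show ?case by (auto simp: circle_mean_add continuous_on_sum)
qed auto

lemma circle_mean_mono:
  assumes "continuous_on (sphere 0 r) g" "continuous_on (sphere 0 r) h" "r \<ge> 0"
    and "\<And>z. norm z = r \<Longrightarrow> g z \<le> h z"
  shows "circle_mean g r \<le> circle_mean h r"
proof -
  have "integral {0..2 * pi} (\<lambda>\<theta>. g (r * cis \<theta>)) \<le> integral {0..2 * pi} (\<lambda>\<theta>. h (r * cis \<theta>))"
    using assms by (intro integral_le circle_integrable) (auto simp: norm_mult)
  then show ?thesis
    unfolding circle_mean_def by (intro mult_left_mono) auto
qed

lemma circle_mean_cong:
  assumes "\<And>z. norm z = r \<Longrightarrow> g z = h z" "r \<ge> 0"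
  shows "circle_mean g r = circle_mean h r"
  unfolding circle_mean_def using assms
  by (intro arg_cong2[where f = "(*)"] integral_cong refl) (auto simp: norm_mult)

lemma circle_mean_nonneg:
  assumes "\<And>z. g z \<ge> 0"
  shows "circle_mean g r \<ge> 0"
\<comment> \<open>No continuity is assumed: for a non-integrable integrand the integral is 0 by
  convention.\<close>
proof (cases "(\<lambda>\<theta>. g (complex_of_real r * cis \<theta>)) integrable_on {0..2 * pi}")
  case True
  then show ?thesis
    unfolding circle_mean_def using assms by (intro mult_nonneg_nonneg integral_nonneg) auto
qed (simp add: circle_mean_def not_integrable_integral)

section \<open>Poisson's formula, and a derivative bound through the real part\<close>

lemma norm_cauchy_kernel:
  fixes w z :: complex
  assumes "norm w = R"
  shows "of_real (R\<^sup>2) - cnj z * w = w * cnj (w - z)"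
proof -
  have "of_real (R\<^sup>2) = w * cnj w"
    using assms by (simp add: complex_norm_square[symmetric] flip: of_real_power)
  then show ?thesis by (simp add: algebra_simps)
qed

lemma cball_kernel_nonzero:
  fixes w z :: complex
  assumes "norm w \<le> R" "norm z < R"
  shows "Re (of_real (R\<^sup>2) - cnj z * w) > 0"
proof -
  have "Re (cnj z * w) \<le> norm (cnj z * w)" by (rule complex_Re_le_cmod)
  also have "\<dots> = norm z * norm w" by (simp add: norm_mult)
  also have "\<dots> \<le> norm z * R" using assms by (intro mult_left_mono) auto
  also have "\<dots> < R * R" 
  proof -
    have "R > 0" using assms(2) norm_ge_zero[of z] by linarith
    then show ?thesis using assms by (intro mult_strict_right_mono) auto
  qed
  finally show ?thesis by (simp add: power2_eq_square)
qed

lemma circle_has_integral_Cauchy: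
  fixes h :: "complex \<Rightarrow> complex"
  assumes "continuous_on (cball 0 R) h" "h holomorphic_on ball 0 R" "norm z < R"
  shows "((\<lambda>\<theta>. h (R * cis \<theta>) / (R * cis \<theta> - z) * (R * cis \<theta>)) has_integral (2 * pi * h z)) {0..2 * pi}"
proof -
  have "((\<lambda>u. h u / (u - z)) has_contour_integral (2 * of_real pi * \<i> * h z)) (part_circlepath 0 R 0 (2 * pi))"
    using Cauchy_integral_circlepath[of 0 R h z] assms by (simp add: circlepath_def)
  then have "((\<lambda>\<theta>. h (0 + R * cis \<theta>) / (0 + R * cis \<theta> - z) * R * \<i> * cis \<theta>) has_integral (2 * of_real pi * \<i> * h z)) {0..2 * pi}"
    by (subst (asm) has_contour_integral_part_circlepath_iff) auto
  from has_integral_mult_right[OF this, of "-\<i>"] show ?thesis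
    by (simp add: mult_ac)
qed

lemma circle_mean_Re:
  fixes H :: "complex \<Rightarrow> complex" and c :: complex
  assumes "((\<lambda>\<theta>. H (complex_of_real R * cis \<theta>)) has_integral (2 * pi * c)) {0..2 * pi}"
  shows "circle_mean (\<lambda>w. Re (H w)) R = Re c"
proof -
  have "((Re \<circ> (\<lambda>\<theta>. H (complex_of_real R * cis \<theta>))) has_integral Re (2 * pi * c)) {0..2 * pi}"
    by (rule has_integral_linear[OF assms bounded_linear_Re])
  then have "integral {0..2 * pi} (\<lambda>\<theta>. Re (H (complex_of_real R * cis \<theta>))) = 2 * pi * Re c"
    by (intro integral_unique) (simp add: o_def)
  then show ?thesis by (simp add: circle_mean_def)
qed

text \<open>Cauchy's formula at \<open>z\<close> for \<open>h w (R\<^sup>2 - \<bar>z\<bar>\<^sup>2) / (R\<^sup>2 - cnj z w)\<close>, which has the value \<open>h z\<close> at \<open>z\<close>.\<close>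

lemma poisson_formula:
  fixes h :: "complex \<Rightarrow> complex"
  assumes "continuous_on (cball 0 R) h" "h holomorphic_on ball 0 R" "norm z < R"
  shows "circle_mean (\<lambda>w::complex. Re (h w) * ((R\<^sup>2 - (norm z)\<^sup>2) / (norm (w - z))\<^sup>2)) R = Re (h z)"
proof -
  define k where "k = (\<lambda>w. h w * (of_real (R\<^sup>2) - cnj z * z) / (of_real (R\<^sup>2) - cnj z * w))"
  have R: "R > 0" using assms(3) norm_ge_zero[of z] by linarith
  have nz: "of_real (R\<^sup>2) - cnj z * w \<noteq> 0" if "norm w \<le> R" for w
    using cball_kernel_nonzero[OF that assms(3)] by (metis less_irrefl zero_complex.sel(1))
  have "continuous_on (cball 0 R) k" "k holomorphic_on ball 0 R"
    unfolding k_def using assms nz by (auto intro!: continuous_intros holomorphic_intros)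
  from circle_has_integral_Cauchy[OF this assms(3)]
  have "((\<lambda>\<theta>. k (R * cis \<theta>) / (R * cis \<theta> - z) * (R * cis \<theta>)) has_integral (2 * pi * h z)) {0..2 * pi}"
    using nz[of z] assms(3) by (simp add: k_def)
  from circle_mean_Re[where H = "\<lambda>w::complex. k w / (w - z) * w", OF this]
  have "circle_mean (\<lambda>w::complex. Re (k w / (w - z) * w :: complex)) R = Re (h z)" .
  moreover have "circle_mean (\<lambda>w::complex. Re (k w / (w - z) * w :: complex)) R =
     circle_mean (\<lambda>w::complex. Re (h w) * ((R\<^sup>2 - (norm z)\<^sup>2) / (norm (w - z))\<^sup>2)) R"
  proof (rule circle_mean_cong)
    fix w :: complex assume w: "norm w = R"
    have nw: "w \<noteq> 0" "w - z \<noteq> 0" using w R assms(3) by auto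
    have zz: "cnj z * z = of_real ((norm z)\<^sup>2)"
      by (simp only: complex_norm_square mult.commute)
    \<comment> \<open>On the circle R^2 = w cnj w turns the denominator of \<open>k\<close> into w
      cnj (w - z); together with w - z this is w |w - z|^2, which contains the denominator of the
      Poisson kernel.\<close>
    have "k w / (w - z) * w = h w * (of_real (R\<^sup>2) - cnj z * z) / ((w - z) * cnj (w - z))"
    proof -
      have "A / (w * u) / v * w = A / (v * u)" for A u v
        using nw by (simp add: field_simps)
      then show ?thesis
        unfolding k_def norm_cauchy_kernel[OF w] .
    qed
    also have "\<dots> = h w * of_real ((R\<^sup>2 - (norm z)\<^sup>2) / (norm (w - z))\<^sup>2)"
      unfolding complex_norm_square[symmetric]
      by (simp add: zz)
    finally show "Re (k w / (w - z) * w) = Re (h w) * ((R\<^sup>2 - (norm z)\<^sup>2) / (norm (w - z))\<^sup>2)"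
      by simp
  qed (use R in auto)
  ultimately show ?thesis by simp
qed

text \<open>Cauchy's formula for h' contains h, whereas only Re h will be known on the circle, as ln
  |f|. Adding the conjugate of a vanishing Cauchy integral replaces h by h + cnj h = 2 Re h without
  changing the value.\<close>

lemma norm_deriv_le_circle_mean:
  fixes h :: "complex \<Rightarrow> complex"
  assumes h: "continuous_on (cball 0 R) h" "h holomorphic_on ball 0 R" "norm z < R"
  shows "norm (deriv h z) \<le> 2 * R / (R - norm z)\<^sup>2 * circle_mean (\<lambda>w. \<bar>Re (h w)\<bar>) R"
proof -
  have R: "R > 0" using assms(3) norm_ge_zero[of z] by linarith
  have nz: "of_real (R\<^sup>2) - cnj z * w \<noteq> 0" if "norm w \<le> R" for w
    using cball_kernel_nonzero[OF that assms(3)] by (metis less_irrefl zero_complex.sel(1))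
  have "((\<lambda>u. h u / (u - z) ^ Suc 1) has_contour_integral ((2 * pi * \<i>) / fact 1 * (deriv ^^ 1) h z))
     (part_circlepath 0 R 0 (2 * pi))"
    using Cauchy_has_contour_integral_higher_derivative_circlepath[of 0 R h z 1] assms
    by (simp add: circlepath_def)
  then have "((\<lambda>\<theta>. h (0 + R * cis \<theta>) / (0 + R * cis \<theta> - z) ^ Suc 1 * R * \<i> * cis \<theta>) has_integral (2 * pi * \<i> * deriv h z)) {0..2 * pi}"
    by (subst (asm) has_contour_integral_part_circlepath_iff) auto
  from has_integral_mult_right[OF this, of "-\<i>"]
  have I1: "((\<lambda>\<theta>. h (R * cis \<theta>) / (R * cis \<theta> - z)\<^sup>2 * (R * cis \<theta>)) has_integral (2 * pi * deriv h z)) {0..2 * pi}"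
    by (simp add: mult_ac power2_eq_square)
  \<comment> \<open>The factor w makes the mean of \<open>k\<close> over the circle vanish. On |w| =
    R the conjugate of \<open>k\<close>, times R^2, is cnj (h w) w / (w - z)^2, which has the kernel
    of Cauchy's formula for h'.\<close>
  define k where "k = (\<lambda>w. w * h w / (of_real (R\<^sup>2) - cnj z * w)\<^sup>2)"
  have "continuous_on (cball 0 R) k" "k holomorphic_on ball 0 R"
    unfolding k_def using assms nz by (auto intro!: continuous_intros holomorphic_intros)
  from circle_has_integral_Cauchy[OF this, of 0]
  have "((\<lambda>\<theta>. k (R * cis \<theta>)) has_integral 0) {0..2 * pi}"
    using R by (simp add: k_def mult_ac)
  from has_integral_linear[OF this bounded_linear_cnj]
  have "((\<lambda>\<theta>. cnj (k (R * cis \<theta>))) has_integral 0) {0..2 * pi}"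
    by (simp add: o_def)
  from has_integral_mult_right[OF this, of "of_real (R\<^sup>2)"]
  have I2: "((\<lambda>\<theta>. of_real (R\<^sup>2) * cnj (k (R * cis \<theta>))) has_integral 0) {0..2 * pi}"
    by simp
  define I where "I = (\<lambda>w. of_real (2 * Re (h w)) * w / (w - z)\<^sup>2)"
  have eq: "h w / (w - z)\<^sup>2 * w + of_real (R\<^sup>2) * cnj (k w) = I w" if w: "norm w = R" for w
  proof -
    have nw: "w \<noteq> 0" "w - z \<noteq> 0" using w R assms(3) by auto
    have R2: "of_real (R\<^sup>2) = w * cnj w"
      using w by (simp add: complex_norm_square[symmetric] flip: of_real_power)
    define u where "u = w - z"
    have "cnj (k w) = cnj w * cnj (h w) / (cnj w * u)\<^sup>2"
      unfolding k_def norm_cauchy_kernel[OF w] u_def by simp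
    then have "of_real (R\<^sup>2) * cnj (k w) = cnj (h w) * w / u\<^sup>2"
      unfolding R2 using nw by (simp add: u_def[symmetric] power_mult_distrib) (simp add: power2_eq_square)
    then have "h w / (w - z)\<^sup>2 * w + of_real (R\<^sup>2) * cnj (k w) = (h w + cnj (h w)) * w / (w - z)\<^sup>2"
      by (simp add: add_divide_distrib distrib_right u_def)
    then show ?thesis
      unfolding I_def complex_add_cnj .
  qed
  have "((\<lambda>\<theta>. I (R * cis \<theta>)) has_integral (2 * pi * deriv h z)) {0..2 * pi}"
  proof (rule has_integral_eq)
    show "((\<lambda>\<theta>. h (R * cis \<theta>) / (R * cis \<theta> - z)\<^sup>2 * (R * cis \<theta>) + of_real (R\<^sup>2) * cnj (k (R * cis \<theta>)))
       has_integral (2 * pi * deriv h z)) {0..2 * pi}"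
      using has_integral_add[OF I1 I2] by simp
    show "h (R * cis \<theta>) / (R * cis \<theta> - z)\<^sup>2 * (R * cis \<theta>) + of_real (R\<^sup>2) * cnj (k (R * cis \<theta>)) = I (R * cis \<theta>)"
      for \<theta>
      by (rule eq) (use R in \<open>simp add: norm_mult\<close>)
  qed
  then have D: "integral {0..2 * pi} (\<lambda>\<theta>. I (R * cis \<theta>)) = 2 * pi * deriv h z"
    and Iint: "(\<lambda>\<theta>. I (R * cis \<theta>)) integrable_on {0..2 * pi}"
    by (auto simp: has_integral_integrable_integral)
  define C where "C = 2 * R / (R - norm z)\<^sup>2"
  have cont: "continuous_on (sphere 0 R) h"
    using h(1) by (rule continuous_on_subset) auto
  have "norm (integral {0..2 * pi} (\<lambda>\<theta>. I (R * cis \<theta>))) \<le> integral {0..2 * pi} (\<lambda>\<theta>. C * \<bar>Re (h (R * cis \<theta>))\<bar>)"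
  proof (rule integral_norm_bound_integral[OF Iint])
    show "(\<lambda>\<theta>. C * \<bar>Re (h (R * cis \<theta>))\<bar>) integrable_on {0..2 * pi}"
      using R by (intro circle_integrable[of R "\<lambda>w. C * \<bar>Re (h w)\<bar>"] continuous_intros cont) auto
    fix \<theta> :: real
    define w where "w = R * cis \<theta>"
    have w: "norm w = R" using R by (simp add: w_def norm_mult)
    have "norm (w - z) \<ge> R - norm z"
      using w norm_triangle_ineq2[of w z] by simp
    then have "(R - norm z)\<^sup>2 \<le> (norm (w - z))\<^sup>2"
      using assms(3) by (intro power_mono) auto
    then have "2 * \<bar>Re (h w)\<bar> * R / (norm (w - z))\<^sup>2 \<le> 2 * \<bar>Re (h w)\<bar> * R / (R - norm z)\<^sup>2"
      using R assms(3) by (intro divide_left_mono mult_pos_pos) (auto intro!: zero_less_power)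
    then show "norm (I (R * cis \<theta>)) \<le> C * \<bar>Re (h (R * cis \<theta>))\<bar>"
      unfolding w_def[symmetric] I_def C_def
      by (simp add: norm_mult norm_divide norm_power w mult_ac)
  qed
  then show ?thesis
    unfolding D C_def[symmetric] by (simp add: circle_mean_def norm_mult field_simps)
qed

section \<open>Blaschke factorization\<close>

definition blaschke :: "real \<Rightarrow> complex \<Rightarrow> complex \<Rightarrow> complex" where
  "blaschke R a z = of_real R * (z - a) / (of_real (R\<^sup>2) - cnj a * z)"

lemma blaschke_denominator:
  assumes "norm a < R" "norm z \<le> R"
  shows "Re (of_real (R\<^sup>2) - cnj a * z) > 0" "of_real (R\<^sup>2) - cnj a * z \<noteq> 0"
proof -
  show "Re (of_real (R\<^sup>2) - cnj a * z) > 0"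
    by (rule cball_kernel_nonzero) fact+
  then show "of_real (R\<^sup>2) - cnj a * z \<noteq> 0"
    by (metis less_irrefl zero_complex.sel(1))
qed

lemma norm_blaschke_eq_1:
  assumes "norm a < R" "norm z = R"
  shows "norm (blaschke R a z) = 1"
proof -
  have R: "R > 0" using assms(1) norm_ge_zero[of a] by linarith
  have "norm (z - a) > 0" using assms by auto
  moreover have "norm (of_real (R\<^sup>2) - cnj a * z) = R * norm (z - a)"
    unfolding norm_cauchy_kernel[OF assms(2)] norm_mult complex_mod_cnj assms(2) ..
  ultimately show ?thesis
    using R by (simp add: blaschke_def norm_divide norm_mult)
qed

text \<open>Rests on |R^2 - cnj a z|^2 - R^2 |z - a|^2 = (R^2 - |a|^2)(R^2 - |z|^2).\<close>

lemma norm_blaschke_le_1: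
  assumes "norm a < R" "norm z \<le> R"
  shows "norm (blaschke R a z) \<le> 1"
proof -
  have R: "R > 0" using assms(1) norm_ge_zero[of a] by linarith
  have sq: "(norm (x - y))\<^sup>2 = (norm x)\<^sup>2 + (norm y)\<^sup>2 - 2 * Re (cnj y * x)" for x y :: complex
    unfolding cmod_power2 by (simp add: power2_eq_square algebra_simps)
  have "(norm (of_real (R\<^sup>2) - cnj a * z))\<^sup>2 =
      (R\<^sup>2)\<^sup>2 + (norm a)\<^sup>2 * (norm z)\<^sup>2 - 2 * Re (cnj (cnj a * z) * of_real (R\<^sup>2))"
    unfolding sq norm_mult power_mult_distrib by (simp add: norm_power)
  also have "Re (cnj (cnj a * z) * of_real (R\<^sup>2)) = R\<^sup>2 * Re (cnj a * z)"
    by (simp add: power2_eq_square algebra_simps)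
  finally have "(norm (of_real (R\<^sup>2) - cnj a * z))\<^sup>2 - (R * norm (z - a))\<^sup>2 = (R\<^sup>2 - (norm a)\<^sup>2) * (R\<^sup>2 - (norm z)\<^sup>2)"
    unfolding power_mult_distrib sq by (simp add: algebra_simps power2_eq_square)
  also have "\<dots> \<ge> 0"
    using assms R by (intro mult_nonneg_nonneg) (auto intro!: power_mono)
  finally have "(R * norm (z - a))\<^sup>2 \<le> (norm (of_real (R\<^sup>2) - cnj a * z))\<^sup>2"
    by linarith
  then have "R * norm (z - a) \<le> norm (of_real (R\<^sup>2) - cnj a * z)"
    by (rule power2_le_imp_le) (rule norm_ge_zero)
  then show ?thesis
    using R blaschke_denominator(2)[OF assms] by (simp add: blaschke_def norm_divide norm_mult)
qed

lemma zorder_linear: "zorder (\<lambda>z. z - a) z = (if z = a then 1 else 0)"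
proof (cases "z = a")
  case True
  then show ?thesis
    by (auto intro!: zorder_eqI[of UNIV _ "\<lambda>_. 1"])
qed (auto intro!: zorder_eq_0I analytic_intros)

lemma nonzero_mero_linear: "nonzero_mero (\<lambda>z. z - a)"
  by (rule nonzero_mero_analytic[of _ "a + 1"]) (auto intro!: analytic_intros)

lemma zorder_blaschke:
  assumes "norm a < R" "norm z < R"
  shows "zorder (blaschke R a) z = (if z = a then 1 else 0)"
proof -
  have R: "R > 0" using assms(1) norm_ge_zero[of a] by linarith
  have "zorder (blaschke R a) a = 1"
    by (rule zorder_eqI[of "ball 0 R" _ "\<lambda>z. of_real R / (of_real (R\<^sup>2) - cnj a * z)"])
      (use assms(1) R blaschke_denominator(2)[OF assms(1)] in
        \<open>auto intro!: holomorphic_intros simp: blaschke_def\<close>)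
  moreover have "zorder (blaschke R a) z = 0" if "z \<noteq> a"
    unfolding blaschke_def
    by (rule zorder_eq_0I)
      (use that R assms blaschke_denominator(2)[OF assms(1), of z] in \<open>auto intro!: analytic_intros\<close>)
  ultimately show ?thesis by auto
qed

lemma nonzero_mero_blaschke:
  assumes "norm a < R"
  shows "nonzero_mero (blaschke R a)"
proof -
  have R: "R > 0" using assms(1) norm_ge_zero[of a] by linarith
  show ?thesis
    unfolding blaschke_def
    by (intro nonzero_mero_divide nonzero_mero_mult nonzero_mero_const nonzero_mero_linear
        nonzero_mero_analytic[of _ 0] analytic_intros) (use R in auto)
qed

lemma regular_radius_blaschke:
  assumes "norm a < R" "0 < r" "r \<le> R" "norm a \<noteq> r"
  shows "regular_radius (blaschke R a) r"
  unfolding regular_radius_def blaschke_def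
  using assms blaschke_denominator(2)[OF assms(1)]
  by (auto intro!: analytic_intros)

lemma regular_radius_zorder:
  assumes "nonzero_mero f" "regular_radius f R" "norm a = R"
  shows "zorder f a = 0"
  using zorder_nonzero_imp_singular[OF assms(1), of a] assms(2,3)
  by (auto simp: regular_radius_def singular_points_def)

text \<open>Each factor of \<open>p\<close> has order - ord f at its own point and order 0
  elsewhere.\<close>

lemma remove_order_divisor:
  assumes f: "nonzero_mero f" and S: "S = {a. norm a \<le> R \<and> zorder f a \<noteq> 0}"
    and p: "p = (\<lambda>z. \<Prod>a\<in>S. (z - a) powi (- zorder f a))"
    and z: "norm z \<le> R"
  shows "zorder (\<lambda>z. f z * p z) z = 0"
proof -
  have fin: "finite S" using finite_zorder_cball[OF f, of R] S by simp
  have nzp: "nonzero_mero p"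
    unfolding p by (intro nonzero_mero_prod nonzero_mero_powi nonzero_mero_linear)
  have "zorder (\<lambda>z. f z * p z) z = zorder f z + zorder p z"
    by (intro zorder_mult nonzero_mero_imp_meromorphic nonzero_mero_frequently f nzp)
  also have "zorder p z = (\<Sum>a\<in>S. zorder (\<lambda>z. (z - a) powi (- zorder f a)) z)"
    unfolding p
    by (rule zorder_prod)
      (use nonzero_mero_eventually[OF nzp, of z] in \<open>auto intro!: meromorphic_intros simp: p\<close>)
  also have "\<dots> = (\<Sum>a\<in>S. if z = a then - zorder f a else 0)"
  proof (rule sum.cong[OF refl])
    fix a
    have "zorder (\<lambda>z. (z - a) powi (- zorder f a)) z = - zorder f a * zorder (\<lambda>z. z - a) z"
      by (intro zorder_power_int nonzero_mero_imp_meromorphic nonzero_mero_frequently nonzero_mero_linear)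
    then show "zorder (\<lambda>z. (z - a) powi (- zorder f a)) z = (if z = a then - zorder f a else 0)"
      by (simp add: zorder_linear)
  qed
  also have "\<dots> = (if z \<in> S then - zorder f z else 0)"
    using fin by simp
  finally show ?thesis using z S by auto
qed

text \<open>Singular points are locally finite, so a function of order 0 on the closed disc is free
  of zeros and poles on a slightly larger open disc, once removable singularities are filled in. The
  larger disc yields a logarithm that is holomorphic across the boundary circle.\<close>

lemma nonzero_mero_zero_free:
  assumes F: "nonzero_mero F" and ord: "\<And>z. norm z \<le> R \<Longrightarrow> zorder F z = 0" and R: "R > 0"
  obtains R' where "R' > R" "\<And>z. norm z < R' \<Longrightarrow> remove_sings F analytic_on {z}"
    "\<And>z. norm z < R' \<Longrightarrow> remove_sings F z \<noteq> 0"
proof -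
  define g where "g = remove_sings F"
  have g: "nonzero_mero g"
  proof -
    have "eventually (\<lambda>w. g w \<noteq> 0) (at z)" for z
      using eventually_remove_sings_eq_at[OF nonzero_mero_isolated(1)[OF F], of z]
        nonzero_mero_eventually[OF F, of z]
      unfolding g_def by eventually_elim auto
    then show ?thesis
      using F by (auto simp: nonzero_mero_def g_def intro!: meromorphic_intros)
  qed
  have 1: "z \<notin> singular_points g" if "norm z \<le> R" for z
  proof -
    have "\<not> is_pole F z"
      using isolated_pole_imp_neg_zorder[OF nonzero_mero_isolated(1)[OF F]] ord[OF that] by force
    then obtain c where "F \<midarrow>z\<rightarrow> c"
      using nonzero_mero_isolated(2)[OF F, of z] by (auto simp: not_essential_def)
    then have an: "g analytic_on {z}"
      unfolding g_def by (rule remove_sings_analytic_at[OF nonzero_mero_isolated(1)[OF F]])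
    moreover have "zorder g z = 0"
      using ord[OF that] nonzero_mero_isolated(1)[OF F] by (simp add: g_def)
    then have "g z \<noteq> 0"
      using zorder_eq_0_iff[OF an nonzero_mero_frequently[OF g]] by simp
    ultimately show ?thesis by (simp add: singular_points_def)
  qed
  define M where "M = singular_points g \<inter> cball 0 (R + 1)"
  have finM: "finite M"
    unfolding M_def by (rule finite_singular_cball[OF g])
  \<comment> \<open>The finitely many singular points in the disc of radius R + 1 all have modulus
    greater than R; the smallest of these moduli stops the enlargement.\<close>
  define R' where "R' = Min (insert (R + 1) (norm ` M))"
  have "R' > R"
    unfolding R'_def using finM 1 by (subst Min_gr_iff) (auto simp: M_def not_le[symmetric])
  moreover have "z \<notin> singular_points g" if "norm z < R'" for z
  proof
    assume z: "z \<in> singular_points g"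
    have "R' \<le> R + 1" unfolding R'_def using finM by (intro Min_le) auto
    then have "z \<in> M" using z that by (auto simp: M_def)
    then have "R' \<le> norm z" unfolding R'_def using finM by (intro Min_le) auto
    then show False using that by simp
  qed
  ultimately show ?thesis
    using that[of R'] by (auto simp: singular_points_def g_def)
qed

text \<open>\<open>zor_poly f 0 0\<close> is the leading Laurent coefficient at 0. The power of z in
  f is cancelled by the factor of \<open>p\<close> that belongs to 0, and the other factors are
  continuous there. This limit provides the constant of Jensen's formula.\<close>

lemma leading_coeff_limit:
  assumes f: "nonzero_mero f" and S: "S = {a. norm a \<le> R \<and> zorder f a \<noteq> 0}" and R: "R > 0"
    and p: "p = (\<lambda>z. \<Prod>a\<in>S. (z - a) powi (- zorder f a))"
  shows "((\<lambda>z. f z * p z) \<longlongrightarrow> zor_poly f 0 0 * (\<Prod>a\<in>S-{0}. (- a) powi (- zorder f a))) (at 0)"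
proof -
  note iso = nonzero_mero_isolated[OF f] and fr = nonzero_mero_frequently[OF f]
  have fin: "finite S" using finite_zorder_cball[OF f, of R] S by simp
  obtain e where e: "e > 0" "zor_poly f 0 holomorphic_on cball 0 e"
    using zorder_exist[OF iso fr, of 0] by blast
  have "isCont (zor_poly f 0) 0"
    using e holomorphic_on_imp_continuous_on[OF e(2)]
    by (intro continuous_on_interior[of "cball 0 e"]) auto
  then have l1: "(zor_poly f 0 \<longlongrightarrow> zor_poly f 0 0) (at 0)"
    by (rule isContD)
  have l2: "((\<lambda>z. \<Prod>a\<in>S-{0}. (z - a) powi (- zorder f a)) \<longlongrightarrow> (\<Prod>a\<in>S-{0}. (0 - a) powi (- zorder f a))) (at 0)"
    by (intro tendsto_intros) auto
  have "((\<lambda>z. zor_poly f 0 z * (\<Prod>a\<in>S-{0}. (z - a) powi (- zorder f a))) \<longlongrightarrow>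
     zor_poly f 0 0 * (\<Prod>a\<in>S-{0}. (0 - a) powi (- zorder f a))) (at 0)"
    by (intro tendsto_mult l1 l2)
  moreover have "eventually (\<lambda>z. zor_poly f 0 z * (\<Prod>a\<in>S-{0}. (z - a) powi (- zorder f a)) = f z * p z) (at 0)"
    using zor_poly_eq[OF iso fr, of 0]
  proof eventually_elim
    case (elim z)
    have "p z = (z - 0) powi (- zorder f 0) * (\<Prod>a\<in>S-{0}. (z - a) powi (- zorder f a))"
    proof (cases "0 \<in> S")
      case True
      then show ?thesis unfolding p using fin by (subst prod.remove[of _ 0]) auto
    next
      case False
      then have "zorder f 0 = 0" using S R by auto
      then show ?thesis using False by (simp add: p)
    qed
    then show ?case using elim by simp
  qed
  ultimately show ?thesis
    by (rule Lim_transform_eventually[THEN tendsto_eq_rhs]) simp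
qed

text \<open>Removing the orders leaves a zero-free function with a logarithm L on a larger disc.
  Passing from z - a to the Blaschke factor costs (R^2 - cnj a z)/R, which has positive real part on
  the closed disc, so multiples of its principal logarithm can be added to L. At 0 this cost is R,
  which produces the terms ln (R/|a|).\<close>

lemma blaschke_factorization:
  assumes f: "nonzero_mero f" and reg: "regular_radius f R"
  obtains h where "continuous_on (cball 0 R) h" "h holomorphic_on ball 0 R"
    "\<And>z. norm z \<le> R \<Longrightarrow> z \<notin> singular_points f \<Longrightarrow>
       f z = exp (h z) * (\<Prod>a | norm a \<le> R \<and> zorder f a \<noteq> 0. blaschke R a z powi zorder f a)"
    "Re (h 0) = ln (norm (zor_poly f 0 0)) + Nsum (\<lambda>a. of_int (zorder f a)) R"
proof -
  have R: "R > 0" using reg by (rule regular_radius_pos)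
  define S where "S = {a. norm a \<le> R \<and> zorder f a \<noteq> 0}"
  define m where "m = zorder f"
  define p where "p = (\<lambda>z. \<Prod>a\<in>S. (z - a) powi (- m a))"
  define F where "F = (\<lambda>z. f z * p z)"
  define g where "g = remove_sings F"
  have fin: "finite S" using finite_zorder_cball[OF f, of R] by (simp add: S_def)
  have lt: "norm a < R" if "a \<in> S" for a
    using that regular_radius_zorder[OF f reg, of a] by (force simp: S_def)
  have nzp: "nonzero_mero p"
    unfolding p_def by (intro nonzero_mero_prod nonzero_mero_powi nonzero_mero_linear)
  have nzF: "nonzero_mero F" unfolding F_def by (intro nonzero_mero_mult f nzp)
  have ord0: "zorder F z = 0" if "norm z \<le> R" for z
    unfolding F_def by (rule remove_order_divisor[OF f S_def _ that]) (simp add: p_def m_def)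
  obtain R' where R': "R' > R" "\<And>z. norm z < R' \<Longrightarrow> g analytic_on {z}" "\<And>z. norm z < R' \<Longrightarrow> g z \<noteq> 0"
    unfolding g_def using nonzero_mero_zero_free[OF nzF ord0 R] by blast
  have "g analytic_on ball 0 R'"
    using R'(2) by (subst analytic_on_analytic_at) auto
  then have "g holomorphic_on ball 0 R'"
    by (rule analytic_imp_holomorphic)
  then obtain L where L: "L holomorphic_on ball 0 R'" "\<And>z. z \<in> ball 0 R' \<Longrightarrow> exp (L z) = g z"
    by (rule holomorphic_logarithm_exists[of "ball 0 R'" g 0, rotated 2])
      (use R' R in auto)
  define k where "k = (\<lambda>a z. (of_real (R\<^sup>2) - cnj a * z) / of_real R)"
  have k_pos: "Re (k a z) > 0" if "a \<in> S" "norm z \<le> R" for a z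
    using blaschke_denominator(1)[OF lt[OF that(1)] that(2)] R by (simp add: k_def Re_divide_of_real)
  then have k_nz: "k a z \<noteq> 0" if "a \<in> S" "norm z \<le> R" for a z
    using that by (metis less_irrefl zero_complex.sel(1))
  have k_nonneg: "k a z \<notin> \<real>\<^sub>\<le>\<^sub>0" if "a \<in> S" "norm z \<le> R" for a z
    using k_pos[OF that] by (auto simp: complex_nonpos_Reals_iff)
  have k_cont: "continuous_on A (k a)" "k a holomorphic_on A" for a A
    unfolding k_def using R by (auto intro!: continuous_intros holomorphic_intros)
  define h where "h = (\<lambda>z. L z + (\<Sum>a\<in>S. of_int (m a) * Ln (k a z)))"
  have L_cont: "continuous_on (cball 0 R) L" "L holomorphic_on ball 0 R"
    using L(1) R' holomorphic_on_imp_continuous_on[OF L(1)]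
    by (auto elim: continuous_on_subset holomorphic_on_subset)
  have h1: "continuous_on (cball 0 R) h"
    unfolding h_def
    by (intro continuous_intros continuous_on_Ln' L_cont k_cont) (auto simp: k_nonneg)
  have h2: "h holomorphic_on ball 0 R"
    unfolding h_def
    by (intro holomorphic_intros holomorphic_on_Ln' L_cont k_cont) (auto simp: k_nonneg)
  have exp_h: "exp (h z) = g z * (\<Prod>a\<in>S. k a z powi m a)" if "norm z \<le> R" for z
  proof -
    have "exp (h z) = exp (L z) * (\<Prod>a\<in>S. exp (of_int (m a) * Ln (k a z)))"
      unfolding h_def exp_add exp_sum[OF fin] ..
    also have "\<dots> = g z * (\<Prod>a\<in>S. k a z powi m a)"
      using that R' k_nz by (subst L(2)) (auto simp: exp_power_int[symmetric] intro!: prod.cong)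
    finally show ?thesis .
  qed
  have h3: "f z = exp (h z) * (\<Prod>a\<in>S. blaschke R a z powi m a)"
    if z: "norm z \<le> R" "z \<notin> singular_points f" for z
  proof -
    have zS: "z \<noteq> a" if "a \<in> S" for a
      using that z(2) zorder_nonzero_imp_singular[OF f, of a] by (auto simp: S_def)
    have "p analytic_on {z}"
      unfolding p_def using zS by (intro analytic_intros) auto
    then have "F analytic_on {z}"
      unfolding F_def using z(2) by (intro analytic_intros) (auto simp: singular_points_def)
    then have "g z = F z" by (simp add: g_def)
    then have "exp (h z) * (\<Prod>a\<in>S. blaschke R a z powi m a) =
        f z * (\<Prod>a\<in>S. (z - a) powi (- m a) * k a z powi m a * blaschke R a z powi m a)"
      unfolding exp_h[OF z(1)] by (simp add: F_def p_def prod.distrib)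
    also have "(\<Prod>a\<in>S. (z - a) powi (- m a) * k a z powi m a * blaschke R a z powi m a) = 1"
    proof (rule prod.neutral, rule ballI)
      fix a assume a: "a \<in> S"
      have "k a z * blaschke R a z = z - a"
        using blaschke_denominator(2)[OF lt[OF a] z(1)] R by (simp add: k_def blaschke_def)
      then have "k a z powi m a * blaschke R a z powi m a = (z - a) powi m a"
        by (simp add: power_int_mult_distrib[symmetric])
      then show "(z - a) powi (- m a) * k a z powi m a * blaschke R a z powi m a = 1"
        using zS[OF a] by (simp add: mult.assoc power_int_minus)
    qed
    finally show ?thesis by simp
  qed
  \<comment> \<open>\<open>g\<close> fills in the removable singularities of \<open>F\<close>, so
    its value at 0 is read off as the limit of \<open>F\<close>.\<close>
  have "g \<midarrow>0\<rightarrow> g 0"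
    using R'(1) R'(2)[of 0] R by (auto intro!: isContD analytic_at_imp_isCont)
  then have "F \<midarrow>0\<rightarrow> g 0"
    using nonzero_mero_isolated(1)[OF nzF] by (simp add: g_def)
  moreover have "F \<midarrow>0\<rightarrow> zor_poly f 0 0 * (\<Prod>a\<in>S-{0}. (- a) powi (- m a))"
    unfolding F_def m_def
    by (rule leading_coeff_limit[OF f S_def R]) (simp add: p_def m_def)
  ultimately have g0: "g 0 = zor_poly f 0 0 * (\<Prod>a\<in>S-{0}. (- a) powi (- m a))"
    by (rule LIM_unique)
  have zp: "zor_poly f 0 0 \<noteq> 0"
    using zorder_exist[OF nonzero_mero_isolated[OF f] nonzero_mero_frequently[OF f], of 0] by blast
  have ln_powi: "ln (x powi n) = of_int n * ln x" if "x > 0" for x :: real and n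
    using that by (simp add: ln_realpow power_int_def ln_inverse)
  have "Re (h 0) = ln (norm (exp (h 0)))" by simp
  also have "norm (exp (h 0)) = norm (zor_poly f 0 0) * (\<Prod>a\<in>S-{0}. norm a powi (- m a)) * (\<Prod>a\<in>S. R powi m a)"
    using exp_h[of 0] R g0 
    by (simp add: norm_mult prod_norm[symmetric] norm_power_int k_def power2_eq_square)
  also have "ln \<dots> = ln (norm (zor_poly f 0 0)) + (\<Sum>a\<in>S-{0}. ln (norm a powi (- m a))) + (\<Sum>a\<in>S. ln (R powi m a))"
  proof -
    have 1: "(\<Prod>a\<in>S-{0}. norm a powi (- m a)) > 0" "(\<Prod>a\<in>S. R powi m a) > 0"
      using R by (auto intro!: prod_pos zero_less_power_int)
    have 2: "ln (\<Prod>a\<in>S-{0}. norm a powi (- m a)) = (\<Sum>a\<in>S-{0}. ln (norm a powi (- m a)))"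
      "ln (\<Prod>a\<in>S. R powi m a) = (\<Sum>a\<in>S. ln (R powi m a))"
      using fin R by (auto intro!: ln_prod)
    have 3: "ln (x * y * z) = ln x + ln y + ln z" if "x > 0" "y > 0" "z > 0" for x y z :: real
      using that by (simp add: ln_mult)
    show ?thesis
      unfolding 2[symmetric] using 1 zp by (intro 3) auto
  qed
  also have "(\<Sum>a\<in>S-{0}. ln (norm a powi (- m a))) = (\<Sum>a\<in>S-{0}. - of_int (m a) * ln (norm a))"
    by (intro sum.cong) (auto simp: ln_powi)
  also have "\<dots> = (\<Sum>a\<in>S. - of_int (m a) * (if a = 0 then 0 else ln (norm a)))"
    using fin by (intro sum.mono_neutral_cong_left) auto
  also have "ln (norm (zor_poly f 0 0)) + \<dots> + (\<Sum>a\<in>S. ln (R powi m a)) =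
     ln (norm (zor_poly f 0 0)) + (\<Sum>a\<in>S. of_int (m a) * ln (R / (if a = 0 then 1 else norm a)))"
    using R unfolding add.assoc sum.distrib[symmetric]
    by (intro arg_cong2[where f = "(+)"] sum.cong refl) (auto simp: ln_powi ln_div algebra_simps)
  also have "(\<Sum>a\<in>S. of_int (m a) * ln (R / (if a = 0 then 1 else norm a))) = Nsum (\<lambda>a. of_int (zorder f a)) R"
    by (simp add: Nsum_def S_def m_def)
  finally have h4: "Re (h 0) = ln (norm (zor_poly f 0 0)) + Nsum (\<lambda>a. of_int (zorder f a)) R" .
  show ?thesis
    using that[OF h1 h2 _ h4] h3 by (simp add: S_def m_def)
qed

section \<open>Jensen's formula and the first main theorem\<close>

lemma log_plus_nonneg [simp]: "log_plus x \<ge> 0"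
  by (simp add: log_plus_def)

lemma log_plus_eq_max: "x > 0 \<Longrightarrow> log_plus x = max 0 (ln x)"
  by (auto simp: log_plus_def max_def)

lemma ln_le_log_plus: "x > 0 \<Longrightarrow> ln x \<le> log_plus x"
  by (simp add: log_plus_eq_max)

lemma log_plus_mono: "x \<le> y \<Longrightarrow> log_plus x \<le> log_plus y"
  by (simp add: log_plus_def)

lemma ln_eq_log_plus_diff: "x > 0 \<Longrightarrow> ln x = log_plus x - log_plus (1 / x)"
  by (auto simp: log_plus_eq_max ln_div)

lemma log_plus_mult:
  assumes "x \<ge> 0" "y \<ge> 0"
  shows "log_plus (x * y) \<le> log_plus x + log_plus y"
proof -
  have "max 1 (x * y) \<le> max 1 x * max 1 y"
    using assms mult_mono[of 1 "max 1 x" 1 "max 1 y"] mult_mono[of x "max 1 x" y "max 1 y"] by auto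
  then have "ln (max 1 (x * y)) \<le> ln (max 1 x * max 1 y)" by (subst ln_le_cancel_iff) auto
  also have "\<dots> = ln (max 1 x) + ln (max 1 y)" by (intro ln_mult_pos) auto
  finally show ?thesis by (simp add: log_plus_def)
qed

lemma continuous_on_log_plus [continuous_intros]:
  "continuous_on A g \<Longrightarrow> continuous_on A (\<lambda>x. log_plus (g x))"
  unfolding log_plus_def by (intro continuous_intros) auto

lemma proximity_eq_circle_mean: "proximity f r = circle_mean (\<lambda>z. log_plus (norm (f z))) r"
  by (simp add: proximity_def circle_mean_def)

lemma proximity_nonneg: "proximity f r \<ge> 0"
  unfolding proximity_eq_circle_mean by (rule circle_mean_nonneg) simp

lemma analytic_radius_continuous:
  assumes "analytic_radius f r" shows "continuous_on (sphere 0 r) f"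
  using assms analytic_at_imp_isCont
  by (auto simp: analytic_radius_def intro!: continuous_at_imp_continuous_on)

lemmas regular_radius_continuous = analytic_radius_continuous[OF regular_imp_analytic_radius]

lemma regular_radius_not_singular:
  "regular_radius f r \<Longrightarrow> norm z = r \<Longrightarrow> z \<notin> singular_points f"
  by (auto simp: regular_radius_def singular_points_def)

lemma norm_blaschke_prod_eq_1:
  assumes "nonzero_mero f" "regular_radius f R" "norm z = R"
  shows "norm (\<Prod>a | norm a \<le> R \<and> zorder f a \<noteq> 0. blaschke R a z powi zorder f a) = 1"
proof -
  have "norm (blaschke R a z powi zorder f a) = 1" if "norm a \<le> R" "zorder f a \<noteq> 0" for a
  proof -
    have "norm a < R"
      using that regular_radius_zorder[OF assms(1,2), of a] by fastforce
    then show ?thesis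
      using norm_blaschke_eq_1[OF _ assms(3)] by (simp add: norm_power_int)
  qed
  then show ?thesis by (simp add: prod_norm[symmetric])
qed

text \<open>The Blaschke product has modulus 1 on the circle, so ln |f| = Re h there, and the
  Poisson kernel at the centre is 1; the mean is therefore Re (h 0).\<close>

theorem jensen_formula:
  assumes f: "nonzero_mero f" and reg: "regular_radius f R"
  shows "circle_mean (\<lambda>z. ln (norm (f z))) R =
           ln (norm (zor_poly f 0 0)) + Nsum (\<lambda>a. of_int (zorder f a)) R"
proof -
  obtain h where h: "continuous_on (cball 0 R) h" "h holomorphic_on ball 0 R"
    "\<And>z. norm z \<le> R \<Longrightarrow> z \<notin> singular_points f \<Longrightarrow>
       f z = exp (h z) * (\<Prod>a | norm a \<le> R \<and> zorder f a \<noteq> 0. blaschke R a z powi zorder f a)"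
    "Re (h 0) = ln (norm (zor_poly f 0 0)) + Nsum (\<lambda>a. of_int (zorder f a)) R"
    using blaschke_factorization[OF f reg] by blast
  have R: "R > 0" by (rule regular_radius_pos[OF reg])
  have "circle_mean (\<lambda>z. ln (norm (f z))) R = circle_mean (\<lambda>w. Re (h w) * ((R\<^sup>2 - (norm (0::complex))\<^sup>2) / (norm (w - 0))\<^sup>2)) R"
  proof (rule circle_mean_cong)
    fix z :: complex assume z: "norm z = R"
    have "norm (f z) = exp (Re (h z))"
      using h(3)[OF _ regular_radius_not_singular[OF reg z]] z norm_blaschke_prod_eq_1[OF f reg z]
      by (simp add: norm_mult)
    then show "ln (norm (f z)) = Re (h z) * ((R\<^sup>2 - (norm (0::complex))\<^sup>2) / (norm (z - 0))\<^sup>2)"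
      using z R by simp
  qed (use R in simp)
  also have "\<dots> = Re (h 0)"
    using R by (intro poisson_formula[OF h(1,2)]) simp
  finally show ?thesis using h(4) by simp
qed

section \<open>Poisson integrals and the Poisson-Jensen inequality\<close>

definition poisson_mean :: "(complex \<Rightarrow> real) \<Rightarrow> real \<Rightarrow> complex \<Rightarrow> real" where
  "poisson_mean u R z = circle_mean (\<lambda>w. u w * ((R\<^sup>2 - (norm z)\<^sup>2) / (norm (w - z))\<^sup>2)) R"

lemma poisson_kernel_continuous:
  assumes "norm z < R"
  shows "continuous_on (sphere 0 R) (\<lambda>w. (R\<^sup>2 - (norm z)\<^sup>2) / (norm (w - z))\<^sup>2)"
  using assms by (intro continuous_intros) auto

lemma poisson_kernel_nonneg:
  assumes "norm z < R"
  shows "(R\<^sup>2 - (norm z)\<^sup>2) / (norm (w - z))\<^sup>2 \<ge> 0"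
  using assms by (intro divide_nonneg_nonneg) (auto intro!: power_mono)

text \<open>As Blaschke factors have modulus at most 1 in the disc, the zeros of f contribute
  nonpositive terms, which are dropped; the poles contribute the sum. The right side is nonnegative,
  so log+ may replace ln.\<close>

lemma log_plus_le_poisson:
  assumes f: "nonzero_mero f" and reg: "regular_radius f R"
    and z: "norm z < R" "z \<notin> singular_points f"
  shows "log_plus (norm (f z)) \<le> poisson_mean (\<lambda>w. log_plus (norm (f w))) R z
     + (\<Sum>a | norm a \<le> R \<and> zorder f a < 0. of_int (- zorder f a) * (- ln (norm (blaschke R a z))))"
proof -
  define S where "S = {a. norm a \<le> R \<and> zorder f a \<noteq> 0}"
  have fin: "finite S" using finite_zorder_cball[OF f, of R] by (simp add: S_def)
  obtain h where h: "continuous_on (cball 0 R) h" "h holomorphic_on ball 0 R"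
    "\<And>z. norm z \<le> R \<Longrightarrow> z \<notin> singular_points f \<Longrightarrow>
       f z = exp (h z) * (\<Prod>a\<in>S. blaschke R a z powi zorder f a)"
    using blaschke_factorization[OF f reg] unfolding S_def by blast
  have R: "R > 0" by (rule regular_radius_pos[OF reg])
  have lt: "norm a < R" if "a \<in> S" for a
    using that regular_radius_zorder[OF f reg, of a] by (force simp: S_def)
  have nz: "blaschke R a z \<noteq> 0" if "a \<in> S" for a
    using blaschke_denominator(2)[OF lt[OF that], of z] z R that zorder_nonzero_imp_singular[OF f, of z]
    by (auto simp: blaschke_def S_def)
  have ln_powi: "ln (x powi n) = of_int n * ln x" if "x > 0" for x :: real and n
    using that by (simp add: ln_realpow power_int_def ln_inverse)
  have fz: "f z = exp (h z) * (\<Prod>a\<in>S. blaschke R a z powi zorder f a)"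
    using z by (intro h(3)) auto
  have ln_le_0: "ln (norm (blaschke R a z)) \<le> 0" if "a \<in> S" for a
    using norm_blaschke_le_1[OF lt[OF that], of z] z nz[OF that] by simp
  have "ln (norm (f z)) = Re (h z) + ln (\<Prod>a\<in>S. norm (blaschke R a z) powi zorder f a)"
    unfolding fz using nz fin
    by (subst norm_mult, subst ln_mult_pos)
      (auto simp: prod_norm[symmetric] norm_power_int intro!: prod_pos zero_less_power_int)
  also have "ln (\<Prod>a\<in>S. norm (blaschke R a z) powi zorder f a) = (\<Sum>a\<in>S. ln (norm (blaschke R a z) powi zorder f a))"
    using fin nz by (intro ln_prod) auto
  also have "\<dots> = (\<Sum>a\<in>S. of_int (zorder f a) * ln (norm (blaschke R a z)))"
    using nz by (intro sum.cong refl ln_powi) auto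
  also have "\<dots> \<le> (\<Sum>a\<in>S. if zorder f a < 0 then of_int (- zorder f a) * (- ln (norm (blaschke R a z))) else 0)"
    using ln_le_0 by (intro sum_mono) (auto intro: mult_nonneg_nonpos)
  also have "\<dots> = (\<Sum>a | norm a \<le> R \<and> zorder f a < 0. of_int (- zorder f a) * (- ln (norm (blaschke R a z))))"
    using fin by (intro sum.mono_neutral_cong_right) (auto simp: S_def)
  also have "Re (h z) \<le> poisson_mean (\<lambda>w. log_plus (norm (f w))) R z"
  proof -
    have "Re (h z) = circle_mean (\<lambda>w. Re (h w) * ((R\<^sup>2 - (norm z)\<^sup>2) / (norm (w - z))\<^sup>2)) R"
      by (rule poisson_formula[symmetric, OF h(1,2) z(1)])
    also have "\<dots> \<le> poisson_mean (\<lambda>w. log_plus (norm (f w))) R z"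
      unfolding poisson_mean_def
    proof (rule circle_mean_mono)
      have "continuous_on (sphere 0 R) h"
        using h(1) by (rule continuous_on_subset) auto
      then show "continuous_on (sphere 0 R) (\<lambda>w. Re (h w) * ((R\<^sup>2 - (norm z)\<^sup>2) / (norm (w - z))\<^sup>2))"
        by (intro continuous_on_mult continuous_on_Re poisson_kernel_continuous z)
      show "continuous_on (sphere 0 R) (\<lambda>w. log_plus (norm (f w)) * ((R\<^sup>2 - (norm z)\<^sup>2) / (norm (w - z))\<^sup>2))"
        by (intro continuous_on_mult continuous_on_log_plus continuous_on_norm regular_radius_continuous
            poisson_kernel_continuous z reg)
      fix w :: complex assume w: "norm w = R"
      have "norm (f w) = exp (Re (h w))"
        using h(3)[OF _ regular_radius_not_singular[OF reg w]] w norm_blaschke_prod_eq_1[OF f reg w]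
        by (simp add: norm_mult S_def)
      then have "Re (h w) \<le> log_plus (norm (f w))"
        by (simp add: log_plus_eq_max)
      then show "Re (h w) * ((R\<^sup>2 - (norm z)\<^sup>2) / (norm (w - z))\<^sup>2) \<le>
          log_plus (norm (f w)) * ((R\<^sup>2 - (norm z)\<^sup>2) / (norm (w - z))\<^sup>2)"
        by (intro mult_right_mono poisson_kernel_nonneg z)
    qed (use R in simp)
    finally show ?thesis .
  qed
  finally have *: "ln (norm (f z)) \<le> poisson_mean (\<lambda>w. log_plus (norm (f w))) R z
     + (\<Sum>a | norm a \<le> R \<and> zorder f a < 0. of_int (- zorder f a) * (- ln (norm (blaschke R a z))))"
    (is "_ \<le> ?X + ?Y") by simp
  have "?X \<ge> 0"
    unfolding poisson_mean_def
    by (intro circle_mean_nonneg mult_nonneg_nonneg poisson_kernel_nonneg z log_plus_nonneg)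
  moreover have "?Y \<ge> 0"
    using ln_le_0 by (intro sum_nonneg mult_nonneg_nonneg) (auto simp: S_def)
  moreover have "f z \<noteq> 0" using z by (auto simp: singular_points_def)
  ultimately show ?thesis
    using * by (simp add: log_plus_eq_max)
qed

text \<open>The kernel is symmetric in the two angles, so after exchanging the integrals the inner
  one is Poisson's formula for the constant 1.\<close>

lemma poisson_mean_average:
  assumes u: "continuous_on (sphere 0 R) u" and r: "0 \<le> r" "r < R"
  shows "continuous_on (sphere 0 r) (poisson_mean u R)" (is ?cont)
    and "circle_mean (poisson_mean u R) r = circle_mean u R" (is ?eq)
proof -
  define K where "K = (\<lambda>\<phi> \<theta>. (R\<^sup>2 - r\<^sup>2) / (norm (R * cis \<theta> - r * cis \<phi>))\<^sup>2)"
  have sepc: "complex_of_real R * cis b \<noteq> complex_of_real r * cis a" for a b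
  proof
    assume "complex_of_real R * cis b = complex_of_real r * cis a"
    then have "norm (complex_of_real R * cis b) = norm (complex_of_real r * cis a)" by simp
    then show False using r by (simp add: norm_mult)
  qed
  have sep: "norm w < norm v \<Longrightarrow> v - w \<noteq> 0" for v w :: complex by auto
  show ?cont
  proof -
    have "continuous_on (sphere 0 r) (\<lambda>z. integral (cbox 0 (2 * pi)) (\<lambda>\<theta>. u (R * cis \<theta>) * ((R\<^sup>2 - (norm z)\<^sup>2) / (norm (R * cis \<theta> - z))\<^sup>2)))"
    proof (rule integral_continuous_on_param, unfold case_prod_unfold)
      show "continuous_on (sphere 0 r \<times> cbox 0 (2 * pi))
         (\<lambda>x. u (R * cis (snd x)) * ((R\<^sup>2 - (norm (fst x))\<^sup>2) / (norm (R * cis (snd x) - fst x))\<^sup>2))"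
        using r by (intro continuous_intros continuous_on_compose2[OF u])
          (auto simp: norm_mult dest!: sep[of "fst _" "_ * cis (snd _)", rotated] intro!: sep)
    qed
    then show ?thesis
      unfolding poisson_mean_def circle_mean_def cbox_interval
      by (intro continuous_on_mult continuous_on_const)
  qed
  have swap: "integral {0..2 * pi} (\<lambda>\<phi>. integral {0..2 * pi} (\<lambda>\<theta>. u (R * cis \<theta>) * K \<phi> \<theta>)) =
     integral {0..2 * pi} (\<lambda>\<theta>. integral {0..2 * pi} (\<lambda>\<phi>. u (R * cis \<theta>) * K \<phi> \<theta>))"
  proof -
    have "continuous_on (cbox (0, 0) (2 * pi, 2 * pi)) (\<lambda>(\<phi>, \<theta>). u (R * cis \<theta>) * K \<phi> \<theta>)"
      unfolding case_prod_unfold K_def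
      using r by (intro continuous_intros continuous_on_compose2[OF u])
        (auto simp: norm_mult sepc)
    from integral_swap_continuous[OF this] show ?thesis by simp
  qed
  have K1: "integral {0..2 * pi} (\<lambda>\<phi>. K \<phi> \<theta>) = 2 * pi" for \<theta>
  proof -
    have "Re (1::complex) = circle_mean (\<lambda>w. Re 1 * ((R\<^sup>2 - (norm (r * cis \<theta>))\<^sup>2) / (norm (w - r * cis \<theta>))\<^sup>2)) R"
      using r by (intro poisson_formula[symmetric]) (auto simp: norm_mult)
    then have "integral {0..2 * pi} (\<lambda>\<phi>. (R\<^sup>2 - r\<^sup>2) / (norm (R * cis \<phi> - r * cis \<theta>))\<^sup>2) = 2 * pi"
      by (simp add: circle_mean_def norm_mult field_simps)
    also have "(\<lambda>\<phi>. (R\<^sup>2 - r\<^sup>2) / (norm (R * cis \<phi> - r * cis \<theta>))\<^sup>2) = (\<lambda>\<phi>. K \<phi> \<theta>)"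
    proof
      fix \<phi> :: real
      have trig: "(sin \<phi>)\<^sup>2 = 1 - (cos \<phi>)\<^sup>2" "(sin \<theta>)\<^sup>2 = 1 - (cos \<theta>)\<^sup>2"
        by (simp_all add: sin_squared_eq)
      have "(norm (R * cis \<phi> - r * cis \<theta>))\<^sup>2 = (norm (R * cis \<theta> - r * cis \<phi>))\<^sup>2"
        unfolding cmod_power2 by (simp add: power2_diff power_mult_distrib trig algebra_simps)
      then show "(R\<^sup>2 - r\<^sup>2) / (norm (R * cis \<phi> - r * cis \<theta>))\<^sup>2 = K \<phi> \<theta>"
        by (simp add: K_def)
    qed
    finally show ?thesis .
  qed
  have "circle_mean (poisson_mean u R) r =
     1 / (2 * pi) * (1 / (2 * pi) * integral {0..2 * pi} (\<lambda>\<phi>. integral {0..2 * pi} (\<lambda>\<theta>. u (R * cis \<theta>) * K \<phi> \<theta>)))"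
    unfolding poisson_mean_def circle_mean_def K_def using r by (simp add: norm_mult)
  also have "\<dots> = 1 / (2 * pi) * (1 / (2 * pi) * integral {0..2 * pi} (\<lambda>\<theta>. u (R * cis \<theta>) * (2 * pi)))"
    unfolding swap integral_mult_right K1 ..
  also have "\<dots> = circle_mean u R"
    by (simp add: circle_mean_def)
  finally show ?eq .
qed

text \<open>Jensen's formula for the Blaschke factor at the radii r and R; at R the modulus is 1 and
  the mean is 0. The difference is the growth from r to R of the integrated count of the single
  point a.\<close>

lemma circle_mean_ln_blaschke:
  assumes a: "norm a < R" and r: "0 < r" "r \<le> R" "norm a \<noteq> r"
  shows "circle_mean (\<lambda>z. - ln (norm (blaschke R a z))) r =
     Nsum (\<lambda>z. if z = a then 1 else 0) R - Nsum (\<lambda>z. if z = a then 1 else 0) r"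
proof -
  note nz = nonzero_mero_blaschke[OF a]
  have R: "R > 0" using r by simp
  have ord: "Nsum (\<lambda>z. of_int (zorder (blaschke R a) z)) s = Nsum (\<lambda>z. if z = a then 1 else 0) s"
    if s: "0 < s" "s \<le> R" for s
  proof (rule Nsum_cong)
    fix z :: complex assume z: "norm z \<le> s"
    show "of_int (zorder (blaschke R a) z) = (if z = a then 1 else 0 :: real)"
    proof (cases "norm z < R")
      case True
      then show ?thesis using zorder_blaschke[OF a True] by simp
    next
      case False
      then have "norm z = R" using z s by simp
      then show ?thesis
        using regular_radius_zorder[OF nz regular_radius_blaschke[OF a R order_refl], of z] a by auto
    qed
  qed
  have J: "circle_mean (\<lambda>z. ln (norm (blaschke R a z))) s = ln (norm (zor_poly (blaschke R a) 0 0)) + Nsum (\<lambda>z. if z = a then 1 else 0) s"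
    if "0 < s" "s \<le> R" "norm a \<noteq> s" for s
    using jensen_formula[OF nz regular_radius_blaschke[OF a that]] ord[OF that(1,2)] by simp
  have "circle_mean (\<lambda>z. ln (norm (blaschke R a z))) R = circle_mean (\<lambda>z. 0) R"
    using norm_blaschke_eq_1[OF a] R by (intro circle_mean_cong) auto
  then have "0 = ln (norm (zor_poly (blaschke R a) 0 0)) + Nsum (\<lambda>z. if z = a then 1 else 0) R"
    using J[of R] a R by simp
  moreover have "circle_mean (\<lambda>z. - ln (norm (blaschke R a z))) r = - circle_mean (\<lambda>z. ln (norm (blaschke R a z))) r"
    using circle_mean_cmult[of "-1"] by simp
  ultimately show ?thesis using J[OF r] by simp
qed

text \<open>\<open>is_pole\<close> is tested first because \<open>zorder\<close> of the zero
  function is unspecified and a coefficient of P may vanish identically.\<close>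

definition pole_order :: "(complex \<Rightarrow> complex) \<Rightarrow> complex \<Rightarrow> real" where
  "pole_order f z = (if is_pole f z then of_int (- zorder f z) else 0)"

definition zero_order :: "(complex \<Rightarrow> complex) \<Rightarrow> complex \<Rightarrow> real" where
  "zero_order f z = max 0 (of_int (zorder f z))"

lemma pole_order_pos:
  assumes "f meromorphic_on UNIV" "is_pole f z"
  shows "pole_order f z \<ge> 1"
proof -
  have "isolated_singularity_at f z"
    using assms(1) meromorphic_at_iff meromorphic_on_subset by blast
  from isolated_pole_imp_neg_zorder[OF this assms(2)] show ?thesis
    using assms(2) by (simp add: pole_order_def)
qed

lemma pole_order_nonneg: "f meromorphic_on UNIV \<Longrightarrow> pole_order f z \<ge> 0"
  using pole_order_pos[of f z] by (cases "is_pole f z") (auto simp: pole_order_def)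

lemma pole_order_eq_max:
  assumes "nonzero_mero f"
  shows "pole_order f z = max 0 (of_int (- zorder f z))"
proof -
  have "is_pole f z \<longleftrightarrow> zorder f z < 0"
    using isolated_pole_imp_neg_zorder[OF nonzero_mero_isolated(1)[OF assms], of z]
      zorder_neg_imp_is_pole[OF nonzero_mero_imp_meromorphic[OF assms] nonzero_mero_eventually[OF assms], of z]
    by blast
  then show ?thesis by (simp add: pole_order_def max_def)
qed

lemma zorder_eq_diff:
  "nonzero_mero f \<Longrightarrow> of_int (zorder f z) = zero_order f z - pole_order f z"
  by (simp add: pole_order_eq_max zero_order_def)

lemma locally_finite_weight_poles:
  assumes "f meromorphic_on UNIV" "\<And>a. \<not> is_pole f a \<Longrightarrow> w a = 0"
  shows "locally_finite_weight w"
  unfolding locally_finite_weight_def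
proof
  fix r
  show "finite {a. norm a \<le> r \<and> w a \<noteq> 0}"
    by (rule finite_subset[OF _ finite_nonanalytic_cball[OF assms(1), of r]])
      (use assms(2) analytic_at_imp_no_pole in blast)
qed

lemma locally_finite_weight_pole_order:
  "f meromorphic_on UNIV \<Longrightarrow> locally_finite_weight (pole_order f)"
  by (erule locally_finite_weight_poles) (simp add: pole_order_def)

lemma locally_finite_weight_zero_order:
  assumes "nonzero_mero f"
  shows "locally_finite_weight (zero_order f)"
  by (rule locally_finite_weight_subset[OF locally_finite_weight_zorder[OF assms]])
    (auto simp: zero_order_def)

lemma counting_N_eq_Nsum:
  assumes f: "f meromorphic_on UNIV" and r: "r > 0"
  shows "counting_N f r = Nsum (pole_order f) r"
  unfolding counting_N_def
proof (rule integrated_count_eq_Nsum[OF locally_finite_weight_pole_order[OF f] r])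
  fix t
  have "{a. norm a \<le> t \<and> pole_order f a \<noteq> 0} = poles_within f t"
    using pole_order_pos[OF f] by (force simp: poles_within_def pole_order_def)
  then show "pole_count f t = (\<Sum>a | norm a \<le> t \<and> pole_order f a \<noteq> 0. pole_order f a)"
    unfolding pole_count_def by (auto simp: poles_within_def pole_order_def intro!: sum.cong)
qed

lemma reduced_counting_N_eq_Nsum:
  assumes f: "f meromorphic_on UNIV" and r: "r > 0"
  shows "reduced_counting_N f r = Nsum (\<lambda>z. if is_pole f z then 1 else 0) r"
  unfolding reduced_counting_N_def
proof (rule integrated_count_eq_Nsum[OF locally_finite_weight_poles[OF f] r])
  fix t
  have "{a. norm a \<le> t \<and> (if is_pole f a then 1 else 0 :: real) \<noteq> 0} = poles_within f t"
    by (auto simp: poles_within_def)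
  then show "reduced_pole_count f t = (\<Sum>a | norm a \<le> t \<and> (if is_pole f a then 1 else 0 :: real) \<noteq> 0. if is_pole f a then 1 else 0)"
    unfolding reduced_pole_count_def by (auto simp: poles_within_def)
qed auto

lemma nevanlinna_T_eq:
  "f meromorphic_on UNIV \<Longrightarrow> r > 0 \<Longrightarrow> nevanlinna_T f r = proximity f r + Nsum (pole_order f) r"
  by (simp add: nevanlinna_T_def counting_N_eq_Nsum)

lemma first_main_theorem:
  assumes f: "nonzero_mero f" and reg: "regular_radius f r"
  shows "nevanlinna_T f r = circle_mean (\<lambda>z. log_plus (norm (1 / f z))) r + Nsum (zero_order f) r
    + ln (norm (zor_poly f 0 0))"
proof -
  have r: "r > 0" by (rule regular_radius_pos[OF reg])
  have nz: "f z \<noteq> 0" if "norm z = r" for z using reg that by (auto simp: regular_radius_def)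
  have cont: "continuous_on (sphere 0 r) f" by (rule regular_radius_continuous[OF reg])
  have "circle_mean (\<lambda>z. ln (norm (f z))) r =
      circle_mean (\<lambda>z. log_plus (norm (f z)) - log_plus (norm (1 / f z))) r"
    using r nz by (intro circle_mean_cong) (auto simp: ln_eq_log_plus_diff norm_divide)
  also have "\<dots> = proximity f r - circle_mean (\<lambda>z. log_plus (norm (1 / f z))) r"
    unfolding proximity_eq_circle_mean
    using r nz by (intro circle_mean_diff continuous_intros cont) auto
  finally have "proximity f r = circle_mean (\<lambda>z. log_plus (norm (1 / f z))) r
      + ln (norm (zor_poly f 0 0)) + Nsum (\<lambda>a. of_int (zorder f a)) r"
    using jensen_formula[OF f reg] by simp
  also have "Nsum (\<lambda>a. of_int (zorder f a)) r = Nsum (zero_order f) r - Nsum (pole_order f) r"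
    unfolding zorder_eq_diff[OF f]
    by (intro Nsum_diff locally_finite_weight_zero_order f locally_finite_weight_pole_order
        nonzero_mero_imp_meromorphic)
  finally show ?thesis
    using r by (simp add: nevanlinna_T_eq[OF nonzero_mero_imp_meromorphic[OF f]])
qed

text \<open>Averaging the Poisson-Jensen inequality over |z| = r gives m(r,f) \<le> m(R,f) + N(R,f)
  - N(r,f): the Poisson integral keeps its mean, and each pole contributes the growth of its own
  count.\<close>

theorem nevanlinna_T_mono:
  assumes f: "nonzero_mero f" and reg: "regular_radius f r" "regular_radius f R" and "r < R"
  shows "nevanlinna_T f r \<le> nevanlinna_T f R"
proof -
  have r: "0 < r" "0 < R" using reg regular_radius_pos by auto
  define S where "S = {a. norm a \<le> R \<and> zorder f a < 0}"
  have fin: "finite S"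
    unfolding S_def by (rule finite_subset[OF _ finite_zorder_cball[OF f, of R]]) auto
  have lt: "norm a < R" "norm a \<noteq> r" if "a \<in> S" for a
    using that regular_radius_zorder[OF f reg(1), of a] regular_radius_zorder[OF f reg(2), of a]
    by (force simp: S_def)+
  let ?u = "\<lambda>w. log_plus (norm (f w))"
  have u: "continuous_on (sphere 0 s) ?u" if "regular_radius f s" for s
    by (intro continuous_intros regular_radius_continuous that)
  have B: "continuous_on (sphere 0 r) (\<lambda>z. - ln (norm (blaschke R a z)))" if "a \<in> S" for a
    using regular_radius_blaschke[OF lt(1)[OF that] r(1) _ lt(2)[OF that]] \<open>r < R\<close>
    by (auto intro!: continuous_intros regular_radius_continuous simp: regular_radius_def)
  have "proximity f r \<le> circle_mean (\<lambda>z. poisson_mean ?u R z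
     + (\<Sum>a\<in>S. of_int (- zorder f a) * (- ln (norm (blaschke R a z))))) r"
    unfolding proximity_eq_circle_mean
  proof (rule circle_mean_mono)
    show "continuous_on (sphere 0 r) (\<lambda>z. poisson_mean ?u R z
     + (\<Sum>a\<in>S. of_int (- zorder f a) * (- ln (norm (blaschke R a z)))))"
      using r \<open>r < R\<close>
      by (intro continuous_on_add continuous_on_sum continuous_on_mult continuous_on_const B
          poisson_mean_average(1) u reg) auto
    show "?u z \<le> poisson_mean ?u R z + (\<Sum>a\<in>S. of_int (- zorder f a) * (- ln (norm (blaschke R a z))))"
      if "norm z = r" for z
      unfolding S_def using that \<open>r < R\<close>
      by (intro log_plus_le_poisson[OF f reg(2)] regular_radius_not_singular[OF reg(1)]) auto
  qed (use r u reg in auto)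
  also have "\<dots> = circle_mean (poisson_mean ?u R) r
     + (\<Sum>a\<in>S. of_int (- zorder f a) * circle_mean (\<lambda>z. - ln (norm (blaschke R a z))) r)"
  proof -
    have c1: "continuous_on (sphere 0 r) (poisson_mean ?u R)"
      using r \<open>r < R\<close> by (intro poisson_mean_average(1) u reg) auto
    have c2: "continuous_on (sphere 0 r) (\<lambda>z. of_int (- zorder f a) * (- ln (norm (blaschke R a z))))"
      if "a \<in> S" for a
      by (intro continuous_on_mult continuous_on_const B that)
    show ?thesis
      using r by (subst circle_mean_add[OF c1 continuous_on_sum[OF c2]])
        (auto simp only: circle_mean_sum[OF c2] circle_mean_cmult)
  qed
  also have "circle_mean (poisson_mean ?u R) r = proximity f R"
    unfolding proximity_eq_circle_mean using r \<open>r < R\<close> by (intro poisson_mean_average(2) u reg) auto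
  also have "(\<Sum>a\<in>S. of_int (- zorder f a) * circle_mean (\<lambda>z. - ln (norm (blaschke R a z))) r) =
     (\<Sum>a\<in>S. of_int (- zorder f a) * Nsum (\<lambda>z. if z = a then 1 else 0) R)
     - (\<Sum>a\<in>S. of_int (- zorder f a) * Nsum (\<lambda>z. if z = a then 1 else 0) r)"
    unfolding sum_subtractf[symmetric] right_diff_distrib[symmetric]
    using lt r \<open>r < R\<close> by (intro sum.cong refl arg_cong2[where f = "(*)"] circle_mean_ln_blaschke) auto
  finally have main: "proximity f r \<le> proximity f R +
     ((\<Sum>a\<in>S. of_int (- zorder f a) * Nsum (\<lambda>z. if z = a then 1 else 0) R)
     - (\<Sum>a\<in>S. of_int (- zorder f a) * Nsum (\<lambda>z. if z = a then 1 else 0) r))" .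
  have Ns: "(\<Sum>a\<in>S. of_int (- zorder f a) * Nsum (\<lambda>z. if z = a then 1 else 0) s) = Nsum (pole_order f) s"
    if "s \<le> R" for s
  proof -
    have lf: "locally_finite_weight (\<lambda>z. if z = a then 1 else 0)" for a
      by (auto simp: locally_finite_weight_def)
    have "(\<Sum>a\<in>S. of_int (- zorder f a) * Nsum (\<lambda>z. if z = a then 1 else 0) s)
       = Nsum (\<lambda>z. \<Sum>a\<in>S. of_int (- zorder f a) * (if z = a then 1 else 0)) s"
      by (subst Nsum_sum) (auto simp only: Nsum_cmult[symmetric] intro!: lf locally_finite_weight_cmult)
    also have "\<dots> = Nsum (pole_order f) s"
    proof (rule Nsum_cong)
      fix z :: complex assume "norm z \<le> s"
      then show "(\<Sum>a\<in>S. of_int (- zorder f a) * (if z = a then 1 else 0)) = pole_order f z"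
        using fin \<open>s \<le> R\<close> by (auto simp: pole_order_eq_max[OF f] S_def if_distrib[of "\<lambda>x. _ * x"] cong: if_cong)
    qed
    finally show ?thesis .
  qed
  show ?thesis
    using main r \<open>r < R\<close> unfolding Ns[OF order_refl] Ns[OF less_imp_le[OF \<open>r < R\<close>]]
    by (simp add: nevanlinna_T_eq[OF nonzero_mero_imp_meromorphic[OF f]])
qed

section \<open>The logarithmic derivative\<close>

lemma lmeasurable_UN_summable:
  fixes A :: "nat \<Rightarrow> 'a::euclidean_space set"
  assumes "\<And>n. A n \<in> lmeasurable" "summable (\<lambda>n. measure lebesgue (A n))"
  shows "(\<Union>n. A n) \<in> lmeasurable"
proof (rule fmeasurableI)
  show "(\<Union>n. A n) \<in> sets lebesgue" using assms(1) by (auto intro: fmeasurableD)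
  have "emeasure lebesgue (\<Union>n. A n) \<le> (\<Sum>n. emeasure lebesgue (A n))"
    using assms(1) by (intro emeasure_subadditive_countably) (auto intro: fmeasurableD)
  also have "\<dots> = (\<Sum>n. ennreal (measure lebesgue (A n)))"
    using assms(1) by (simp add: emeasure_eq_measure2)
  also have "\<dots> < \<infinity>"
    using assms(2) by (simp add: suminf_ennreal2)
  finally show "emeasure lebesgue (\<Union>n. A n) < \<infinity>" .
qed

lemma lmeasurable_UN_intervals:
  fixes c d :: "nat \<Rightarrow> real"
  assumes "summable d" "\<And>n. d n \<ge> 0"
  shows "(\<Union>n. {c n - d n..c n + d n}) \<in> lmeasurable"
proof (rule lmeasurable_UN_summable)
  have "measure lebesgue {c n - d n..c n + d n} = 2 * d n" for n
    using assms(2)[of n] by simp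
  then show "summable (\<lambda>n. measure lebesgue {c n - d n..c n + d n})"
    using assms(1) by (simp add: summable_mult)
qed auto

lemma countable_imp_lmeasurable:
  fixes A :: "'a::euclidean_space set" shows "countable A \<Longrightarrow> A \<in> lmeasurable"
  by (intro negligible_imp_measurable)
    (simp add: negligible_iff_null_sets null_sets_completionI countable_imp_null_set_lborel)

text \<open>The part of the exceptional set where \<open>2 ^ j \<le> U < 2 ^ (j + 1)\<close> has diameter at most \<open>2 ^ (- j)\<close>.\<close>

lemma borel_growth_lemma:
  fixes U :: "real \<Rightarrow> real"
  assumes mono: "\<And>r s. 1 \<le> r \<Longrightarrow> r \<le> s \<Longrightarrow> U r \<le> U s" and ge1: "\<And>r. U r \<ge> 1"
  shows "\<exists>E\<in>lmeasurable. \<forall>r\<ge>1. r \<notin> E \<longrightarrow> U (r + 1 / U r) \<le> 2 * U r"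
proof -
  define B where "B = (\<lambda>j::nat. {r. r \<ge> 1 \<and> 2 * U r < U (r + 1 / U r) \<and> 2 ^ j \<le> U r \<and> U r < 2 ^ Suc j})"
  \<comment> \<open>If \<open>B j\<close> is empty, \<open>c j\<close> is arbitrary, and its
    interval only adds to a summable total length.\<close>
  define c where "c = (\<lambda>j. SOME r. r \<in> B j)"
  define E where "E = (\<Union>j. {c j - (1/2) ^ j..c j + (1/2) ^ j})"
  \<comment> \<open>A point s of \<open>B j\<close> beyond r + 2^(-j) would satisfy s \<ge> r + 1 /
    U r, hence U s > 2 U r \<ge> 2^(j+1), which \<open>B j\<close> forbids.\<close>
  have close: "s \<le> r + (1/2) ^ j" if "r \<in> B j" "s \<in> B j" for r s j
  proof (rule ccontr)
    assume "\<not> s \<le> r + (1/2) ^ j"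
    moreover have "1 / U r \<le> (1/2) ^ j"
      using that(1) ge1[of r] by (simp add: B_def field_simps power_one_over)
    ultimately have "U (r + 1 / U r) \<le> U s"
      using that ge1[of r] by (intro mono) (auto simp: B_def add_increasing2)
    then show False using that by (auto simp: B_def)
  qed
  have "E \<in> lmeasurable"
    unfolding E_def by (intro lmeasurable_UN_intervals) (auto simp: summable_geometric)
  moreover have "U (r + 1 / U r) \<le> 2 * U r" if "r \<ge> 1" "r \<notin> E" for r
  proof (rule ccontr)
    assume bad: "\<not> U (r + 1 / U r) \<le> 2 * U r"
    define j where "j = nat \<lfloor>log 2 (U r)\<rfloor>"
    have "2 ^ j \<le> U r \<and> U r < 2 ^ Suc j"
    proof -
      have l0: "0 \<le> log 2 (U r)" using ge1[of r] by simp
      then have "real j \<le> log 2 (U r)" "log 2 (U r) < real j + 1"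
        unfolding j_def by linarith+
      then show ?thesis
        using ge1[of r] by (simp add: le_log_iff log_less_iff powr_realpow powr_add)
    qed
    then have rB: "r \<in> B j" using bad that by (auto simp: B_def)
    then have cB: "c j \<in> B j" unfolding c_def by (rule someI)
    have "r \<in> E"
      using close[OF rB cB] close[OF cB rB] by (auto simp: E_def intro!: exI[of _ j])
    with that show False by simp
  qed
  ultimately show ?thesis by blast
qed

text \<open>The counting function of \<open>A\<close> takes distinct positive integer values on the set of moduli,
  so the squares of their reciprocals are summable.\<close>

lemma exceptional_set_near_moduli:
  fixes A :: "complex set"
  assumes fin: "\<And>r. finite (A \<inter> cball 0 r)"
  shows "\<exists>E\<in>lmeasurable. \<forall>r. r \<notin> E \<longrightarrow> (\<forall>a\<in>A. \<bar>r - norm a\<bar> > 1 / (real (card (A \<inter> cball 0 (norm a))))\<^sup>2)"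
proof -
  define n where "n = (\<lambda>s. card (A \<inter> cball 0 s))"
  define c where "c = (\<lambda>j. SOME s. s \<in> norm ` A \<and> n s = j)"
  \<comment> \<open>For \<open>j = 0\<close> the division by zero gives an interval of radius
    0.\<close>
  define E where "E = (\<Union>j. {c j - 1 / (real j)\<^sup>2..c j + 1 / (real j)\<^sup>2})"
  have less: "n s < n t" if "s \<in> norm ` A" "t \<in> norm ` A" "s < t" for s t
  proof -
    from that(2) obtain a where a: "a \<in> A" "norm a = t" by auto
    have "A \<inter> cball 0 s \<subset> A \<inter> cball 0 t"
    proof (rule psubsetI)
      show "A \<inter> cball 0 s \<subseteq> A \<inter> cball 0 t" using \<open>s < t\<close> by auto
      have "a \<in> A \<inter> cball 0 t" "a \<notin> A \<inter> cball 0 s" using a \<open>s < t\<close> by auto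
      then show "A \<inter> cball 0 s \<noteq> A \<inter> cball 0 t" by blast
    qed
    then show ?thesis unfolding n_def by (rule psubset_card_mono[OF fin])
  qed
  have "E \<in> lmeasurable"
    unfolding E_def
    using inverse_power_summable[of 2, where 'a = real]
    by (intro lmeasurable_UN_intervals) (auto simp: field_simps)
  moreover have "\<bar>r - norm a\<bar> > 1 / (real (n (norm a)))\<^sup>2" if "r \<notin> E" "a \<in> A" for r a
  proof (rule ccontr)
    assume *: "\<not> \<bar>r - norm a\<bar> > 1 / (real (n (norm a)))\<^sup>2"
    define j where "j = n (norm a)"
    have "c j \<in> norm ` A \<and> n (c j) = j"
      unfolding c_def by (rule someI[of _ "norm a"]) (use that in \<open>auto simp: j_def\<close>)
    then have "c j = norm a"
      using less[of "c j" "norm a"] less[of "norm a" "c j"] that by (force simp: j_def)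
    then have "r \<in> {c j - 1 / (real j)\<^sup>2..c j + 1 / (real j)\<^sup>2}"
      using * by (auto simp: j_def)
    then show False using that by (auto simp: E_def)
  qed
  ultimately show ?thesis unfolding n_def by blast
qed

section \<open>Differentiating the Blaschke factorization\<close>

lemma has_field_derivative_prod_powi:
  fixes u :: "'a \<Rightarrow> complex \<Rightarrow> complex"
  assumes "finite S" "\<And>a. a \<in> S \<Longrightarrow> (u a has_field_derivative u' a) (at z)" "\<And>a. a \<in> S \<Longrightarrow> u a z \<noteq> 0"
  shows "((\<lambda>w. \<Prod>a\<in>S. u a w powi m a) has_field_derivative
     ((\<Prod>a\<in>S. u a z powi m a) * (\<Sum>a\<in>S. of_int (m a) * (u' a / u a z)))) (at z)"
  using assms
proof (induction S rule: finite_induct)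
  case (insert x F)
  have "((\<lambda>w. u x w powi m x) has_field_derivative of_int (m x) * u x z powi (m x - 1) * u' x) (at z)"
    using insert.prems by (intro DERIV_power_int) auto
  also have "of_int (m x) * u x z powi (m x - 1) * u' x = u x z powi m x * (of_int (m x) * (u' x / u x z))"
    using insert.prems(2)[of x] by (simp add: power_int_diff field_simps)
  finally have D: "((\<lambda>w. u x w powi m x) has_field_derivative u x z powi m x * (of_int (m x) * (u' x / u x z))) (at z)" .
  have "((\<lambda>w. u x w powi m x * (\<Prod>a\<in>F. u a w powi m a)) has_field_derivative
     u x z powi m x * ((\<Prod>a\<in>F. u a z powi m a) * (\<Sum>a\<in>F. of_int (m a) * (u' a / u a z)))
     + u x z powi m x * (of_int (m x) * (u' x / u x z)) * (\<Prod>a\<in>F. u a z powi m a)) (at z)"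
    by (rule DERIV_mult'[OF D insert.IH]) (use insert.prems in auto)
  then show ?case
    using insert.hyps by (simp add: algebra_simps)
qed simp

lemma blaschke_log_derivative:
  assumes "norm a < R" "norm z \<le> R" "z \<noteq> a"
  shows "(blaschke R a has_field_derivative
     blaschke R a z * (1 / (z - a) + cnj a / (of_real (R\<^sup>2) - cnj a * z))) (at z)"
proof -
  have R: "R > 0" using assms(1) norm_ge_zero[of a] by linarith
  note nz = blaschke_denominator(2)[OF assms(1,2)]
  have "(blaschke R a has_field_derivative
     (of_real R * (of_real (R\<^sup>2) - cnj a * z) - of_real R * (z - a) * (- cnj a)) / (of_real (R\<^sup>2) - cnj a * z)\<^sup>2) (at z)"
    unfolding blaschke_def using nz
    by (auto intro!: derivative_eq_intros simp: power2_eq_square)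
  also have "(of_real R * (of_real (R\<^sup>2) - cnj a * z) - of_real R * (z - a) * (- cnj a)) / (of_real (R\<^sup>2) - cnj a * z)\<^sup>2
     = blaschke R a z * (1 / (z - a) + cnj a / (of_real (R\<^sup>2) - cnj a * z))"
  proof -
    have "(X * D - X * y * (- e)) / D\<^sup>2 = X * y / D * (1 / y + e / D)" if "D \<noteq> 0" "y \<noteq> 0" for X D y e :: complex
      using that by (simp add: field_simps power2_eq_square)
    from this[OF nz, of "z - a" "of_real R" "cnj a"] assms(3) show ?thesis
      by (simp add: blaschke_def)
  qed
  finally show ?thesis .
qed

lemma eventually_nhds_regular:
  assumes "z \<notin> singular_points f"
  shows "eventually (\<lambda>w. w \<notin> singular_points f) (nhds z)"
proof -
  have an: "f analytic_on {z}" "f z \<noteq> 0" using assms by (auto simp: singular_points_def)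
  from an(1) obtain S where S: "open S" "z \<in> S" "f holomorphic_on S"
    by (auto simp: analytic_at)
  have "eventually (\<lambda>w. w \<in> S) (nhds z)"
    using S by (intro eventually_nhds_in_open)
  then have "eventually (\<lambda>w. f analytic_on {w}) (nhds z)"
    by (rule eventually_mono) (use S in \<open>auto simp: analytic_at\<close>)
  moreover have "(f \<longlongrightarrow> f z) (nhds z)"
    using analytic_at_imp_isCont[OF an(1)] by (simp add: isCont_def tendsto_at_iff_tendsto_nhds)
  then have "eventually (\<lambda>w. f w \<noteq> 0) (nhds z)"
    using an(2) by (rule tendsto_imp_eventually_ne)
  ultimately show ?thesis
    by eventually_elim (auto simp: singular_points_def)
qed

text \<open>Logarithmic differentiation of the factorization gives h' and, for every zero or pole a,
  ord f times 1/(z - a) + cnj a/(R^2 - cnj a z). These two terms are at most 1/\<delta> and 1/(R -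
  |z|), and h' is controlled by the mean of |Re h|, where Re h is ln |f| on the circle.\<close>

lemma log_derivative_pointwise:
  assumes f: "nonzero_mero f" and reg: "regular_radius f R"
    and z: "norm z < R" "z \<notin> singular_points f"
    and \<delta>: "\<delta> > 0" "\<And>a. norm a \<le> R \<Longrightarrow> zorder f a \<noteq> 0 \<Longrightarrow> \<delta> \<le> norm (z - a)"
  shows "norm (deriv f z / f z) \<le> 2 * R / (R - norm z)\<^sup>2 * circle_mean (\<lambda>w. \<bar>ln (norm (f w))\<bar>) R
     + (\<Sum>a | norm a \<le> R \<and> zorder f a \<noteq> 0. \<bar>of_int (zorder f a)\<bar>) * (1 / \<delta> + 1 / (R - norm z))"
proof -
  define S where "S = {a. norm a \<le> R \<and> zorder f a \<noteq> 0}"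
  have fin: "finite S" using finite_zorder_cball[OF f, of R] by (simp add: S_def)
  obtain h where h: "continuous_on (cball 0 R) h" "h holomorphic_on ball 0 R"
    "\<And>z. norm z \<le> R \<Longrightarrow> z \<notin> singular_points f \<Longrightarrow>
       f z = exp (h z) * (\<Prod>a\<in>S. blaschke R a z powi zorder f a)"
    using blaschke_factorization[OF f reg] unfolding S_def by blast
  have R: "R > 0" by (rule regular_radius_pos[OF reg])
  have lt: "norm a < R" if "a \<in> S" for a
    using that regular_radius_zorder[OF f reg, of a] by (force simp: S_def)
  have ne: "z \<noteq> a" if "a \<in> S" for a
    using that \<delta>(2)[of a] \<delta>(1) by (auto simp: S_def)
  have nz: "blaschke R a z \<noteq> 0" if "a \<in> S" for a
    using blaschke_denominator(2)[OF lt[OF that], of z] z R ne[OF that] by (auto simp: blaschke_def)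
  define l where "l = (\<lambda>a. 1 / (z - a) + cnj a / (of_real (R\<^sup>2) - cnj a * z))"
  define Q where "Q = (\<lambda>w. \<Prod>a\<in>S. blaschke R a w powi zorder f a)"
  have "(Q has_field_derivative Q z * (\<Sum>a\<in>S. of_int (zorder f a) * (blaschke R a z * l a / blaschke R a z))) (at z)"
    unfolding Q_def
    by (rule has_field_derivative_prod_powi[OF fin])
      (use blaschke_log_derivative lt ne nz z in \<open>auto simp: l_def\<close>)
  also have "(\<Sum>a\<in>S. of_int (zorder f a) * (blaschke R a z * l a / blaschke R a z)) = (\<Sum>a\<in>S. of_int (zorder f a) * l a)"
    using nz by (intro sum.cong) auto
  finally have DQ: "(Q has_field_derivative Q z * (\<Sum>a\<in>S. of_int (zorder f a) * l a)) (at z)" .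
  have Dh: "(h has_field_derivative deriv h z) (at z)"
    using h(2) z by (intro holomorphic_derivI[of h "ball 0 R"]) auto
  have "((\<lambda>w. exp (h w) * Q w) has_field_derivative
     exp (h z) * (Q z * (\<Sum>a\<in>S. of_int (zorder f a) * l a)) + exp (h z) * deriv h z * Q z) (at z)"
    by (rule DERIV_mult'[OF DERIV_chain2[OF DERIV_exp Dh] DQ])
  moreover have ev: "eventually (\<lambda>w. exp (h w) * Q w = f w) (nhds z)"
  proof -
    have "eventually (\<lambda>w. w \<in> ball 0 R) (nhds z)"
      using z by (intro eventually_nhds_in_open) auto
    with eventually_nhds_regular[OF z(2)] show ?thesis
      by eventually_elim (use h(3) in \<open>auto simp: Q_def\<close>)
  qed
  ultimately have "(f has_field_derivative
     exp (h z) * (Q z * (\<Sum>a\<in>S. of_int (zorder f a) * l a)) + exp (h z) * deriv h z * Q z) (at z)"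
    using DERIV_cong_ev[OF refl ev refl] by simp
  then have "deriv f z = exp (h z) * (Q z * (\<Sum>a\<in>S. of_int (zorder f a) * l a)) + exp (h z) * deriv h z * Q z"
    by (rule DERIV_imp_deriv)
  moreover have "f z = exp (h z) * Q z" "f z \<noteq> 0"
    using h(3)[of z] z by (auto simp: Q_def singular_points_def)
  ultimately have eq: "deriv f z / f z = deriv h z + (\<Sum>a\<in>S. of_int (zorder f a) * l a)"
    by (simp add: field_simps)
  have 1: "norm (deriv h z) \<le> 2 * R / (R - norm z)\<^sup>2 * circle_mean (\<lambda>w. \<bar>ln (norm (f w))\<bar>) R"
  proof -
    have "circle_mean (\<lambda>w. \<bar>Re (h w)\<bar>) R = circle_mean (\<lambda>w. \<bar>ln (norm (f w))\<bar>) R"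
    proof (rule circle_mean_cong)
      fix w :: complex assume w: "norm w = R"
      have "norm (f w) = exp (Re (h w))"
        using h(3)[OF _ regular_radius_not_singular[OF reg w]] w norm_blaschke_prod_eq_1[OF f reg w]
        by (simp add: norm_mult S_def)
      then show "\<bar>Re (h w)\<bar> = \<bar>ln (norm (f w))\<bar>" by simp
    qed (use R in simp)
    then show ?thesis using norm_deriv_le_circle_mean[OF h(1,2) z(1)] by simp
  qed
  have l: "norm (l a) \<le> 1 / \<delta> + 1 / (R - norm z)" if a: "a \<in> S" for a
  proof -
    have "norm (1 / (z - a)) \<le> 1 / \<delta>"
      using \<delta>(2)[of a] \<delta>(1) a by (auto simp: S_def norm_divide intro!: divide_left_mono mult_pos_pos)
    moreover have "norm (cnj a / (of_real (R\<^sup>2) - cnj a * z)) \<le> 1 / (R - norm z)"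
    proof -
      have "R * (R - norm z) = R\<^sup>2 - R * norm z" by (simp add: power2_eq_square algebra_simps)
      also have "\<dots> \<le> R\<^sup>2 - norm a * norm z"
        using lt[OF a] by (intro diff_mono mult_right_mono) auto
      also have "\<dots> = norm (complex_of_real (R\<^sup>2)) - norm (cnj a * z)"
        by (simp add: norm_mult norm_power)
      also have "\<dots> \<le> norm (of_real (R\<^sup>2) - cnj a * z)"
        by (rule norm_triangle_ineq2)
      finally have "R * (R - norm z) \<le> norm (of_real (R\<^sup>2) - cnj a * z)" .
      moreover have "R * (R - norm z) > 0" using R z by simp
      ultimately have "norm a / norm (of_real (R\<^sup>2) - cnj a * z) \<le> R / (R * (R - norm z))"
        using lt[OF a] R by (intro frac_le) auto
      then show ?thesis using R by (simp add: norm_divide)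
    qed
    ultimately show ?thesis
      unfolding l_def by (intro order_trans[OF norm_triangle_ineq]) linarith
  qed
  have "norm (\<Sum>a\<in>S. of_int (zorder f a) * l a) \<le> (\<Sum>a\<in>S. \<bar>of_int (zorder f a)\<bar> * (1 / \<delta> + 1 / (R - norm z)))"
    using l by (intro sum_norm_le) (auto simp: norm_mult intro!: mult_left_mono)
  also have "\<dots> = (\<Sum>a\<in>S. \<bar>of_int (zorder f a)\<bar>) * (1 / \<delta> + 1 / (R - norm z))"
    by (simp add: sum_distrib_right)
  finally show ?thesis
    unfolding eq S_def[symmetric] using 1
    by (intro order_trans[OF norm_triangle_ineq]) linarith
qed

text \<open>|ln x| = log+ x + log+ (1/x). The first mean is at most T, and by the first main theorem
  the second is at most T up to a constant.\<close>

lemma circle_mean_abs_ln_le: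
  assumes f: "nonzero_mero f" and reg: "regular_radius f r" and r: "r \<ge> 1"
  shows "circle_mean (\<lambda>w. \<bar>ln (norm (f w))\<bar>) r \<le> 2 * nevanlinna_T f r + \<bar>ln (norm (zor_poly f 0 0))\<bar>"
proof -
  have nz: "f z \<noteq> 0" if "norm z = r" for z using reg that by (auto simp: regular_radius_def)
  have cont: "continuous_on (sphere 0 r) f" by (rule regular_radius_continuous[OF reg])
  have "circle_mean (\<lambda>w. \<bar>ln (norm (f w))\<bar>) r = circle_mean (\<lambda>z. log_plus (norm (f z)) + log_plus (norm (1 / f z))) r"
  proof (rule circle_mean_cong)
    fix w :: complex assume "norm w = r"
    then have "norm (f w) > 0" using nz by simp
    then show "\<bar>ln (norm (f w))\<bar> = log_plus (norm (f w)) + log_plus (norm (1 / f w))"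
      by (simp add: log_plus_eq_max norm_divide ln_div)
  qed (use r in simp)
  also have "\<dots> = proximity f r + circle_mean (\<lambda>z. log_plus (norm (1 / f z))) r"
    unfolding proximity_eq_circle_mean
    using r nz by (intro circle_mean_add continuous_intros cont) auto
  finally show ?thesis
    using first_main_theorem[OF f reg] r
      Nsum_nonneg[of "zero_order f" r] Nsum_nonneg[of "pole_order f" r]
      pole_order_nonneg[OF nonzero_mero_imp_meromorphic[OF f]]
      nevanlinna_T_eq[OF nonzero_mero_imp_meromorphic[OF f], of r]
    by (auto simp: zero_order_def)
qed

lemma nevanlinna_T_nonneg:
  "f meromorphic_on UNIV \<Longrightarrow> r \<ge> 1 \<Longrightarrow> nevanlinna_T f r \<ge> 0"
  using Nsum_nonneg[of "pole_order f" r] proximity_nonneg[of f r] pole_order_nonneg[of f]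
  by (simp add: nevanlinna_T_eq)

lemma Nsum_zero_order_le:
  assumes f: "nonzero_mero f" and reg: "regular_radius f r"
  shows "Nsum (zero_order f) r \<le> nevanlinna_T f r + \<bar>ln (norm (zor_poly f 0 0))\<bar>"
  using first_main_theorem[OF f reg] circle_mean_nonneg[of "\<lambda>z. log_plus (norm (1 / f z))" r] by auto

lemma Nsum_pole_order_le:
  assumes "f meromorphic_on UNIV" "r > 0"
  shows "Nsum (pole_order f) r \<le> nevanlinna_T f r"
  using nevanlinna_T_eq[OF assms] proximity_nonneg[of f r] by simp

text \<open>|ord f| is the sum of the zero order and the pole order, and each of these has an
  integrated count of at most T up to a constant.\<close>

lemma zero_pole_count_le:
  assumes f: "nonzero_mero f" and reg: "regular_radius f R" and \<rho>: "1 \<le> \<rho>" "\<rho> \<le> R"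
  shows "(\<Sum>a | norm a \<le> \<rho> \<and> zorder f a \<noteq> 0. \<bar>of_int (zorder f a)\<bar>) * ln (R / \<rho>)
    \<le> 2 * nevanlinna_T f R + \<bar>ln (norm (zor_poly f 0 0))\<bar>"
proof -
  let ?w = "\<lambda>a. \<bar>real_of_int (zorder f a)\<bar>"
  have lf: "locally_finite_weight ?w"
    by (rule locally_finite_weight_subset[OF locally_finite_weight_zorder[OF f]]) auto
  have "(\<Sum>a | norm a \<le> \<rho> \<and> zorder f a \<noteq> 0. ?w a) * ln (R / \<rho>) \<le> Nsum ?w R"
    using Nsum_ge_count[OF lf _ \<rho>] by simp
  also have "Nsum ?w R = Nsum (\<lambda>a. zero_order f a + pole_order f a) R"
    by (intro Nsum_cong) (auto simp: pole_order_eq_max[OF f] zero_order_def)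
  also have "Nsum (\<lambda>a. zero_order f a + pole_order f a) R = Nsum (zero_order f) R + Nsum (pole_order f) R"
    by (intro Nsum_add locally_finite_weight_zero_order f locally_finite_weight_pole_order
        nonzero_mero_imp_meromorphic)
  also have "\<dots> \<le> 2 * nevanlinna_T f R + \<bar>ln (norm (zor_poly f 0 0))\<bar>"
    using Nsum_zero_order_le[OF f reg] Nsum_pole_order_le[OF nonzero_mero_imp_meromorphic[OF f], of R] \<rho>
    by simp
  finally show ?thesis .
qed

text \<open>Borel's lemma asks for monotonicity over all radii from 1 on, while
  \<open>nevanlinna_T_mono\<close> compares regular radii only. The supremum is finite because T at
  a regular radius beyond r bounds it.\<close>

lemma nevanlinna_T_monotone_majorant:
  assumes f: "nonzero_mero f"
  obtains U where "\<And>r s. r \<le> s \<Longrightarrow> U r \<le> U s" "\<And>r. U r \<ge> 1"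
    "\<And>r. 1 \<le> r \<Longrightarrow> regular_radius f r \<Longrightarrow> U r = max 1 (nevanlinna_T f r)"
proof -
  define V where "V = (\<lambda>r. insert 1 (nevanlinna_T f ` {s. 1 \<le> s \<and> s \<le> r \<and> regular_radius f s}))"
  define U where "U = (\<lambda>r. Sup (V r))"
  have bdd: "bdd_above (V r)" for r
  proof -
    obtain R where R: "max 1 r < R" "regular_radius f R"
      by (rule regular_radius_between[OF f, of "max 1 r" "max 1 r + 1"]) auto
    have "nevanlinna_T f s \<le> max 1 (nevanlinna_T f R)" if "1 \<le> s" "s \<le> r" "regular_radius f s" for s
      using nevanlinna_T_mono[OF f that(3) R(2)] that R by auto
    then show ?thesis unfolding V_def by (intro bdd_aboveI[of _ "max 1 (nevanlinna_T f R)"]) auto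
  qed
  show ?thesis
  proof
    show "U r \<le> U s" if "r \<le> s" for r s
      unfolding U_def using that bdd by (intro cSup_subset_mono) (auto simp: V_def)
    show "U r \<ge> 1" for r
      unfolding U_def using bdd by (intro cSup_upper) (auto simp: V_def)
    show "U r = max 1 (nevanlinna_T f r)" if "1 \<le> r" "regular_radius f r" for r
      unfolding U_def
    proof (rule cSup_eq_maximum)
      show "max 1 (nevanlinna_T f r) \<in> V r" using that by (auto simp: V_def max_def)
      fix x assume "x \<in> V r"
      then consider "x = 1" | s where "1 \<le> s" "s \<le> r" "regular_radius f s" "x = nevanlinna_T f s"
        by (auto simp: V_def)
      then show "x \<le> max 1 (nevanlinna_T f r)"
      proof cases
        case 2
        then show ?thesis using nevanlinna_T_mono[OF f 2(3) that(2)] by (cases "s = r") auto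
      qed simp
    qed
  qed
qed

text \<open>Off the intervals of radius \<open>1 / n\<^sup>2\<close> around the moduli of the zeros and poles the sum over the
  zeros and poles in the differentiated factorization is bounded on the whole circle, so no average
  over the circle is needed.\<close>

theorem log_derivative_bound:
  assumes f: "nonzero_mero f"
  shows "\<exists>E\<in>lmeasurable. \<exists>K\<ge>1. \<forall>r\<ge>1. r \<notin> E \<longrightarrow> regular_radius f r \<and>
     (\<forall>z. norm z = r \<longrightarrow> norm (deriv f z / f z) \<le> K * r ^ 3 * max 1 (nevanlinna_T f r) ^ 6)"
proof -
  define A where "A = {a. zorder f a \<noteq> 0}"
  have finA: "finite (A \<inter> cball 0 r)" for r
    using finite_zorder_cball[OF f, of r] by (simp add: A_def Int_def conj_commute)
  obtain U where U: "\<And>r s. r \<le> s \<Longrightarrow> U r \<le> U s" "\<And>r. U r \<ge> 1"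
    "\<And>r. 1 \<le> r \<Longrightarrow> regular_radius f r \<Longrightarrow> U r = max 1 (nevanlinna_T f r)"
    using nevanlinna_T_monotone_majorant[OF f] by blast
  obtain E1 where E1: "E1 \<in> lmeasurable" "\<And>r. r \<ge> 1 \<Longrightarrow> r \<notin> E1 \<Longrightarrow> U (r + 1 / U r) \<le> 2 * U r"
    using borel_growth_lemma[of U] U by blast
  obtain E2 where E2: "E2 \<in> lmeasurable"
    "\<And>r a. r \<notin> E2 \<Longrightarrow> a \<in> A \<Longrightarrow> \<bar>r - norm a\<bar> > 1 / (real (card (A \<inter> cball 0 (norm a))))\<^sup>2"
    using exceptional_set_near_moduli[OF finA] by blast
  define E3 where "E3 = {r. r > 0 \<and> \<not> regular_radius f r}"
  have E3: "E3 \<in> lmeasurable"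
    unfolding E3_def by (intro countable_imp_lmeasurable countable_nonregular_radii f)
  define C where "C = \<bar>ln (norm (zor_poly f 0 0))\<bar>"
  have C: "C \<ge> 0" by (simp add: C_def)
  \<comment> \<open>\<open>K1\<close> comes from the number of zeros and poles, which is at most (4
    + C) u divided by ln (R/\<rho>) \<ge> 1/(8 u r). The summands of \<open>K\<close> belong to h',
    to the reflected terms 1/(\<rho> - |z|) and to the terms 1/\<delta>, in this order.\<close>
  define K1 where "K1 = 8 * (4 + C)"
  define K where "K = 64 * (4 + C) + 4 * K1 + K1 ^ 3"
  have K1: "K1 \<ge> 1" using C by (simp add: K1_def)
  have K: "K \<ge> 1" using K1 C by (simp add: K_def)
  show ?thesis
  proof (intro bexI[of _ "E1 \<union> E2 \<union> E3"] exI[of _ K] conjI allI impI K)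
    show "E1 \<union> E2 \<union> E3 \<in> lmeasurable" using E1(1) E2(1) E3 by (intro fmeasurable.Un)
  next
    fix r assume r: "r \<ge> 1" "r \<notin> E1 \<union> E2 \<union> E3"
    then show reg: "regular_radius f r" by (auto simp: E3_def)
    fix z :: complex assume z: "norm z = r"
    define u where "u = U r"
    have u: "u \<ge> 1" using U(2) by (simp add: u_def)
    \<comment> \<open>Two radii within Borel's range up to r + 1/u: f is factorized on the disc of
      radius \<rho>, and R serves to count the zeros and poles up to \<rho>. Both gaps, \<rho> - r
      and R - \<rho>, exceed 1/(4 u).\<close>
    obtain \<rho> where \<rho>: "r + 1 / (4 * u) < \<rho>" "\<rho> < r + 1 / (2 * u)" "regular_radius f \<rho>"
      using regular_radius_between[OF f, of "r + 1 / (4 * u)" "r + 1 / (2 * u)"] r u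
      by (auto simp: field_simps)
    obtain R where R: "r + 3 / (4 * u) < R" "R < r + 1 / u" "regular_radius f R"
      using regular_radius_between[OF f, of "r + 3 / (4 * u)" "r + 1 / u"] r u
      by (auto simp: field_simps)
    have inv: "1 / (4 * u) > 0" "1 / (2 * u) = 2 * (1 / (4 * u))" "3 / (4 * u) = 3 * (1 / (4 * u))"
      "1 / u = 4 * (1 / (4 * u))" "1 / u \<le> 1"
      using u by (auto simp: field_simps)
    have ord: "r < \<rho>" "\<rho> < R" "\<rho> \<le> r + 1" "R \<le> r + 1" "1 \<le> \<rho>" "1 \<le> R"
      using \<rho> R inv r by linarith+
    have TU: "nevanlinna_T f s \<le> 2 * u" if "1 \<le> s" "s \<le> r + 1 / u" "regular_radius f s" for s
    proof -
      have "nevanlinna_T f s \<le> U s" using U(3)[OF that(1,3)] by simp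
      also have "\<dots> \<le> U (r + 1 / u)" by (rule U(1)) fact
      also have "\<dots> \<le> 2 * u" using E1(2)[of r] r by (simp add: u_def)
      finally show ?thesis .
    qed
    have "\<rho> \<le> r + 1 / u" "R \<le> r + 1 / u" using \<rho> R ord by linarith+
    then have T\<rho>: "nevanlinna_T f \<rho> \<le> 2 * u" and TR: "nevanlinna_T f R \<le> 2 * u"
      using TU ord \<rho>(3) R(3) by blast+
    define cnt where "cnt = (\<Sum>a | norm a \<le> \<rho> \<and> zorder f a \<noteq> 0. \<bar>real_of_int (zorder f a)\<bar>)"
    have Cu: "4 * u + C \<le> (4 + C) * u"
      using u C mult_left_mono[of 1 u C] by (simp add: algebra_simps)
    have cnt0: "cnt \<ge> 0" unfolding cnt_def by (intro sum_nonneg) auto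
    have cnt: "cnt \<le> K1 * r * u\<^sup>2"
    proof -
      have "1 / (8 * u * r) \<le> ln (R / \<rho>)"
      proof -
        have "1 / (8 * u * r) = (1 / (4 * u)) / (2 * r)" by simp
        also have "\<dots> \<le> (R - \<rho>) / R"
        proof (rule frac_le)
          show "1 / (4 * u) \<le> R - \<rho>" "0 \<le> R - \<rho>" "0 < R" "R \<le> 2 * r"
            using \<rho> R inv ord r by linarith+
        qed
        also have "\<dots> = 1 - \<rho> / R" using ord by (simp add: field_simps)
        also have "\<dots> \<le> - ln (\<rho> / R)" using ln_le_minus_one[of "\<rho> / R"] ord by simp
        also have "\<dots> = ln (R / \<rho>)" using ord by (simp add: ln_div)
        finally show ?thesis .
      qed
      then have "cnt * (1 / (8 * u * r)) \<le> cnt * ln (R / \<rho>)"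
        using cnt0 by (intro mult_left_mono)
      also have "\<dots> \<le> 2 * nevanlinna_T f R + C"
        unfolding cnt_def C_def using ord by (intro zero_pole_count_le[OF f R(3)]) auto
      also have "\<dots> \<le> (4 + C) * u" using TR Cu by linarith
      finally have "cnt \<le> (4 + C) * u * (8 * u * r)"
        using u r by (simp add: field_simps)
      then show ?thesis by (simp add: K1_def power2_eq_square mult_ac)
    qed
    define N where "N = card (A \<inter> cball 0 \<rho>)"
    have N: "real N \<le> cnt"
    proof -
      have "real N = (\<Sum>a\<in>A \<inter> cball 0 \<rho>. 1)" by (simp add: N_def)
      also have "\<dots> \<le> (\<Sum>a\<in>A \<inter> cball 0 \<rho>. \<bar>real_of_int (zorder f a)\<bar>)"
        by (intro sum_mono) (auto simp: A_def)
      also have "A \<inter> cball 0 \<rho> = {a. norm a \<le> \<rho> \<and> zorder f a \<noteq> 0}" by (auto simp: A_def)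
      finally show ?thesis by (simp add: cnt_def)
    qed
    \<comment> \<open>The interval removed around |a| has radius 1/n^2, where n counts the points of
      modulus at most |a|. As n \<le> N, the single distance 1/N^2 works for all points up to
      \<rho>.\<close>
    have sep: "1 / (real N)\<^sup>2 \<le> norm (z - a) \<and> N > 0" if a: "norm a \<le> \<rho>" "zorder f a \<noteq> 0" for a
    proof -
      have "a \<in> A \<inter> cball 0 (norm a)" using a by (auto simp: A_def)
      then have "0 < card (A \<inter> cball 0 (norm a))"
        using card_gt_0_iff finA by blast
      moreover have "card (A \<inter> cball 0 (norm a)) \<le> N"
        unfolding N_def using a by (intro card_mono finA) auto
      ultimately have "1 / (real N)\<^sup>2 \<le> 1 / (real (card (A \<inter> cball 0 (norm a))))\<^sup>2" "N > 0"
        by (auto intro!: divide_left_mono power_mono mult_pos_pos)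
      moreover have "1 / (real (card (A \<inter> cball 0 (norm a))))\<^sup>2 < \<bar>r - norm a\<bar>"
        using E2(2)[of r a] r a by (auto simp: A_def)
      moreover have "\<bar>r - norm a\<bar> \<le> norm (z - a)"
        using norm_triangle_ineq3[of z a] z by simp
      ultimately show ?thesis by linarith
    qed
    \<comment> \<open>Without zeros and poles any positive number serves, whereas 1/0^2 would be
      0.\<close>
    define \<delta> where "\<delta> = (if N = 0 then 1 else 1 / (real N)\<^sup>2)"
    have "norm (deriv f z / f z) \<le> 2 * \<rho> / (\<rho> - norm z)\<^sup>2 * circle_mean (\<lambda>w. \<bar>ln (norm (f w))\<bar>) \<rho>
       + cnt * (1 / \<delta> + 1 / (\<rho> - norm z))"
      unfolding cnt_def
      by (rule log_derivative_pointwise[OF f \<rho>(3)])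
        (use ord z sep regular_radius_not_singular[OF reg] in \<open>auto simp: \<delta>_def\<close>)
    also have "\<dots> \<le> 64 * (4 + C) * r * u ^ 3 + (K1 ^ 3 * r ^ 3 * u ^ 6 + 4 * K1 * r * u ^ 3)"
    proof (rule add_mono)
      have "2 * \<rho> / (\<rho> - norm z)\<^sup>2 \<le> 4 * r / (1 / (4 * u))\<^sup>2"
      proof (rule frac_le)
        have "1 / (4 * u) \<le> \<rho> - norm z" using \<rho> z by linarith
        then show "(1 / (4 * u))\<^sup>2 \<le> (\<rho> - norm z)\<^sup>2"
          using inv(1) by (intro power_mono) linarith+
        show "0 < (1 / (4 * u))\<^sup>2" using inv(1) by (rule zero_less_power)
        show "2 * \<rho> \<le> 4 * r" "0 \<le> 4 * r" using ord r by linarith+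
      qed
      moreover have "circle_mean (\<lambda>w. \<bar>ln (norm (f w))\<bar>) \<rho> \<le> (4 + C) * u"
        using circle_mean_abs_ln_le[OF f \<rho>(3)] ord T\<rho> Cu by (simp add: C_def)
      ultimately have "2 * \<rho> / (\<rho> - norm z)\<^sup>2 * circle_mean (\<lambda>w. \<bar>ln (norm (f w))\<bar>) \<rho> \<le>
         4 * r / (1 / (4 * u))\<^sup>2 * ((4 + C) * u)"
        using ord r by (intro mult_mono circle_mean_nonneg) auto
      also have "\<dots> = 64 * (4 + C) * r * u ^ 3"
        using u by (simp add: field_simps power2_eq_square power3_eq_cube)
      finally show "2 * \<rho> / (\<rho> - norm z)\<^sup>2 * circle_mean (\<lambda>w. \<bar>ln (norm (f w))\<bar>) \<rho> \<le> 64 * (4 + C) * r * u ^ 3" .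
    next
      have "cnt * (1 / \<delta>) \<le> K1 ^ 3 * r ^ 3 * u ^ 6"
      proof (cases "N = 0")
        case True
        then have "{a. norm a \<le> \<rho> \<and> zorder f a \<noteq> 0} = {}" using sep by auto
        then have "cnt = 0" by (simp add: cnt_def)
        then show ?thesis using K1 r u by simp
      next
        case False
        \<comment> \<open>The exponents 3 and 6 of the theorem arise here: 1/\<delta> = N^2 is at
          most \<open>cnt\<close>^2, and \<open>cnt\<close> is at most a constant times r
          u^2.\<close>
        then have "cnt * (1 / \<delta>) = cnt * (real N)\<^sup>2" by (simp add: \<delta>_def)
        also have "\<dots> \<le> cnt * cnt\<^sup>2" using N cnt0 by (intro mult_left_mono power_mono) auto
        also have "\<dots> = cnt ^ 3" by (simp add: power2_eq_square power3_eq_cube)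
        also have "\<dots> \<le> (K1 * r * u\<^sup>2) ^ 3" using cnt cnt0 by (intro power_mono)
        also have "\<dots> = K1 ^ 3 * r ^ 3 * u ^ 6" by (simp add: power_mult_distrib flip: power_mult)
        finally show ?thesis .
      qed
      moreover have "cnt * (1 / (\<rho> - norm z)) \<le> K1 * r * u\<^sup>2 * (4 * u)"
      proof (rule mult_mono[OF cnt])
        have "1 / (\<rho> - norm z) \<le> 1 / (1 / (4 * u))"
        proof (rule divide_left_mono)
          have *: "1 / (4 * u) \<le> \<rho> - norm z" using \<rho> z by linarith
          then show "1 / (4 * u) \<le> \<rho> - norm z" .
          show "0 < (\<rho> - norm z) * (1 / (4 * u))"
            using * inv(1) by (intro mult_pos_pos) linarith+
        qed simp
        then show "1 / (\<rho> - norm z) \<le> 4 * u" by simp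
      qed (use ord z K1 r u in auto)
      moreover have "K1 * r * u\<^sup>2 * (4 * u) = 4 * K1 * r * u ^ 3"
        by (simp add: power2_eq_square power3_eq_cube)
      ultimately show "cnt * (1 / \<delta> + 1 / (\<rho> - norm z)) \<le> K1 ^ 3 * r ^ 3 * u ^ 6 + 4 * K1 * r * u ^ 3"
        by (simp add: distrib_left)
    qed
    also have "\<dots> \<le> K * (r ^ 3 * u ^ 6)"
    proof -
      have "r * u ^ 3 \<le> r ^ 3 * u ^ 6"
        using r u power_increasing[of 1 3 r] power_increasing[of 3 6 u] by (intro mult_mono) auto
      then have "64 * (4 + C) * (r * u ^ 3) \<le> 64 * (4 + C) * (r ^ 3 * u ^ 6)" "4 * K1 * (r * u ^ 3) \<le> 4 * K1 * (r ^ 3 * u ^ 6)"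
        using C K1 by (auto intro!: mult_left_mono)
      then show ?thesis by (simp add: K_def algebra_simps)
    qed
    finally show "norm (deriv f z / f z) \<le> K * r ^ 3 * max 1 (nevanlinna_T f r) ^ 6"
      using U(3)[OF r(1) reg] by (simp add: u_def mult.assoc)
  qed
qed

section \<open>Growth of transcendental functions\<close>

lemma transcendental_imp_nonzero_mero:
  assumes "transcendental_meromorphic f"
  shows "nonzero_mero f"
proof (rule nonzero_meroI)
  show "f meromorphic_on UNIV" using assms by (simp add: transcendental_meromorphic_def)
  show "\<not> (\<forall>\<^sub>\<approx>z\<in>UNIV. f z = 0)"
  proof
    assume *: "\<forall>\<^sub>\<approx>z\<in>UNIV. f z = 0"
    have "rational_meromorphic f"
      unfolding rational_meromorphic_def by (rule exI[of _ 0], rule exI[of _ 1]) (use * in simp)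
    then show False using assms by (simp add: transcendental_meromorphic_def)
  qed
qed

text \<open>Cauchy's estimate on arbitrarily large circles annihilates all Taylor coefficients
  beyond the N-th. The radius r/2 fits the later bound of F on the half disc by its mean on the
  circle of radius r.\<close>

lemma entire_polynomial_growth_imp_polynomial:
  assumes F: "F holomorphic_on UNIV"
    and bd: "\<And>r0. \<exists>r\<ge>r0. \<forall>z. norm z = r / 2 \<longrightarrow> norm (F z) \<le> r ^ N"
  shows "\<exists>p. \<forall>z. F z = poly p z"
proof -
  have zero: "(deriv ^^ n) F 0 = 0" if n: "n > N" for n
  proof (rule ccontr)
    assume nz: "(deriv ^^ n) F 0 \<noteq> 0"
    define c where "c = norm ((deriv ^^ n) F 0)"
    have c: "c > 0" using nz by (simp add: c_def)
    obtain r where r: "r \<ge> max 1 (fact n * 2 ^ n / c + 1)" "\<And>z. norm z = r / 2 \<Longrightarrow> norm (F z) \<le> r ^ N"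
      using bd by blast
    have r1: "r \<ge> 1" "r > 0" using r(1) by auto
    have "c \<le> fact n * r ^ N / (r / 2) ^ n"
      unfolding c_def
      by (rule Cauchy_inequality)
        (use F r1 r(2) in \<open>auto intro: holomorphic_on_subset holomorphic_on_imp_continuous_on\<close>)
    also have "\<dots> = fact n * 2 ^ n * (r ^ N / r ^ n)" by (simp add: power_divide)
    also have "r ^ N / r ^ n \<le> 1 / r"
    proof -
      have "r * r ^ N \<le> r ^ n" using n r1 power_increasing[of "Suc N" n r] by simp
      then show ?thesis using r1 by (simp add: field_simps)
    qed
    finally have "c \<le> fact n * 2 ^ n * (1 / r)" by (simp add: mult_left_mono)
    then have "r \<le> fact n * 2 ^ n / c" using c r1 by (simp add: field_simps)
    then show False using r(1) by auto
  qed
  define p where "p = (\<Sum>n\<le>N. monom ((deriv ^^ n) F 0 / fact n) n)"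
  have "F z = poly p z" for z
  proof -
    have "(\<lambda>n. (deriv ^^ n) F 0 / fact n * (z - 0) ^ n) sums F z"
      by (rule holomorphic_power_series[of _ _ "norm z + 1"])
        (use F in \<open>auto intro: holomorphic_on_subset\<close>)
    moreover have "(\<lambda>n. (deriv ^^ n) F 0 / fact n * (z - 0) ^ n) sums (\<Sum>n\<le>N. (deriv ^^ n) F 0 / fact n * (z - 0) ^ n)"
      by (rule sums_finite) (auto simp: zero)
    ultimately show ?thesis
      unfolding p_def poly_sum poly_monom using sums_unique2 by fastforce
  qed
  then show ?thesis by blast
qed

text \<open>Every pole of modulus at most sqrt r adds at least ln (r / sqrt r) = (ln r)/2 to N(r,f),
  so more than 2 C poles would force T(r,f) \<ge> C ln r for all large r.\<close>

lemma finite_poles_if_slow_growth: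
  assumes f: "f meromorphic_on UNIV"
    and slow: "\<And>r0. \<exists>r\<ge>r0. nevanlinna_T f r < C * ln r"
  shows "finite {z. is_pole f z}"
proof (rule ccontr)
  assume "infinite {z. is_pole f z}"
  then obtain S where S: "finite S" "card S = Suc (nat \<lceil>2 * C\<rceil>)" "S \<subseteq> {z. is_pole f z}"
    using infinite_arbitrarily_large by blast
  obtain M where M: "\<And>a. a \<in> S \<Longrightarrow> norm a \<le> M"
    using finite_imp_bounded[OF S(1)] by (auto simp: bounded_iff)
  obtain r where r: "r \<ge> max 2 (M\<^sup>2)" "nevanlinna_T f r < C * ln r"
    using slow by blast
  define s where "s = sqrt r"
  have s: "s * s = r" "s \<ge> 1" using r(1) by (auto simp: s_def)
  have "M \<le> s" using r(1) by (simp add: s_def real_le_rsqrt)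
  have sr: "s \<le> r" using s mult_left_mono[of 1 s s] by simp
  let ?T = "{a. norm a \<le> s \<and> pole_order f a \<noteq> 0}"
  have fin: "finite ?T"
    using locally_finite_weight_pole_order[OF f] by (auto simp: locally_finite_weight_def)
  have "real (card S) = (\<Sum>a\<in>S. 1)" by simp
  also have "\<dots> \<le> (\<Sum>a\<in>S. pole_order f a)"
    using S(3) pole_order_pos[OF f] by (intro sum_mono) auto
  also have "\<dots> \<le> (\<Sum>a\<in>?T. pole_order f a)"
  proof (rule sum_mono2[OF fin])
    show "S \<subseteq> ?T" using S(3) pole_order_pos[OF f] M \<open>M \<le> s\<close> by force
  qed (use pole_order_nonneg[OF f] in auto)
  finally have cS: "real (card S) \<le> (\<Sum>a\<in>?T. pole_order f a)" .
  have ln_s: "ln (r / s) = ln s" "ln r = 2 * ln s" "ln s > 0"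
  proof -
    show "ln (r / s) = ln s" using s by (simp flip: s(1))
    show "ln r = 2 * ln s" using s by (simp flip: s(1) add: ln_mult)
    then show "ln s > 0" using r(1) by (smt (verit) ln_gt_zero)
  qed
  have "real (card S) * ln s \<le> (\<Sum>a\<in>?T. pole_order f a) * ln (r / s)"
    unfolding ln_s(1) using cS ln_s(3) by (intro mult_right_mono) auto
  also have "\<dots> \<le> Nsum (pole_order f) r"
    by (rule Nsum_ge_count[OF locally_finite_weight_pole_order[OF f] pole_order_nonneg[OF f] s(2) sr])
  also have "\<dots> \<le> nevanlinna_T f r" using r(1) by (intro Nsum_pole_order_le[OF f]) auto
  also have "\<dots> < C * ln r" by (rule r(2))
  finally have "real (card S) * ln s < 2 * C * ln s" using ln_s by simp
  then have "real (card S) < 2 * C" using ln_s(3) by simp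
  then show False unfolding S(2) by linarith
qed

text \<open>Harnack's inequality: the kernel is at most (R + |z|)/(R - |z|), which is at most 3 when
  |z| \<le> R/2.\<close>

lemma poisson_mean_le:
  assumes u: "continuous_on (sphere 0 R) u" "\<And>w. u w \<ge> 0" and z: "norm z \<le> R / 2" and R: "R > 0"
  shows "poisson_mean u R z \<le> 3 * circle_mean u R"
proof -
  have zR: "norm z < R" using z R by simp
  have "poisson_mean u R z \<le> circle_mean (\<lambda>w. 3 * u w) R"
    unfolding poisson_mean_def
  proof (rule circle_mean_mono)
    show "continuous_on (sphere 0 R) (\<lambda>w. u w * ((R\<^sup>2 - (norm z)\<^sup>2) / (norm (w - z))\<^sup>2))"
      by (intro continuous_on_mult u poisson_kernel_continuous zR)
    fix w :: complex assume w: "norm w = R"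
    have "norm (w - z) \<ge> R - norm z" using norm_triangle_ineq2[of w z] w by simp
    then have "(R\<^sup>2 - (norm z)\<^sup>2) / (norm (w - z))\<^sup>2 \<le> (R\<^sup>2 - (norm z)\<^sup>2) / (R - norm z)\<^sup>2"
      using zR by (intro divide_left_mono mult_pos_pos power_mono) (auto intro!: power_mono)
    also have "\<dots> = (R + norm z) / (R - norm z)"
      using zR by (simp add: power2_eq_square square_diff_square_factored)
    also have "\<dots> \<le> 3" using zR z by (simp add: field_simps)
    finally have "u w * ((R\<^sup>2 - (norm z)\<^sup>2) / (norm (w - z))\<^sup>2) \<le> u w * 3"
      using u(2) by (intro mult_left_mono)
    then show "u w * ((R\<^sup>2 - (norm z)\<^sup>2) / (norm (w - z))\<^sup>2) \<le> 3 * u w" by simp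
  qed (use u R in \<open>auto intro!: continuous_intros\<close>)
  then show ?thesis by (simp add: circle_mean_cmult)
qed

lemma log_plus_le_proximity_entire:
  assumes F: "nonzero_mero F" "F analytic_on UNIV" and reg: "regular_radius F R" and z: "norm z \<le> R / 2"
  shows "log_plus (norm (F z)) \<le> 3 * proximity F R"
proof (cases "F z = 0")
  case True
  then show ?thesis using proximity_nonneg[of F R] by (simp add: log_plus_def)
next
  case False
  have R: "R > 0" by (rule regular_radius_pos[OF reg])
  have "F analytic_on {w}" for w using F(2) analytic_on_subset by blast
  then have "\<not> is_pole F w" for w using analytic_at_imp_no_pole by blast
  then have "\<not> zorder F w < 0" for w
    using zorder_neg_imp_is_pole[OF nonzero_mero_imp_meromorphic[OF F(1)] nonzero_mero_eventually[OF F(1)]] by blast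
  then have "log_plus (norm (F z)) \<le> poisson_mean (\<lambda>w. log_plus (norm (F w))) R z"
    using log_plus_le_poisson[OF F(1) reg, of z] z R False \<open>\<And>w. F analytic_on {w}\<close>
    by (simp add: singular_points_def)
  also have "\<dots> \<le> 3 * proximity F R"
    unfolding proximity_eq_circle_mean
    using z R by (intro poisson_mean_le continuous_intros regular_radius_continuous[OF reg]) auto
  finally show ?thesis .
qed

text \<open>The poles are finite in number. A polynomial q removes them and leaves an entire F with
  m(r,F) = O(ln r) for arbitrarily large r, so F is a polynomial.\<close>

lemma rational_if_slow_growth:
  assumes f: "nonzero_mero f"
    and slow: "\<And>r0. \<exists>r\<ge>r0. regular_radius f r \<and> nevanlinna_T f r < C * ln r"
  shows "rational_meromorphic f"
proof -
  note mero = nonzero_mero_imp_meromorphic[OF f]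
  define S where "S = {z. is_pole f z}"
  have fin: "finite S"
    unfolding S_def by (rule finite_poles_if_slow_growth[OF mero, of C]) (use slow in blast)
  define n where "n = (\<lambda>a. nat (- zorder f a))"
  define Q where "Q = (\<Prod>a\<in>S. [:-a, 1:] ^ n a)"
  define q where "q = poly Q"
  have q: "q = (\<lambda>z. \<Prod>a\<in>S. (z - a) ^ n a)"
    by (auto simp: q_def Q_def poly_prod)
  have nzq: "nonzero_mero q"
    unfolding q by (intro nonzero_mero_prod nonzero_mero_power nonzero_mero_linear)
  define F where "F = remove_sings (\<lambda>z. f z * q z)"
  have nzfq: "nonzero_mero (\<lambda>z. f z * q z)" by (intro nonzero_mero_mult f nzq)
  have an: "F analytic_on {z}" for z
  proof -
    have "zorder (\<lambda>z. f z * q z) z = zorder f z + zorder q z"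
      by (intro zorder_mult nonzero_mero_imp_meromorphic nonzero_mero_frequently f nzq)
    also have "zorder q z = (\<Sum>a\<in>S. zorder (\<lambda>z. (z - a) ^ n a) z)"
      unfolding q by (rule zorder_prod)
        (use nonzero_mero_eventually[OF nzq, of z] in \<open>auto intro!: meromorphic_intros simp: q\<close>)
    also have "\<dots> = (\<Sum>a\<in>S. if z = a then int (n a) else 0)"
    proof (rule sum.cong[OF refl])
      fix a
      have "zorder (\<lambda>z. (z - a) ^ n a) z = int (n a) * zorder (\<lambda>z. z - a) z"
        by (intro zorder_power nonzero_mero_imp_meromorphic nonzero_mero_frequently nonzero_mero_linear)
      then show "zorder (\<lambda>z. (z - a) ^ n a) z = (if z = a then int (n a) else 0)"
        by (simp add: zorder_linear)
    qed
    also have "\<dots> = (if z \<in> S then int (n z) else 0)" using fin by simp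
    finally have "zorder (\<lambda>z. f z * q z) z \<ge> 0"
      using pole_order_eq_max[OF f, of z] by (auto simp: S_def n_def pole_order_def split: if_splits)
    then have "\<not> is_pole (\<lambda>z. f z * q z) z"
      using isolated_pole_imp_neg_zorder[OF nonzero_mero_isolated(1)[OF nzfq]] by force
    then obtain c where "(\<lambda>z. f z * q z) \<midarrow>z\<rightarrow> c"
      using nonzero_mero_isolated(2)[OF nzfq, of z] by (auto simp: not_essential_def)
    then show ?thesis
      unfolding F_def by (rule remove_sings_analytic_at[OF nonzero_mero_isolated(1)[OF nzfq]])
  qed
  then have anU: "F analytic_on UNIV" by (subst analytic_on_analytic_at) auto
  have F_eq: "F z = f z * q z" if "f analytic_on {z}" for z
  proof -
    have "(\<lambda>z. f z * q z) analytic_on {z}" unfolding q using that by (intro analytic_intros)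
    then show ?thesis by (simp add: F_def)
  qed
  have nzF: "nonzero_mero F"
  proof -
    obtain s where s: "0 < s" "s < 1" "regular_radius (\<lambda>z. f z * q z) s"
      by (rule regular_radius_between[OF nzfq, of 0 1]) auto
    have "F (of_real s) \<noteq> 0"
      using s by (auto simp: F_def regular_radius_def)
    then show ?thesis by (rule nonzero_mero_analytic[OF anU])
  qed
  define m where "m = (\<Sum>a\<in>S. n a)"
  \<comment> \<open>The 3 is Harnack's constant, and 2 m ln r bounds log+ |q| on the circle, because
    each of the m linear factors satisfies |z - a| \<le> 2 r \<le> r^2.\<close>
  define N where "N = nat \<lceil>3 * (C + 2 * real m)\<rceil>"
  obtain M where M: "\<And>a. a \<in> S \<Longrightarrow> norm a \<le> M"
    using finite_imp_bounded[OF fin] by (auto simp: bounded_iff)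
  have "\<exists>p. \<forall>z. F z = poly p z"
  proof (rule entire_polynomial_growth_imp_polynomial[of _ N])
    show "F holomorphic_on UNIV" by (rule analytic_imp_holomorphic[OF anU])
    fix r0 :: real
    obtain r where r: "r \<ge> max 2 (max M r0)" "regular_radius f r" "nevanlinna_T f r < C * ln r"
      using slow by blast
    have r1: "r \<ge> 2" "r \<ge> M" "r \<ge> r0" using r(1) by auto
    have lnr: "ln r \<ge> 0" using r1 by simp
    have notS: "z \<notin> S" if "norm z = r" for z
      using r(2) that analytic_at_imp_no_pole by (auto simp: S_def regular_radius_def)
    have reg: "regular_radius F r"
      unfolding regular_radius_def
    proof (intro conjI allI impI an)
      show "r > 0" using r1 by simp
      fix z :: complex assume z: "norm z = r"
      then have "f analytic_on {z}" "f z \<noteq> 0" using r(2) by (auto simp: regular_radius_def)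
      moreover have "q z \<noteq> 0" using notS[OF z] fin by (auto simp: q)
      ultimately show "F z \<noteq> 0" by (simp add: F_eq)
    qed
    have "proximity F r \<le> circle_mean (\<lambda>z. log_plus (norm (f z)) + 2 * real m * ln r) r"
      unfolding proximity_eq_circle_mean
    proof (rule circle_mean_mono)
      fix z :: complex assume z: "norm z = r"
      have "norm (q z) = (\<Prod>a\<in>S. norm (z - a) ^ n a)"
        by (simp add: q prod_norm[symmetric] norm_power)
      also have "\<dots> \<le> (\<Prod>a\<in>S. (r\<^sup>2) ^ n a)"
      proof (intro prod_mono conjI power_mono)
        fix a assume a: "a \<in> S"
        have "norm (z - a) \<le> 2 * r" using norm_triangle_ineq4[of z a] z M[OF a] r1 by simp
        also have "\<dots> \<le> r\<^sup>2" using r1 by (simp add: power2_eq_square)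
        finally show "norm (z - a) \<le> r\<^sup>2" .
      qed auto
      also have "\<dots> = (r\<^sup>2) ^ m" by (simp add: m_def power_sum)
      finally have "log_plus (norm (q z)) \<le> log_plus ((r\<^sup>2) ^ m)" by (rule log_plus_mono)
      also have "\<dots> = 2 * real m * ln r"
        using r1 lnr by (simp add: log_plus_eq_max ln_realpow)
      finally have "log_plus (norm (q z)) \<le> 2 * real m * ln r" .
      moreover have "f analytic_on {z}" using r(2) z by (auto simp: regular_radius_def)
      then have "log_plus (norm (F z)) \<le> log_plus (norm (f z)) + log_plus (norm (q z))"
        by (simp add: F_eq norm_mult log_plus_mult)
      ultimately show "log_plus (norm (F z)) \<le> log_plus (norm (f z)) + 2 * real m * ln r" by simp
    qed (use r1 in \<open>auto intro!: continuous_intros regular_radius_continuous reg r(2)\<close>)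
    also have "\<dots> = proximity f r + 2 * real m * ln r"
      unfolding proximity_eq_circle_mean
      using r1 by (subst circle_mean_add) (auto intro!: continuous_intros regular_radius_continuous r(2))
    also have "\<dots> \<le> nevanlinna_T f r + 2 * real m * ln r"
      using r1 Nsum_nonneg[of "pole_order f" r] pole_order_nonneg[OF mero] by (simp add: nevanlinna_T_eq[OF mero])
    also have "\<dots> \<le> (C + 2 * real m) * ln r"
      using r(3) by (simp add: distrib_right)
    finally have "3 * proximity F r \<le> 3 * ((C + 2 * real m) * ln r)" by (rule mult_left_mono) simp
    then have prox: "3 * proximity F r \<le> 3 * (C + 2 * real m) * ln r" by (simp only: mult.assoc)
    have "norm (F z) \<le> r ^ N" if z: "norm z = r / 2" for z
    proof (cases "F z = 0")
      case False
      have "ln (norm (F z)) \<le> log_plus (norm (F z))" using False by (intro ln_le_log_plus) simp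
      also have "\<dots> \<le> 3 * proximity F r"
        by (rule log_plus_le_proximity_entire[OF nzF anU reg]) (use z in simp)
      also note prox
      also have "3 * (C + 2 * real m) * ln r \<le> real N * ln r"
        unfolding N_def using lnr by (intro mult_right_mono) linarith+
      also have "\<dots> = ln (r ^ N)" using r1 by (simp add: ln_realpow)
      finally show ?thesis using False r1 by simp
    qed (use r1 in simp)
    then show "\<exists>r\<ge>r0. \<forall>z. norm z = r / 2 \<longrightarrow> norm (F z) \<le> r ^ N" using r1 by blast
  qed
  then obtain p where p: "\<And>z. F z = poly p z" by blast
  have "Q \<noteq> 0" using fin by (simp add: Q_def)
  moreover have "\<forall>\<^sub>\<approx>z\<in>UNIV. f z = poly p z / poly Q z"
  proof -
    have "eventually (\<lambda>z. f analytic_on {z}) (cosparse UNIV)"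
      by (rule meromorphic_on_imp_analytic_cosparse[OF mero])
    moreover have "eventually (\<lambda>z. q z \<noteq> 0) (cosparse UNIV)"
      using nzq by (simp add: eventually_cosparse_open_eq nonzero_mero_def)
    ultimately show ?thesis
    proof eventually_elim
      case (elim z)
      then have "poly p z = f z * q z" using F_eq[of z] by (simp flip: p)
      then show ?case using elim by (simp add: q_def)
    qed
  qed
  ultimately show ?thesis unfolding rational_meromorphic_def by blast
qed

text \<open>This is what makes ln r and constants negligible against T and sends T to infinity off
  the exceptional set.\<close>

lemma transcendental_growth:
  assumes "transcendental_meromorphic f"
  shows "\<exists>r0. \<forall>r\<ge>r0. regular_radius f r \<longrightarrow> C * ln r \<le> nevanlinna_T f r"
proof (rule ccontr)
  assume "\<not> ?thesis"
  then have "\<exists>r\<ge>r0. regular_radius f r \<and> nevanlinna_T f r < C * ln r" for r0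
    by (meson not_le)
  then have "rational_meromorphic f"
    by (rule rational_if_slow_growth[OF transcendental_imp_nonzero_mero[OF assms]])
  then show False using assms by (simp add: transcendental_meromorphic_def)
qed

section \<open>Local orders of differential polynomials\<close>

text \<open>In contrast to \<open>zorder\<close>, which is unspecified for the zero function, this treats its order as infinite.\<close>

definition order_ge :: "(complex \<Rightarrow> complex) \<Rightarrow> complex \<Rightarrow> int \<Rightarrow> bool" where
  "order_ge f z n \<longleftrightarrow> (\<exists>L. (\<lambda>w. f (z + w)) has_laurent_expansion L \<and> (\<forall>i<n. fls_nth L i = 0))"

lemma order_ge_mono: "order_ge f z n \<Longrightarrow> m \<le> n \<Longrightarrow> order_ge f z m"
  by (force simp: order_ge_def)

lemma order_ge_zero: "order_ge (\<lambda>w. 0) z n"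
  unfolding order_ge_def by (intro exI[of _ 0]) auto

lemma order_ge_one: "order_ge (\<lambda>w. 1) z 0"
  unfolding order_ge_def by (intro exI[of _ 1]) auto

lemma order_ge_add: "order_ge f z n \<Longrightarrow> order_ge g z n \<Longrightarrow> order_ge (\<lambda>w. f w + g w) z n"
  unfolding order_ge_def by (force intro: has_laurent_expansion_add)

lemma order_ge_sum: "(\<And>j. j \<in> J \<Longrightarrow> order_ge (g j) z n) \<Longrightarrow> order_ge (\<lambda>w. \<Sum>j\<in>J. g j w) z n"
  by (induction J rule: infinite_finite_induct) (auto intro: order_ge_add order_ge_zero)

lemma fls_nth_times_eq_0:
  fixes L M :: "complex fls"
  assumes "\<forall>i<n. fls_nth L i = 0" "\<forall>i<m. fls_nth M i = 0" "i < n + m"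
  shows "fls_nth (L * M) i = 0"
proof (cases "L = 0 \<or> M = 0")
  case False
  then have "n \<le> fls_subdegree L" "m \<le> fls_subdegree M"
    using assms(1,2) by (auto intro: fls_subdegree_geI)
  then have "i < fls_subdegree (L * M)" using False assms(3) by simp
  then show ?thesis by (rule fls_eq0_below_subdegree)
qed auto

lemma order_ge_mult: "order_ge f z n \<Longrightarrow> order_ge g z m \<Longrightarrow> order_ge (\<lambda>w. f w * g w) z (n + m)"
proof -
  assume "order_ge f z n" "order_ge g z m"
  then obtain L M where
    L: "(\<lambda>w. f (z + w)) has_laurent_expansion L" "\<forall>i<n. fls_nth L i = 0" and
    M: "(\<lambda>w. g (z + w)) has_laurent_expansion M" "\<forall>i<m. fls_nth M i = 0"
    by (auto simp: order_ge_def)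
  show ?thesis
    unfolding order_ge_def
    using has_laurent_expansion_mult[OF L(1) M(1)] fls_nth_times_eq_0[OF L(2) M(2)]
    by (intro exI[of _ "L * M"]) simp
qed

lemma order_ge_power:
  assumes "order_ge f z n"
  shows "order_ge (\<lambda>w. f w ^ e) z (int e * n)"
proof (induction e)
  case (Suc e)
  have "order_ge (\<lambda>w. f w * f w ^ e) z (n + int e * n)" by (rule order_ge_mult[OF assms Suc])
  then show ?case by (simp add: algebra_simps)
qed (simp add: order_ge_one)

lemma order_ge_prod:
  "(\<And>i. i \<in> I \<Longrightarrow> order_ge (g i) z (n i)) \<Longrightarrow> order_ge (\<lambda>w. \<Prod>i\<in>I. g i w) z (\<Sum>i\<in>I. n i)"
  by (induction I rule: infinite_finite_induct) (auto intro: order_ge_mult order_ge_one)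

lemma has_laurent_expansion_deriv_shift:
  assumes "(\<lambda>w. f (z + w)) has_laurent_expansion L"
  shows "(\<lambda>w. deriv f (z + w)) has_laurent_expansion fls_deriv L"
proof -
  have "deriv (\<lambda>w. f (z + w)) has_laurent_expansion fls_deriv L"
    using assms by (rule has_laurent_expansion_deriv)
  also have "deriv (\<lambda>w. f (z + w)) = (\<lambda>w. deriv f (z + w))"
    by (simp add: deriv_shift_0' add_ac o_def fun_eq_iff)
  finally show ?thesis .
qed

text \<open>Termwise differentiation lowers exponents by one but kills the constant term, so order 0
  is kept and the shift by c disappears. The case c = 1 serves the 1-points of P.\<close>

lemma order_ge_deriv_minus_const:
  assumes "order_ge (\<lambda>w. f w - c) z n"
  shows "order_ge (deriv f) z (if n = 0 then 0 else n - 1)"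
proof -
  obtain L where L: "(\<lambda>w. f (z + w) - c) has_laurent_expansion L" "\<And>i. i < n \<Longrightarrow> fls_nth L i = 0"
    using assms by (auto simp: order_ge_def)
  have "(\<lambda>w. f (z + w) - c + c) has_laurent_expansion (L + fls_const c)"
    by (intro has_laurent_expansion_add L has_laurent_expansion_const)
  then have "(\<lambda>w. f (z + w)) has_laurent_expansion (L + fls_const c)" by simp
  from has_laurent_expansion_deriv_shift[OF this]
  have "(\<lambda>w. deriv f (z + w)) has_laurent_expansion fls_deriv L" by simp
  moreover have "fls_nth (fls_deriv L) i = 0" if "i < (if n = 0 then 0 else n - 1)" for i
    using L(2)[of "i + 1"] that by (cases "n = 0"; cases "i = -1") auto
  ultimately show ?thesis unfolding order_ge_def by blast
qed

lemma order_ge_deriv: "order_ge f z n \<Longrightarrow> order_ge (deriv f) z (if n = 0 then 0 else n - 1)"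
  using order_ge_deriv_minus_const[of f 0] by simp

lemma order_ge_higher_deriv:
  "order_ge f z n \<Longrightarrow> order_ge ((deriv ^^ i) f) z (n - int i)"
proof (induction i)
  case (Suc i)
  then have "order_ge (deriv ((deriv ^^ i) f)) z (if n - int i = 0 then 0 else n - int i - 1)"
    by (intro order_ge_deriv) auto
  then have "order_ge ((deriv ^^ Suc i) f) z (if n - int i = 0 then 0 else n - int i - 1)" by simp
  then show ?case by (rule order_ge_mono) auto
qed simp

lemma order_ge_higher_deriv_nonneg:
  "order_ge f z 0 \<Longrightarrow> order_ge ((deriv ^^ i) f) z 0"
proof (induction i)
  case (Suc i)
  then show ?case using order_ge_deriv[of "(deriv ^^ i) f" z 0] by simp
qed simp

lemma order_ge_zorder:
  assumes "f meromorphic_on {z}" "eventually (\<lambda>w. f w \<noteq> 0) (at z)"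
  shows "order_ge f z n \<longleftrightarrow> n \<le> zorder f z"
proof -
  obtain L where L: "(\<lambda>w. f (z + w)) has_laurent_expansion L"
    using assms(1) by (auto simp: meromorphic_on_def)
  then have L0: "L \<noteq> 0" using assms(2) has_laurent_expansion_eventually_nonzero_iff by blast
  have "order_ge f z n \<longleftrightarrow> (\<forall>i<n. fls_nth L i = 0)"
    using has_laurent_expansion_unique[OF L] L unfolding order_ge_def by blast
  also have "\<dots> \<longleftrightarrow> n \<le> fls_subdegree L"
    using L0 by (auto intro: fls_subdegree_geI)
  finally show ?thesis using has_laurent_expansion_zorder[OF L L0] by simp
qed

lemma order_ge_nonzero_mero: "nonzero_mero f \<Longrightarrow> order_ge f z n \<longleftrightarrow> n \<le> zorder f z"
  by (intro order_ge_zorder nonzero_mero_imp_meromorphic nonzero_mero_eventually)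

lemma order_ge_0_iff_not_pole:
  assumes "f meromorphic_on UNIV"
  shows "order_ge f z 0 \<longleftrightarrow> \<not> is_pole f z"
proof -
  obtain L where L: "(\<lambda>w. f (z + w)) has_laurent_expansion L"
    using assms meromorphic_on_subset[of f UNIV "{z}"] by (auto simp: meromorphic_on_def)
  have "order_ge f z 0 \<longleftrightarrow> (\<forall>i<0. fls_nth L i = 0)"
    using has_laurent_expansion_unique[OF L] L unfolding order_ge_def by blast
  also have "\<dots> \<longleftrightarrow> fls_subdegree L \<ge> 0"
    by (auto intro: fls_subdegree_ge0I)
  finally show ?thesis using is_pole_fls_subdegree_iff[OF L] by (simp add: not_less)
qed

definition pole_multiplicity :: "(complex \<Rightarrow> complex) \<Rightarrow> complex \<Rightarrow> int" where
  "pole_multiplicity f z = (if is_pole f z then - zorder f z else 0)"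

lemma pole_order_eq_multiplicity: "pole_order f z = of_int (pole_multiplicity f z)"
  by (simp add: pole_order_def pole_multiplicity_def)

lemma pole_multiplicity_nonneg: "f meromorphic_on UNIV \<Longrightarrow> pole_multiplicity f z \<ge> 0"
  using pole_order_nonneg[of f z] by (simp add: pole_order_eq_multiplicity)

lemma order_ge_pole_multiplicity:
  assumes "f meromorphic_on UNIV"
  shows "order_ge f z (- pole_multiplicity f z)"
proof (cases "is_pole f z")
  case True
  have "f meromorphic_on {z}" using assms by (rule meromorphic_on_subset) auto
  moreover from this have "eventually (\<lambda>w. f w \<noteq> 0) (at z)"
    using non_zero_neighbour_pole[OF True] by simp
  ultimately show ?thesis
    using True by (simp add: order_ge_zorder pole_multiplicity_def)
next
  case False
  then show ?thesis using order_ge_0_iff_not_pole[OF assms] by (simp add: pole_multiplicity_def)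
qed

lemma pole_order_le_of_order_ge:
  assumes "f meromorphic_on UNIV" "order_ge f z (- n)" "n \<ge> 0"
  shows "pole_order f z \<le> of_int n"
proof (cases "is_pole f z")
  case True
  have "f meromorphic_on {z}" using assms(1) by (rule meromorphic_on_subset) auto
  moreover have "eventually (\<lambda>w. f w \<noteq> 0) (at z)"
    using non_zero_neighbour_pole[OF True] by simp
  ultimately have "- n \<le> zorder f z" using assms(2) order_ge_zorder by blast
  then show ?thesis using True by (simp add: pole_order_def)
qed (use assms in \<open>simp add: pole_order_def\<close>)

text \<open>A pole of order n becomes one of order at most n + i, and n + i \<le> (i + 1) n because
  n \<ge> 1. The multiplicative form carries over to counting functions.\<close>

lemma pole_order_higher_deriv_le:
  assumes f: "f meromorphic_on UNIV"
  shows "pole_order ((deriv ^^ i) f) z \<le> (real i + 1) * pole_order f z"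
proof (cases "is_pole f z")
  case True
  have "order_ge ((deriv ^^ i) f) z (- pole_multiplicity f z - int i)"
    by (intro order_ge_higher_deriv order_ge_pole_multiplicity f)
  then have "pole_order ((deriv ^^ i) f) z \<le> of_int (pole_multiplicity f z + int i)"
    using pole_multiplicity_nonneg[OF f, of z]
    by (intro pole_order_le_of_order_ge meromorphic_intros f) auto
  also have "\<dots> = pole_order f z + real i * 1" by (simp add: pole_order_eq_multiplicity)
  also have "\<dots> \<le> pole_order f z + real i * pole_order f z"
    using pole_order_pos[OF f True] by (intro add_mono mult_left_mono) auto
  finally show ?thesis by (simp add: algebra_simps)
next
  case False
  then have "order_ge ((deriv ^^ i) f) z (- 0)"
    using order_ge_0_iff_not_pole[OF f] order_ge_higher_deriv_nonneg[of f z i] by simp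
  then have "pole_order ((deriv ^^ i) f) z \<le> of_int 0"
    by (intro pole_order_le_of_order_ge meromorphic_intros f) auto
  then show ?thesis using False by (simp add: pole_order_def)
qed

text \<open>At a zero of f only the factors f themselves are credited, and the derivatives merely
  count as finite. At a pole of order s each factor has a pole of order at most s + k \<le> (k + 1)
  s.\<close>

lemma diff_monomial_order_ge:
  assumes f: "nonzero_mero f"
  shows "order_ge (diff_monomial k q f) z
    (int (q 0) * max 0 (zorder f z) - int (monomial_degree k q) * (int k + 1) * max 0 (- zorder f z))"
proof -
  define p where "p = zorder f z"
  have fp: "order_ge f z p" using order_ge_nonzero_mero[OF f] by (simp add: p_def)
  define e where "e = (\<lambda>i::nat. (if i = 0 then max 0 p else 0) - (int k + 1) * max 0 (- p))"
  have e: "order_ge ((deriv ^^ i) f) z (e i)" if "i \<le> k" for i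
  proof (cases "p \<ge> 0")
    case True
    then have "order_ge f z 0" using fp order_ge_mono by blast
    then show ?thesis
      using True order_ge_higher_deriv_nonneg[of f z i] fp by (auto simp: e_def)
  next
    case False
    have "(int k + 1) * p = int k * p + p" by (simp add: algebra_simps)
    also have "\<dots> \<le> int k * (-1) + p" using False by (intro add_mono mult_left_mono) auto
    finally have "e i \<le> p - int i" using False that by (simp add: e_def)
    then show ?thesis using order_ge_higher_deriv[OF fp, of i] order_ge_mono by blast
  qed
  have "order_ge (\<lambda>w. \<Prod>i\<le>k. (deriv ^^ i) f w ^ q i) z (\<Sum>i\<le>k. int (q i) * e i)"
    using e by (intro order_ge_prod order_ge_power) auto
  also have "(\<lambda>w. \<Prod>i\<le>k. (deriv ^^ i) f w ^ q i) = diff_monomial k q f"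
    by (simp add: diff_monomial_def fun_eq_iff)
  also have "(\<Sum>i\<le>k. int (q i) * e i) =
     (\<Sum>i\<le>k. if i = 0 then int (q i) * max 0 p else 0) - (\<Sum>i\<le>k. int (q i) * ((int k + 1) * max 0 (- p)))"
    unfolding sum_subtractf[symmetric] by (intro sum.cong) (auto simp: e_def algebra_simps)
  also have "(\<Sum>i\<le>k. if i = 0 then int (q i) * max 0 p else 0) = int (q 0) * max 0 p"
    by (subst sum.delta) auto
  also have "(\<Sum>i\<le>k. int (q i) * ((int k + 1) * max 0 (- p))) = int (monomial_degree k q) * (int k + 1) * max 0 (- p)"
    by (simp add: monomial_degree_def sum_distrib_right mult.assoc)
  finally show ?thesis by (simp add: p_def)
qed

lemma diff_poly_order_ge:
  assumes f: "nonzero_mero f" and b: "\<And>j. j \<in> {1..t} \<Longrightarrow> b j meromorphic_on UNIV"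
    and deg: "\<And>j. j \<in> {1..t} \<Longrightarrow> monomial_degree k (\<lambda>i. q i j) = d"
    and m: "\<And>j. j \<in> {1..t} \<Longrightarrow> m \<le> q 0 j"
  shows "order_ge (diff_poly k t b q f) z
    (int m * max 0 (zorder f z) - int d * (int k + 1) * max 0 (- zorder f z) - (\<Sum>j=1..t. pole_multiplicity (b j) z))"
proof -
  define B where "B = (\<Sum>j=1..t. pole_multiplicity (b j) z)"
  have "order_ge (\<lambda>w. \<Sum>j=1..t. b j w * diff_monomial k (\<lambda>i. q i j) f w) z
    (int m * max 0 (zorder f z) - int d * (int k + 1) * max 0 (- zorder f z) - B)"
  proof (rule order_ge_sum)
    fix j assume j: "j \<in> {1..t}"
    have "pole_multiplicity (b j) z \<le> B"
      unfolding B_def using j b pole_multiplicity_nonneg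
      by (intro member_le_sum) auto
    moreover have "int m * max 0 (zorder f z) \<le> int (q 0 j) * max 0 (zorder f z)"
      using m[OF j] by (intro mult_right_mono) auto
    moreover have "order_ge (\<lambda>w. b j w * diff_monomial k (\<lambda>i. q i j) f w) z
      (- pole_multiplicity (b j) z + (int (q 0 j) * max 0 (zorder f z) - int d * (int k + 1) * max 0 (- zorder f z)))"
      using diff_monomial_order_ge[OF f, of k "\<lambda>i. q i j" z] deg[OF j]
      by (intro order_ge_mult order_ge_pole_multiplicity b[OF j]) auto
    ultimately show "order_ge (\<lambda>w. b j w * diff_monomial k (\<lambda>i. q i j) f w) z
      (int m * max 0 (zorder f z) - int d * (int k + 1) * max 0 (- zorder f z) - B)"
      by (elim order_ge_mono) linarith
  qed
  then show ?thesis by (simp add: B_def diff_poly_def[abs_def])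
qed

lemma zorder_pos_tendsto_0:
  assumes "nonzero_mero f" "zorder f z > 0"
  shows "f \<midarrow>z\<rightarrow> 0"
  using zorder_pos_imp_isolated_zero[OF nonzero_mero_imp_meromorphic nonzero_mero_eventually, OF assms(1,1,2)]
  by (simp add: isolated_zero_def)

text \<open>The three cases are: \<open>z\<close> is a 1-point of \<open>P\<close>; \<open>P\<close> is finite and different from 1 at \<open>z\<close>; \<open>z\<close> is a
  pole of \<open>P\<close>, hence of \<open>f\<close> or of some coefficient.\<close>

lemma local_order_inequality:
  assumes f: "nonzero_mero f" and P: "nonzero_mero P" and P1: "nonzero_mero (\<lambda>z. P z - 1)"
    and P': "nonzero_mero (deriv P)"
    and n0: "order_ge P z (int m * max 0 (zorder f z) - e * max 0 (- zorder f z) - B)"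
    and m: "1 \<le> m" "m \<le> d" and B: "B \<ge> 0" 
  shows "real d * zero_order f z - of_int (zorder (deriv P) z) + of_int (zorder (\<lambda>z. P z - 1) z)
    \<le> (real d - real m + 1) * zero_order f z + (if is_pole f z then 1 else 0)
      + (if is_pole (\<lambda>z. 1 / (P z - 1)) z then 1 else 0) + (real d + 1) * of_int B"
proof -
  define p where "p = max 0 (zorder f z)"
  define s where "s = max 0 (- zorder f z)"
  define o1 where "o1 = zorder (\<lambda>z. P z - 1) z"
  define o' where "o' = zorder (deriv P) z"
  define x :: int where "x = (if is_pole f z then 1 else 0)"
  define y :: int where "y = (if is_pole (\<lambda>z. 1 / (P z - 1)) z then 1 else 0)"
  note n0 = n0[folded p_def s_def]
  have P_ge: "order_ge P z n \<longleftrightarrow> n \<le> zorder P z" for n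
    by (rule order_ge_nonzero_mero[OF P])
  \<comment> \<open>The order of P' falls short of that of P - 1 by at most one. The missing unit is
    paid for by the 1-point, by the pole of f or by a pole of a coefficient.\<close>
  have F1: "o' \<ge> o1 - 1"
  proof -
    have "order_ge (\<lambda>z. P z - 1) z o1" by (simp add: order_ge_nonzero_mero[OF P1] o1_def)
    then have "order_ge (deriv P) z (if o1 = 0 then 0 else o1 - 1)"
      by (rule order_ge_deriv_minus_const)
    then show ?thesis by (simp add: order_ge_nonzero_mero[OF P'] o'_def split: if_splits)
  qed
  have F2: "o' \<ge> (if n = 0 then 0 else n - 1)" if "order_ge P z n" for n
    using order_ge_deriv[OF that] unfolding order_ge_nonzero_mero[OF P'] o'_def .
  have x: "x = (if s > 0 then 1 else 0)"
    using pole_order_eq_max[OF f, of z] pole_order_pos[OF nonzero_mero_imp_meromorphic[OF f], of z]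
    by (auto simp: x_def s_def pole_order_def split: if_splits)
  have y: "y = 1" if "o1 > 0"
  proof -
    have "isolated_zero (\<lambda>z. P z - 1) z"
      using that unfolding o1_def
      by (intro zorder_pos_imp_isolated_zero nonzero_mero_imp_meromorphic nonzero_mero_eventually P1)
    then have "is_pole (\<lambda>z. inverse (P z - 1)) z" by (simp add: is_pole_inverse_iff)
    then show ?thesis by (simp add: y_def inverse_eq_divide)
  qed
  have xy: "x \<ge> 0" "y \<ge> 0" by (auto simp: x_def y_def)
  have ps: "p \<ge> 0" "s \<ge> 0" "p > 0 \<Longrightarrow> s = 0" by (auto simp: p_def s_def)
  have mp: "p \<le> int m * p" using m ps mult_right_mono[of 1 "int m" p] by simp
  have dB: "int d * p \<le> int d * B" if "p \<le> B" using that by (intro mult_left_mono) auto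
  have dB0: "0 \<le> int d * B" using B by simp
  have dmp: "0 \<le> (int d - int m + 1) * p" using m ps by simp
  have "int d * p - o' + o1 \<le> (int d - int m + 1) * p + x + y + (int d + 1) * B"
  proof (cases "o1 > 0")
    case True
    \<comment> \<open>A 1-point of P is no zero of P. Since P has order at least m p - B where p >
      0, a zero of f can sit there only if coefficient poles compensate it, so p \<le> B.\<close>
    have "\<not> zorder P z \<ge> 1"
    proof
      assume "zorder P z \<ge> 1"
      then have "P \<midarrow>z\<rightarrow> 0" by (intro zorder_pos_tendsto_0 P) auto
      moreover have "(\<lambda>z. P z - 1) \<midarrow>z\<rightarrow> 0"
        using True by (intro zorder_pos_tendsto_0 P1) (simp add: o1_def)
      ultimately have "(\<lambda>z. P z - (P z - 1)) \<midarrow>z\<rightarrow> 0 - 0" by (rule tendsto_diff)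
      then have "((\<lambda>z. 1::complex) \<longlongrightarrow> 0) (at z)" by simp
      then show False by (simp add: tendsto_const_iff)
    qed
    then have "int m * p - e * s - B \<le> 0" using n0 unfolding P_ge by linarith
    then have "p \<le> B" if "p > 0" using ps(3)[OF that] mp by simp
    then have "p \<le> B" using ps(1) B by linarith
    then show ?thesis
      using F1 y[OF True] xy dmp dB B by (simp add: distrib_right) 
  next
    case o1: False
    show ?thesis
    proof (cases "order_ge P z 0")
      case True
      have o'0: "o' \<ge> 0" using F2[OF True] by simp
      show ?thesis
      proof (cases "p > 0")
        case True
        then have "order_ge P z (int m * p - B)" using n0 ps(3) by simp
        \<comment> \<open>The unit lost by differentiation is absorbed by the + 1 in d - m + 1,
          since p \<ge> 1.\<close>
        from F2[OF this] have "o' \<ge> int m * p - B - 1" using o'0 by (auto split: if_splits)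
        then show ?thesis
          using o1 True xy dB0 by (simp add: distrib_right left_diff_distrib)
      next
        case False
        then have "p = 0" using ps by simp
        moreover have "0 \<le> (int d + 1) * B" using B by simp
        ultimately show ?thesis
          using o1 o'0 xy by (simp only: mult_zero_right)
      qed
    next
      case False
      \<comment> \<open>P has a pole here. Either f has one, and then p = 0 and x = 1, or the
        coefficients cause it, and then p < B.\<close>
      then have neg: "int m * p - e * s - B < 0"
        using n0 order_ge_mono by (metis not_le)
      show ?thesis
      proof (cases "s > 0")
        case True
        moreover have "p = 0 \<or> s = 0" by (auto simp: p_def s_def)
        ultimately have "p = 0" "x = 1" using x by auto
        moreover have "0 \<le> (int d + 1) * B" using B by simp
        ultimately show ?thesis using F1 xy by (simp only: mult_zero_right, linarith?)
      next
        case False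
        then have "s = 0" using ps by simp
        then have "p < B" using neg mp by simp
        then show ?thesis using F1 xy dB dmp ps by (simp add: distrib_right)
      qed
    qed
  qed
  then have "real_of_int (int d * p - o' + o1) \<le> real_of_int ((int d - int m + 1) * p + x + y + (int d + 1) * B)"
    by (simp only: of_int_le_iff)
  then have "real d * of_int p - of_int o' + of_int o1 \<le>
      (real d - real m + 1) * of_int p + of_int x + of_int y + (real d + 1) * of_int B"
    by simp
  moreover have "zero_order f z = of_int p" by (simp add: zero_order_def p_def)
  moreover have "of_int x = (if is_pole f z then 1 else 0 :: real)"
    "of_int y = (if is_pole (\<lambda>z. 1 / (P z - 1)) z then 1 else 0 :: real)"
    by (simp_all add: x_def y_def)
  ultimately show ?thesis by (simp only: o'_def o1_def)
qed

text \<open>If P' vanished, the Laurent expansion of P at 0 would be a constant c, and by the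
  identity theorem P would equal c off a sparse set.\<close>

lemma deriv_nonzero_mero:
  assumes P: "P meromorphic_on UNIV" and nc: "\<And>c. \<not> (\<forall>\<^sub>\<approx>z\<in>UNIV. P z = c)"
  shows "nonzero_mero (deriv P)"
proof (rule nonzero_meroI)
  show "deriv P meromorphic_on UNIV" by (intro meromorphic_intros P)
  show "\<not> (\<forall>\<^sub>\<approx>z\<in>UNIV. deriv P z = 0)"
  proof
    assume "\<forall>\<^sub>\<approx>z\<in>UNIV. deriv P z = 0"
    then have ev: "eventually (\<lambda>w. deriv P w = 0) (at 0)"
      by (simp add: eventually_cosparse_open_eq)
    obtain L where L: "(\<lambda>w. P (0 + w)) has_laurent_expansion L"
      using P meromorphic_on_subset[of P UNIV "{0}"] by (auto simp: meromorphic_on_def)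
    have "\<not> eventually (\<lambda>w. deriv P w \<noteq> 0) (at 0)"
      using ev eventually_frequently[of "at (0::complex)"] by (auto simp: frequently_def)
    then have "fls_deriv L = 0"
      using has_laurent_expansion_eventually_nonzero_iff[OF has_laurent_expansion_deriv_shift[OF L]] by blast
    then obtain c where c: "L = fls_const c"
      by (auto simp: fls_deriv_eq_0_iff)
    have "(\<lambda>w. P (0 + w) - c) has_laurent_expansion (fls_const c - fls_const c)"
      using L unfolding c by (intro has_laurent_expansion_diff has_laurent_expansion_const)
    then have "\<not> eventually (\<lambda>w. P w - c \<noteq> 0) (at 0)"
      using has_laurent_expansion_eventually_nonzero_iff[of "\<lambda>w. P w - c" 0 0] by simp
    then have "\<not> (\<forall>\<^sub>\<approx>z\<in>UNIV. P z \<noteq> c)"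
      by (auto simp: eventually_cosparse_open_eq)
    then show False
      using meromorphic_imp_constant_or_avoid[OF P, of c] nc[of c] by auto
  qed
qed

lemma deriv_eventually_zero:
  assumes "g meromorphic_on UNIV" "\<forall>\<^sub>\<approx>z\<in>UNIV. g z = 0"
  shows "\<forall>\<^sub>\<approx>z\<in>UNIV. deriv g z = 0"
proof -
  have ev: "eventually (\<lambda>w. g w = 0) (at 0)"
    using assms(2) by (simp add: eventually_cosparse_open_eq)
  obtain L where L: "(\<lambda>w. g (0 + w)) has_laurent_expansion L"
    using assms(1) meromorphic_on_subset[of g UNIV "{0}"] by (auto simp: meromorphic_on_def)
  have "\<not> eventually (\<lambda>w. g w \<noteq> 0) (at 0)"
    using ev eventually_frequently[of "at (0::complex)"] by (auto simp: frequently_def)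
  then have "L = 0"
    using has_laurent_expansion_eventually_nonzero_iff[OF L] by blast
  then have "\<not> eventually (\<lambda>w. deriv g w \<noteq> 0) (at 0)"
    using has_laurent_expansion_eventually_nonzero_iff[OF has_laurent_expansion_deriv_shift[OF L]] by simp
  then have "\<not> (\<forall>\<^sub>\<approx>z\<in>UNIV. deriv g z \<noteq> 0)"
    by (auto simp: eventually_cosparse_open_eq)
  then show ?thesis
    using meromorphic_imp_constant_or_avoid[of "deriv g" UNIV 0] assms(1)
    by (auto intro: meromorphic_on_deriv)
qed

section \<open>Quantities that are negligible off an exceptional set\<close>

lemma log_plus_power: "x \<ge> 0 \<Longrightarrow> log_plus (x ^ n) = real n * log_plus x"
proof -
  assume "x \<ge> 0"
  then have "max 1 (x ^ n) = (max 1 x) ^ n"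
    using power_le_one[of x n] one_le_power[of x n] by (cases "x \<le> 1") (auto simp: max_def)
  then show ?thesis by (simp add: log_plus_def ln_realpow)
qed

lemma log_plus_prod:
  "(\<And>i. i \<in> I \<Longrightarrow> x i \<ge> 0) \<Longrightarrow> log_plus (\<Prod>i\<in>I. x i) \<le> (\<Sum>i\<in>I. log_plus (x i))"
proof (induction I rule: infinite_finite_induct)
  case (insert i I)
  then have "log_plus (x i * (\<Prod>i\<in>I. x i)) \<le> log_plus (x i) + log_plus (\<Prod>i\<in>I. x i)"
    by (intro log_plus_mult prod_nonneg) auto
  then show ?case using insert by auto
qed (auto simp: log_plus_def)

text \<open>Each summand is at most Q, the product of all max 1 x, so the sum is at most card J
  times Q.\<close>

lemma log_plus_sum:
  assumes "finite J" "J \<noteq> {}" "\<And>j. j \<in> J \<Longrightarrow> x j \<ge> 0"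
  shows "log_plus (\<Sum>j\<in>J. x j) \<le> ln (card J) + (\<Sum>j\<in>J. log_plus (x j))"
proof -
  define Q where "Q = (\<Prod>j\<in>J. max 1 (x j))"
  have Q1: "Q \<ge> 1" unfolding Q_def by (rule prod_ge_1) auto
  have c1: "real (card J) \<ge> 1" using assms(1,2) by (simp add: Suc_le_eq card_gt_0_iff)
  have "x j \<le> Q" if "j \<in> J" for j
  proof -
    have "Q = max 1 (x j) * (\<Prod>j\<in>J - {j}. max 1 (x j))"
      unfolding Q_def using assms(1) that by (rule prod.remove)
    moreover have "(\<Prod>j\<in>J - {j}. max 1 (x j)) \<ge> 1" by (rule prod_ge_1) auto
    ultimately have "max 1 (x j) * 1 \<le> Q" by (simp only:) (rule mult_left_mono, auto)
    then show ?thesis by simp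
  qed
  then have "(\<Sum>j\<in>J. x j) \<le> real (card J) * Q"
    using sum_bounded_above[of J x Q] by simp
  moreover have "1 * 1 \<le> real (card J) * Q" using Q1 c1 by (intro mult_mono) auto
  ultimately have "log_plus (\<Sum>j\<in>J. x j) \<le> ln (real (card J) * Q)"
    unfolding log_plus_def by (subst ln_le_cancel_iff) auto
  also have "\<dots> = ln (card J) + ln Q" using Q1 c1 by (intro ln_mult_pos) auto
  also have "ln Q = (\<Sum>j\<in>J. log_plus (x j))"
    unfolding Q_def log_plus_def by (rule ln_prod[OF assms(1)]) (simp add: max_def)
  finally show ?thesis .
qed

lemma log_plus_add:
  assumes "x \<ge> 0" "y \<ge> 0"
  shows "log_plus (x + y) \<le> ln 2 + log_plus x + log_plus y"
proof -
  have "\<And>j. 0 \<le> (if j then x else y)" using assms by simp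
  then show ?thesis
    using log_plus_sum[of "{True, False}" "\<lambda>c. if c then x else y"] by simp
qed

text \<open>The exceptional set is a parameter, so that several functions can share the union of
  their sets.\<close>

definition log_deriv_bounded :: "(complex \<Rightarrow> complex) \<Rightarrow> real set \<Rightarrow> bool" where
  "log_deriv_bounded g E \<longleftrightarrow> (\<exists>K\<ge>1. \<forall>r\<ge>1. r \<notin> E \<longrightarrow> regular_radius g r \<and>
     (\<forall>z. norm z = r \<longrightarrow> norm (deriv g z / g z) \<le> K * r ^ 3 * max 1 (nevanlinna_T g r) ^ 6))"

lemma log_deriv_bounded_mono:
  assumes "log_deriv_bounded g E" "E \<inter> {1..} \<subseteq> E'"
  shows "log_deriv_bounded g E'"
proof -
  have "r \<notin> E" if "r \<ge> 1" "r \<notin> E'" for r using assms(2) that by auto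
  then show ?thesis using assms(1) unfolding log_deriv_bounded_def by meson
qed

lemma log_deriv_bounded_regular: "log_deriv_bounded g E \<Longrightarrow> r \<ge> 1 \<Longrightarrow> r \<notin> E \<Longrightarrow> regular_radius g r"
  unfolding log_deriv_bounded_def by blast

lemma log_deriv_bounded_ex:
  "nonzero_mero g \<Longrightarrow> \<exists>E\<in>lmeasurable. log_deriv_bounded g E"
  using log_derivative_bound unfolding log_deriv_bounded_def by blast

section \<open>Calculus of error terms off one fixed exceptional set\<close>

locale exceptional_set =
  fixes f :: "complex \<Rightarrow> complex" and E :: "real set"
  assumes transcendental: "transcendental_meromorphic f"
    and regular: "\<And>r. r \<ge> 1 \<Longrightarrow> r \<notin> E \<Longrightarrow> regular_radius f r"
begin

abbreviation T where "T \<equiv> nevanlinna_T f"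

abbreviation off_E :: "real filter" where "off_E \<equiv> inf at_top (principal (- E))"

text \<open>An upper bound only: error terms stand on the larger side of inequalities, where a
  negative term of any size does no harm.\<close>

definition small :: "(real \<Rightarrow> real) \<Rightarrow> bool" where
  "small X \<longleftrightarrow> (\<forall>\<epsilon>>0. eventually (\<lambda>r. X r \<le> \<epsilon> * T r) off_E)"

lemma nonzero: "nonzero_mero f"
  by (rule transcendental_imp_nonzero_mero[OF transcendental])

lemma mero: "f meromorphic_on A"
  by (rule nonzero_mero_imp_meromorphic[OF nonzero])

lemma eventually_off_E: "(\<And>r. r \<ge> c \<Longrightarrow> r \<notin> E \<Longrightarrow> Q r) \<Longrightarrow> eventually Q off_E"
  unfolding eventually_inf_principal
  using eventually_ge_at_top[of c] by eventually_elim auto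

lemma eventually_ge_ln: "eventually (\<lambda>r. C * ln r \<le> T r) off_E"
proof -
  obtain r0 where "\<And>r. r \<ge> r0 \<Longrightarrow> regular_radius f r \<Longrightarrow> C * ln r \<le> T r"
    using transcendental_growth[OF transcendental, of C] by blast
  then show ?thesis by (intro eventually_off_E[of "max 1 r0"]) (auto intro: regular)
qed

lemma T_at_top: "filterlim T at_top off_E"
proof (rule filterlim_at_top_mono)
  show "filterlim ln at_top off_E"
    using ln_at_top by (rule filterlim_mono) auto
  show "eventually (\<lambda>r. ln r \<le> T r) off_E" using eventually_ge_ln[of 1] by simp
qed

lemma smallI_le: "small Y \<Longrightarrow> eventually (\<lambda>r. X r \<le> Y r) off_E \<Longrightarrow> small X"
  unfolding small_def
proof (intro allI impI)
  fix \<epsilon> :: real assume *: "\<forall>\<epsilon>>0. eventually (\<lambda>r. Y r \<le> \<epsilon> * T r) off_E" "\<epsilon> > 0"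
    "eventually (\<lambda>r. X r \<le> Y r) off_E"
  from *(1) \<open>\<epsilon> > 0\<close> have "eventually (\<lambda>r. Y r \<le> \<epsilon> * T r) off_E" by blast
  with *(3) show "eventually (\<lambda>r. X r \<le> \<epsilon> * T r) off_E" by eventually_elim auto
qed

lemma small_add: "small X \<Longrightarrow> small Y \<Longrightarrow> small (\<lambda>r. X r + Y r)"
  unfolding small_def
proof (intro allI impI)
  fix \<epsilon> :: real
  assume *: "\<forall>\<epsilon>>0. eventually (\<lambda>r. X r \<le> \<epsilon> * T r) off_E" "\<forall>\<epsilon>>0. eventually (\<lambda>r. Y r \<le> \<epsilon> * T r) off_E" "\<epsilon> > 0"
  have "eventually (\<lambda>r. X r \<le> \<epsilon> / 2 * T r) off_E" "eventually (\<lambda>r. Y r \<le> \<epsilon> / 2 * T r) off_E"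
    using *(1)[rule_format, of "\<epsilon> / 2"] *(2)[rule_format, of "\<epsilon> / 2"] *(3) by simp_all
  then show "eventually (\<lambda>r. X r + Y r \<le> \<epsilon> * T r) off_E" by eventually_elim auto
qed

lemma small_cmult: "small X \<Longrightarrow> c \<ge> 0 \<Longrightarrow> small (\<lambda>r. c * X r)"
  unfolding small_def
proof (intro allI impI)
  fix \<epsilon> :: real
  assume *: "\<forall>\<epsilon>>0. eventually (\<lambda>r. X r \<le> \<epsilon> * T r) off_E" "c \<ge> 0" "\<epsilon> > 0"
  have "eventually (\<lambda>r. X r \<le> \<epsilon> / (c + 1) * T r) off_E" "eventually (\<lambda>r. T r \<ge> 0) off_E"
    using *(1)[rule_format, of "\<epsilon> / (c + 1)"] *(2,3) filterlim_at_top[THEN iffD1, OF T_at_top] by simp_all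
  then show "eventually (\<lambda>r. c * X r \<le> \<epsilon> * T r) off_E"
  proof eventually_elim
    case (elim r)
    have "c * X r \<le> c * (\<epsilon> / (c + 1) * T r)" using elim * by (intro mult_left_mono) auto
    also have "\<dots> = (c / (c + 1)) * (\<epsilon> * T r)" by simp
    also have "\<dots> \<le> 1 * (\<epsilon> * T r)" using elim * by (intro mult_right_mono) auto
    finally show ?case by simp
  qed
qed

lemma small_ln: "small ln"
  unfolding small_def
proof (intro allI impI)
  fix \<epsilon> :: real assume "\<epsilon> > 0"
  with eventually_ge_ln[of "1 / \<epsilon>"] show "eventually (\<lambda>r. ln r \<le> \<epsilon> * T r) off_E"
    by (auto elim!: eventually_mono simp: field_simps)
qed

lemma small_const: "small (\<lambda>r. c)"
proof (rule smallI_le[OF small_cmult[OF small_ln, of "\<bar>c\<bar>"]])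
  show "eventually (\<lambda>r. c \<le> \<bar>c\<bar> * ln r) off_E"
  proof (rule eventually_off_E[of "exp 1"])
    fix r :: real assume "r \<ge> exp 1"
    then have "ln r \<ge> 1" using ln_ge_iff[of r 1] exp_gt_zero[of 1] by (metis dual_order.strict_trans1)
    then have "\<bar>c\<bar> * 1 \<le> \<bar>c\<bar> * ln r" by (intro mult_left_mono) auto
    then show "c \<le> \<bar>c\<bar> * ln r" by simp
  qed
qed simp

lemma small_sum: "(\<And>j. j \<in> J \<Longrightarrow> small (X j)) \<Longrightarrow> small (\<lambda>r. \<Sum>j\<in>J. X j r)"
  by (induction J rule: infinite_finite_induct) (auto intro: small_add small_const)

text \<open>T tends to infinity off E and ln x / x tends to 0, so ln T is negligible; the factor C
  only adds a constant.\<close>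

lemma small_ln_T:
  assumes "eventually (\<lambda>r. X r \<le> C * T r) off_E"
  shows "small (\<lambda>r. ln (max 1 (X r)))"
proof -
  define D where "D = max 1 C"
  have "small (\<lambda>r. ln D + ln (T r))"
  proof (intro small_add small_const)
    show "small (\<lambda>r. ln (T r))"
      unfolding small_def
    proof (intro allI impI)
      fix \<epsilon> :: real assume "\<epsilon> > 0"
      have "eventually (\<lambda>x::real. ln x / x < \<epsilon>) at_top"
        using order_tendstoD(2)[OF ln_x_over_x_tendsto_0 \<open>\<epsilon> > 0\<close>] .
      with eventually_gt_at_top[of 0] have "eventually (\<lambda>x::real. ln x \<le> \<epsilon> * x) at_top"
        by eventually_elim (simp add: field_simps)
      then show "eventually (\<lambda>r. ln (T r) \<le> \<epsilon> * T r) off_E"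
        using T_at_top unfolding filterlim_iff by blast
    qed
  qed
  moreover have "eventually (\<lambda>r. T r \<ge> 1) off_E"
    using filterlim_at_top[THEN iffD1, OF T_at_top] by auto
  with assms have "eventually (\<lambda>r. ln (max 1 (X r)) \<le> ln D + ln (T r)) off_E"
  proof eventually_elim
    case (elim r)
    have "1 * 1 \<le> D * T r" using elim by (intro mult_mono) (auto simp: D_def)
    moreover have "C * T r \<le> D * T r" using elim by (intro mult_right_mono) (auto simp: D_def)
    ultimately have "max 1 (X r) \<le> D * T r" using elim(1) by linarith
    then have "ln (max 1 (X r)) \<le> ln (D * T r)" by (subst ln_le_cancel_iff) auto
    also have "\<dots> = ln D + ln (T r)" using elim by (intro ln_mult_pos) (auto simp: D_def)
    finally show ?case .
  qed
  ultimately show ?thesis by (rule smallI_le)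
qed

text \<open>log+ turns the polynomial bound on |g'/g| into a constant plus 3 ln r plus 6 ln (max 1
  T(r,g)), and T(r,g) is at most C T(r,f).\<close>

lemma small_log_deriv:
  assumes g: "log_deriv_bounded g E" and C: "eventually (\<lambda>r. nevanlinna_T g r \<le> C * T r) off_E"
  obtains L where "small L" "\<And>r. r \<ge> 1 \<Longrightarrow> L r \<ge> 0"
    "\<And>r z. r \<ge> 1 \<Longrightarrow> r \<notin> E \<Longrightarrow> norm z = r \<Longrightarrow> log_plus (norm (deriv g z / g z)) \<le> L r"
proof -
  obtain K where K: "K \<ge> 1" "\<And>r z. r \<ge> 1 \<Longrightarrow> r \<notin> E \<Longrightarrow> norm z = r \<Longrightarrow>
      norm (deriv g z / g z) \<le> K * r ^ 3 * max 1 (nevanlinna_T g r) ^ 6"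
    using g unfolding log_deriv_bounded_def by blast
  define L where "L = (\<lambda>r. ln K + 3 * ln r + 6 * ln (max 1 (nevanlinna_T g r)))"
  show ?thesis
  proof
    show "small L" unfolding L_def
      by (intro small_add small_cmult small_const small_ln small_ln_T[OF C]) auto
    show "L r \<ge> 0" if "r \<ge> 1" for r using K(1) that by (simp add: L_def)
    show "log_plus (norm (deriv g z / g z)) \<le> L r" if "r \<ge> 1" "r \<notin> E" "norm z = r" for r z
    proof -
      define u where "u = max 1 (nevanlinna_T g r)"
      have u: "u \<ge> 1" by (simp add: u_def)
      have "log_plus (norm (deriv g z / g z)) \<le> log_plus (K * r ^ 3 * u ^ 6)"
        unfolding u_def by (rule log_plus_mono) (rule K(2)[OF that])
      also have "\<dots> \<le> log_plus K + log_plus (r ^ 3) + log_plus (u ^ 6)"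
        using K(1) that u log_plus_mult[of "K * r ^ 3" "u ^ 6"] log_plus_mult[of K "r ^ 3"] by auto
      also have "\<dots> = L r"
        using K(1) that u by (simp add: log_plus_power L_def u_def[symmetric]) (simp add: log_plus_def)
      finally show ?thesis .
    qed
  qed
qed

lemma higher_deriv_analytic_radius:
  assumes "analytic_radius g r"
  shows "analytic_radius ((deriv ^^ i) g) r"
  using assms analytic_higher_deriv[of g] by (auto simp: analytic_radius_def)

lemma analytic_radius: "r \<ge> 1 \<Longrightarrow> r \<notin> E \<Longrightarrow> analytic_radius f r"
  by (intro regular_imp_analytic_radius regular)

text \<open>Induction with m(r,g') \<le> m(r,g) + m(r,g'/g) and N(r,f^(i+1)) \<le> (i + 2) N(r,f).
  The bound for one derivative makes its logarithmic derivative negligible, which gives the bound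
  for the next.\<close>

lemma T_higher_deriv_le:
  assumes "\<And>l. l < i \<Longrightarrow> log_deriv_bounded ((deriv ^^ l) f) E"
  shows "\<exists>C. eventually (\<lambda>r. nevanlinna_T ((deriv ^^ i) f) r \<le> C * T r) off_E"
  using assms
proof (induction i)
  case 0
  show ?case by (intro exI[of _ 1]) simp
next
  case (Suc i)
  let ?g = "(deriv ^^ i) f" and ?h = "(deriv ^^ Suc i) f"
  obtain C where C: "eventually (\<lambda>r. nevanlinna_T ?g r \<le> C * T r) off_E" using Suc by auto
  have g: "log_deriv_bounded ?g E" using Suc.prems by simp
  obtain L where L: "small L" "\<And>r. r \<ge> 1 \<Longrightarrow> L r \<ge> 0"
    "\<And>r z. r \<ge> 1 \<Longrightarrow> r \<notin> E \<Longrightarrow> norm z = r \<Longrightarrow> log_plus (norm (deriv ?g z / ?g z)) \<le> L r"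
    using small_log_deriv[OF g C] by blast
  have mg: "?g meromorphic_on A" "?h meromorphic_on A" for A
    by (intro meromorphic_on_higher_deriv mero)+
  have le: "nevanlinna_T ?h r \<le> nevanlinna_T ?g r + L r + (real i + 2) * T r" if r: "r \<ge> 1" "r \<notin> E" for r
  proof -
    have reg: "regular_radius ?g r" by (rule log_deriv_bounded_regular[OF g r])
    have an: "analytic_radius ?h r"
      by (intro higher_deriv_analytic_radius analytic_radius r)
    have "proximity ?h r \<le> circle_mean (\<lambda>z. log_plus (norm (?g z)) + L r) r"
      unfolding proximity_eq_circle_mean
    proof (rule circle_mean_mono)
      fix z :: complex assume z: "norm z = r"
      have "?g z \<noteq> 0" using reg z by (auto simp: regular_radius_def)
      then have "norm (?h z) = norm (?g z) * norm (deriv ?g z / ?g z)" by (simp add: norm_divide)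
      then have "log_plus (norm (?h z)) \<le> log_plus (norm (?g z)) + log_plus (norm (deriv ?g z / ?g z))"
        by (simp only:) (rule log_plus_mult, auto)
      then show "log_plus (norm (?h z)) \<le> log_plus (norm (?g z)) + L r" using L(3)[OF r z] by linarith
    qed (use r in \<open>auto intro!: continuous_intros regular_radius_continuous[OF reg] analytic_radius_continuous[OF an]
      simp del: funpow.simps\<close>)
    also have "\<dots> = proximity ?g r + L r"
      unfolding proximity_eq_circle_mean
      using r by (subst circle_mean_add) (auto intro!: continuous_intros regular_radius_continuous[OF reg])
    also have "\<dots> \<le> nevanlinna_T ?g r + L r"
      using r Nsum_nonneg[of "pole_order ?g" r] pole_order_nonneg[OF mg(1)] by (simp add: nevanlinna_T_eq[OF mg(1)])
    finally have "proximity ?h r \<le> nevanlinna_T ?g r + L r" .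
    moreover have "Nsum (pole_order ?h) r \<le> Nsum (\<lambda>z. (real (Suc i) + 1) * pole_order f z) r"
      using r by (intro Nsum_mono locally_finite_weight_cmult locally_finite_weight_pole_order mero mg(2)
          pole_order_higher_deriv_le)
    then have "Nsum (pole_order ?h) r \<le> (real i + 2) * Nsum (pole_order f) r"
      unfolding Nsum_cmult by (simp add: add.commute)
    moreover have "(real i + 2) * Nsum (pole_order f) r \<le> (real i + 2) * T r"
      using r by (intro mult_left_mono Nsum_pole_order_le mero) auto
    moreover have "nevanlinna_T ?h r = proximity ?h r + Nsum (pole_order ?h) r"
      using r by (intro nevanlinna_T_eq mg(2)) auto
    ultimately show ?thesis by linarith
  qed
  have "eventually (\<lambda>r. L r \<le> 1 * T r) off_E" using L(1) unfolding small_def by (meson zero_less_one)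
  moreover have "eventually (\<lambda>r. nevanlinna_T ?h r \<le> nevanlinna_T ?g r + L r + (real i + 2) * T r) off_E"
    by (rule eventually_off_E[of 1]) (rule le)
  ultimately have "eventually (\<lambda>r. nevanlinna_T ?h r \<le> (C + 1 + (real i + 2)) * T r) off_E"
    using C by eventually_elim (auto simp: distrib_right)
  then show ?case by blast
qed

text \<open>f^(i)/f is the product of the successive quotients f^(l+1)/f^(l), each of which is a
  logarithmic derivative.\<close>

lemma small_higher_log_deriv:
  assumes "\<And>l. l < k \<Longrightarrow> log_deriv_bounded ((deriv ^^ l) f) E"
  obtains L where "small L" "\<And>r. r \<ge> 1 \<Longrightarrow> L r \<ge> 0"
    "\<And>r z i. r \<ge> 1 \<Longrightarrow> r \<notin> E \<Longrightarrow> norm z = r \<Longrightarrow> i \<le> k \<Longrightarrow> log_plus (norm ((deriv ^^ i) f z / f z)) \<le> L r"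
proof -
  have "\<exists>L. small L \<and> (\<forall>r\<ge>1. L r \<ge> 0) \<and> (\<forall>r z. r \<ge> 1 \<longrightarrow> r \<notin> E \<longrightarrow> norm z = r \<longrightarrow>
     log_plus (norm (deriv ((deriv ^^ l) f) z / (deriv ^^ l) f z)) \<le> L r)" if l: "l < k" for l
  proof -
    obtain C where C: "eventually (\<lambda>r. nevanlinna_T ((deriv ^^ l) f) r \<le> C * T r) off_E"
      using T_higher_deriv_le[of l] assms l by auto
    obtain L where "small L" "\<And>r. r \<ge> 1 \<Longrightarrow> L r \<ge> 0"
      "\<And>r z. r \<ge> 1 \<Longrightarrow> r \<notin> E \<Longrightarrow> norm z = r \<Longrightarrow>
         log_plus (norm (deriv ((deriv ^^ l) f) z / (deriv ^^ l) f z)) \<le> L r"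
      using small_log_deriv[OF assms[OF l] C] by blast
    then show ?thesis by (intro exI[of _ L]) simp
  qed
  then obtain L where L: "\<And>l. l < k \<Longrightarrow> small (L l)" "\<And>l r. l < k \<Longrightarrow> r \<ge> 1 \<Longrightarrow> L l r \<ge> 0"
    "\<And>l r z. l < k \<Longrightarrow> r \<ge> 1 \<Longrightarrow> r \<notin> E \<Longrightarrow> norm z = r \<Longrightarrow>
     log_plus (norm (deriv ((deriv ^^ l) f) z / (deriv ^^ l) f z)) \<le> L l r"
    by metis
  show ?thesis
  proof
    show "small (\<lambda>r. \<Sum>l<k. L l r)" using L(1) by (intro small_sum) auto
    show "(\<Sum>l<k. L l r) \<ge> 0" if "r \<ge> 1" for r using L(2) that by (intro sum_nonneg) auto
    fix r i and z :: complex assume r: "r \<ge> 1" "r \<notin> E" "norm z = r" "i \<le> k"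
    have nz: "(deriv ^^ l) f z \<noteq> 0" if "l < k" for l
      using log_deriv_bounded_regular[OF assms[OF that] r(1,2)] r(3) by (auto simp: regular_radius_def)
    have "log_plus (norm ((deriv ^^ i) f z / f z)) \<le> (\<Sum>l<i. L l r)"
      using \<open>i \<le> k\<close>
    proof (induction i)
      case 0
      then show ?case by (cases "f z = 0") (auto simp: log_plus_def)
    next
      case (Suc i)
      have "norm ((deriv ^^ Suc i) f z / f z) = norm ((deriv ^^ i) f z / f z) * norm (deriv ((deriv ^^ i) f) z / (deriv ^^ i) f z)"
        using nz[of i] Suc.prems by (simp add: norm_divide)
      then have "log_plus (norm ((deriv ^^ Suc i) f z / f z)) \<le> log_plus (norm ((deriv ^^ i) f z / f z))
         + log_plus (norm (deriv ((deriv ^^ i) f) z / (deriv ^^ i) f z))"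
        by (simp only:) (rule log_plus_mult, auto)
      then show ?case using Suc L(3)[of i r z] r by simp
    qed
    also have "\<dots> \<le> (\<Sum>l<k. L l r)" using r L(2) by (intro sum_mono2) auto
    finally show "log_plus (norm ((deriv ^^ i) f z / f z)) \<le> (\<Sum>l<k. L l r)" .
  qed
qed

end

section \<open>The main inequality\<close>

locale diff_poly_setting = exceptional_set f E for f E +
  fixes b :: "nat \<Rightarrow> complex \<Rightarrow> complex" and q :: "nat \<Rightarrow> nat \<Rightarrow> nat" and k t d m :: nat
    and P :: "complex \<Rightarrow> complex"
  assumes t: "t \<ge> 1"
    and b_mero: "\<And>j. j \<in> {1..t} \<Longrightarrow> b j meromorphic_on UNIV"
    and b_small: "\<And>j. j \<in> {1..t} \<Longrightarrow> small (nevanlinna_T (b j))"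
    and b_radius: "\<And>j r. j \<in> {1..t} \<Longrightarrow> r \<ge> 1 \<Longrightarrow> r \<notin> E \<Longrightarrow> analytic_radius (b j) r"
    and P: "P = diff_poly k t b q f"
    and homogeneous: "\<And>j. j \<in> {1..t} \<Longrightarrow> monomial_degree k (\<lambda>i. q i j) = d"
    and m: "1 \<le> m" "\<And>j. j \<in> {1..t} \<Longrightarrow> m \<le> q 0 j"
    and higher: "\<And>l. l < k \<Longrightarrow> log_deriv_bounded ((deriv ^^ l) f) E"
    and P_nonzero: "nonzero_mero P"
    and P_bounded: "log_deriv_bounded P E"
begin

lemma m_le_d: "m \<le> d"
proof -
  have "m \<le> q 0 1" using m(2)[of 1] t by simp
  also have "\<dots> \<le> (\<Sum>i\<le>k. q i 1)" by (rule member_le_sum) auto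
  also have "\<dots> = d" using homogeneous[of 1] t by (simp add: monomial_degree_def)
  finally show ?thesis .
qed

lemma regular_P: "r \<ge> 1 \<Longrightarrow> r \<notin> E \<Longrightarrow> regular_radius P r"
  by (rule log_deriv_bounded_regular[OF P_bounded])

text \<open>By homogeneity f^d distributes over the factors of each monomial and leaves products of
  quotients f^(i)/f. Their log+ is bounded uniformly on the circle, whereas the coefficients are
  small only on average and therefore stay under the sum.\<close>

lemma quotient_log_plus_le:
  obtains H where "small H" "\<And>r. r \<ge> 1 \<Longrightarrow> H r \<ge> 0"
    "\<And>r z. r \<ge> 1 \<Longrightarrow> r \<notin> E \<Longrightarrow> norm z = r \<Longrightarrow>
       log_plus (norm (P z / f z ^ d)) \<le> (\<Sum>j=1..t. log_plus (norm (b j z))) + H r"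
proof -
  obtain L where L: "small L" "\<And>r. r \<ge> 1 \<Longrightarrow> L r \<ge> 0"
    "\<And>r z i. r \<ge> 1 \<Longrightarrow> r \<notin> E \<Longrightarrow> norm z = r \<Longrightarrow> i \<le> k \<Longrightarrow> log_plus (norm ((deriv ^^ i) f z / f z)) \<le> L r"
    using small_higher_log_deriv[of k] higher by blast
  define H where "H = (\<lambda>r. ln t + real t * (real d * L r))"
  show ?thesis
  proof
    show "small H" unfolding H_def by (intro small_add small_const small_cmult L) auto
    show "H r \<ge> 0" if "r \<ge> 1" for r using L(2)[OF that] t by (auto simp: H_def)
    fix r and z :: complex assume r: "r \<ge> 1" "r \<notin> E" "norm z = r"
    have fz: "f z \<noteq> 0" using regular[OF r(1,2)] r(3) by (auto simp: regular_radius_def)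
    define x where "x = (\<lambda>j. norm (b j z) * (\<Prod>i\<le>k. norm ((deriv ^^ i) f z / f z) ^ q i j))"
    have "norm (P z / f z ^ d) \<le> (\<Sum>j=1..t. x j)"
    proof -
      have "b j z * diff_monomial k (\<lambda>i. q i j) f z / f z ^ d = b j z * (\<Prod>i\<le>k. ((deriv ^^ i) f z / f z) ^ q i j)"
        if "j \<in> {1..t}" for j
      proof -
        have "f z ^ d = (\<Prod>i\<le>k. f z ^ q i j)"
          using homogeneous[OF that] by (simp add: monomial_degree_def flip: power_sum)
        then show ?thesis by (simp add: diff_monomial_def power_divide prod_dividef)
      qed
      then have "P z / f z ^ d = (\<Sum>j=1..t. b j z * (\<Prod>i\<le>k. ((deriv ^^ i) f z / f z) ^ q i j))"
        unfolding P diff_poly_def sum_divide_distrib by (intro sum.cong) auto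
      also have "norm \<dots> \<le> (\<Sum>j=1..t. x j)"
        by (intro sum_norm_le) (simp add: x_def norm_mult prod_norm[symmetric] norm_power)
      finally show ?thesis .
    qed
    then have "log_plus (norm (P z / f z ^ d)) \<le> log_plus (\<Sum>j=1..t. x j)" by (rule log_plus_mono)
    also have "\<dots> \<le> ln (card {1..t}) + (\<Sum>j=1..t. log_plus (x j))"
      using t by (intro log_plus_sum) (auto simp: x_def intro!: mult_nonneg_nonneg prod_nonneg)
    also have "(\<Sum>j=1..t. log_plus (x j)) \<le> (\<Sum>j=1..t. log_plus (norm (b j z)) + real d * L r)"
    proof (rule sum_mono)
      fix j assume j: "j \<in> {1..t}"
      have "log_plus (x j) \<le> log_plus (norm (b j z)) + log_plus (\<Prod>i\<le>k. norm ((deriv ^^ i) f z / f z) ^ q i j)"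
        unfolding x_def by (intro log_plus_mult prod_nonneg) auto
      also have "log_plus (\<Prod>i\<le>k. norm ((deriv ^^ i) f z / f z) ^ q i j) \<le> (\<Sum>i\<le>k. log_plus (norm ((deriv ^^ i) f z / f z) ^ q i j))"
        by (intro log_plus_prod) auto
      also have "\<dots> \<le> (\<Sum>i\<le>k. real (q i j) * L r)"
        using L(3)[OF r] by (intro sum_mono) (auto simp: log_plus_power intro!: mult_left_mono)
      also have "\<dots> = real d * L r"
        using homogeneous[OF j] by (simp add: monomial_degree_def flip: sum_distrib_right of_nat_sum)
      finally show "log_plus (x j) \<le> log_plus (norm (b j z)) + real d * L r" by simp
    qed
    also have "ln (card {1..t}) + (\<Sum>j=1..t. log_plus (norm (b j z)) + real d * L r) =
      (\<Sum>j=1..t. log_plus (norm (b j z))) + H r"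
      by (simp add: sum.distrib H_def)
    finally show "log_plus (norm (P z / f z ^ d)) \<le> (\<Sum>j=1..t. log_plus (norm (b j z))) + H r" by simp
  qed
qed

lemma proximity_le_T: "g meromorphic_on UNIV \<Longrightarrow> r \<ge> 1 \<Longrightarrow> proximity g r \<le> nevanlinna_T g r"
  using Nsum_nonneg[of "pole_order g" r] pole_order_nonneg[of g] by (simp add: nevanlinna_T_eq)

lemma continuous_log_plus_b:
  assumes "r \<ge> 1" "r \<notin> E" "j \<in> {1..t}"
  shows "continuous_on (sphere 0 r) (\<lambda>z. log_plus (norm (b j z)))"
  by (intro continuous_intros analytic_radius_continuous b_radius assms)

lemma circle_mean_log_plus_b_le:
  assumes "r \<ge> 1" "r \<notin> E"
  shows "circle_mean (\<lambda>z. \<Sum>j=1..t. log_plus (norm (b j z))) r \<le> (\<Sum>j=1..t. nevanlinna_T (b j) r)"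
proof -
  have "circle_mean (\<lambda>z. \<Sum>j=1..t. log_plus (norm (b j z))) r = (\<Sum>j=1..t. proximity (b j) r)"
    unfolding proximity_eq_circle_mean
    using assms by (intro circle_mean_sum continuous_log_plus_b) auto
  also have "\<dots> \<le> (\<Sum>j=1..t. nevanlinna_T (b j) r)"
    using assms by (intro sum_mono proximity_le_T b_mero) auto
  finally show ?thesis .
qed

text \<open>Coefficient poles can cancel zeros of P or create poles of P; every such disturbance is
  charged to this weight, whose counting function is negligible.\<close>

definition B where "B z = (\<Sum>j=1..t. pole_order (b j) z)"

lemma B_eq: "B z = of_int (\<Sum>j=1..t. pole_multiplicity (b j) z)"
  by (simp add: B_def pole_order_eq_multiplicity)

lemma B_nonneg: "(\<Sum>j=1..t. pole_multiplicity (b j) z) \<ge> 0"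
  by (intro sum_nonneg pole_multiplicity_nonneg b_mero)

lemma locally_finite_B: "locally_finite_weight B"
  unfolding B_def[abs_def] by (intro locally_finite_weight_sum locally_finite_weight_pole_order b_mero)

lemma Nsum_B_le:
  assumes "r \<ge> 1" shows "Nsum B r \<le> (\<Sum>j=1..t. nevanlinna_T (b j) r)"
proof -
  have "Nsum B r = (\<Sum>j=1..t. Nsum (pole_order (b j)) r)"
    unfolding B_def[abs_def] by (intro Nsum_sum locally_finite_weight_pole_order b_mero)
  also have "\<dots> \<le> (\<Sum>j=1..t. nevanlinna_T (b j) r)"
    using assms by (intro sum_mono Nsum_pole_order_le b_mero) auto
  finally show ?thesis .
qed

lemma order_P:
  "order_ge P z (int m * max 0 (zorder f z) - int d * (int k + 1) * max 0 (- zorder f z)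
     - (\<Sum>j=1..t. pole_multiplicity (b j) z))"
  unfolding P by (rule diff_poly_order_ge[OF nonzero b_mero homogeneous m(2)])

lemma pole_order_P_le: "pole_order P z \<le> real d * (real k + 1) * pole_order f z + B z"
proof -
  have "order_ge P z (- (int d * (int k + 1) * max 0 (- zorder f z) + (\<Sum>j=1..t. pole_multiplicity (b j) z)))"
    using order_P by (rule order_ge_mono) simp
  then have "pole_order P z \<le> of_int (int d * (int k + 1) * max 0 (- zorder f z) + (\<Sum>j=1..t. pole_multiplicity (b j) z))"
    using B_nonneg by (intro pole_order_le_of_order_ge nonzero_mero_imp_meromorphic P_nonzero) auto
  also have "\<dots> = real d * (real k + 1) * pole_order f z + B z"
    by (simp add: B_eq pole_order_eq_max[OF nonzero] of_int_max)
  finally show ?thesis .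
qed

lemma small_sum_b: "small (\<lambda>r. \<Sum>j=1..t. nevanlinna_T (b j) r)"
  by (intro small_sum b_small)

text \<open>Makes the logarithmic derivative of P negligible. The proximity part comes from P = f^d
  (P/f^d), the poles from those of f and of the coefficients.\<close>

lemma T_P_le: "\<exists>C. eventually (\<lambda>r. nevanlinna_T P r \<le> C * T r) off_E"
proof -
  obtain H where H: "small H" "\<And>r. r \<ge> 1 \<Longrightarrow> H r \<ge> 0"
    "\<And>r z. r \<ge> 1 \<Longrightarrow> r \<notin> E \<Longrightarrow> norm z = r \<Longrightarrow>
       log_plus (norm (P z / f z ^ d)) \<le> (\<Sum>j=1..t. log_plus (norm (b j z))) + H r"
    using quotient_log_plus_le by blast
  have mP: "P meromorphic_on UNIV" by (rule nonzero_mero_imp_meromorphic[OF P_nonzero])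
  let ?b = "\<lambda>r. \<Sum>j=1..t. nevanlinna_T (b j) r"
  have le: "nevanlinna_T P r \<le> (real d + real d * (real k + 1)) * T r + (2 * ?b r + H r)"
    if r: "r \<ge> 1" "r \<notin> E" for r
  proof -
    have cf: "continuous_on (sphere 0 r) f" by (rule regular_radius_continuous[OF regular[OF r]])
    have cP: "continuous_on (sphere 0 r) P" by (rule regular_radius_continuous[OF regular_P[OF r]])
    have cb: "continuous_on (sphere 0 r) (\<lambda>z. \<Sum>j=1..t. log_plus (norm (b j z)))"
      by (intro continuous_on_sum continuous_log_plus_b r)
    have c1: "continuous_on (sphere 0 r) (\<lambda>z. log_plus (norm (P z)))"
      by (intro continuous_intros cP)
    have c2: "continuous_on (sphere 0 r) (\<lambda>z. real d * log_plus (norm (f z)) + ((\<Sum>j=1..t. log_plus (norm (b j z))) + H r))"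
      by (intro continuous_on_add cb) (intro continuous_intros cf)+
    have "proximity P r \<le> circle_mean (\<lambda>z. real d * log_plus (norm (f z)) + ((\<Sum>j=1..t. log_plus (norm (b j z))) + H r)) r"
      unfolding proximity_eq_circle_mean
    proof (rule circle_mean_mono)
      fix z :: complex assume z: "norm z = r"
      have fz: "f z \<noteq> 0" using regular[OF r] z by (auto simp: regular_radius_def)
      then have "norm (P z) = norm (f z) ^ d * norm (P z / f z ^ d)" by (simp add: norm_divide norm_power)
      then have "log_plus (norm (P z)) \<le> log_plus (norm (f z) ^ d) + log_plus (norm (P z / f z ^ d))"
        by (simp only:) (rule log_plus_mult, auto)
      then show "log_plus (norm (P z)) \<le> real d * log_plus (norm (f z)) + ((\<Sum>j=1..t. log_plus (norm (b j z))) + H r)"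
        using H(3)[OF r z] by (simp add: log_plus_power)
    qed (rule c1, rule c2, use r in simp)
    also have "\<dots> = real d * proximity f r + (circle_mean (\<lambda>z. \<Sum>j=1..t. log_plus (norm (b j z))) r + H r)"
    proof -
      have "circle_mean (\<lambda>z. (\<Sum>j=1..t. log_plus (norm (b j z))) + H r) r =
          circle_mean (\<lambda>z. \<Sum>j=1..t. log_plus (norm (b j z))) r + H r"
        using r by (subst circle_mean_add[OF cb]) auto
      moreover have "circle_mean (\<lambda>z. real d * log_plus (norm (f z)) + ((\<Sum>j=1..t. log_plus (norm (b j z))) + H r)) r
        = circle_mean (\<lambda>z. real d * log_plus (norm (f z))) r + circle_mean (\<lambda>z. (\<Sum>j=1..t. log_plus (norm (b j z))) + H r) r"
        using r by (intro circle_mean_add continuous_on_add cb continuous_intros cf) auto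
      ultimately show ?thesis by (simp add: circle_mean_cmult proximity_eq_circle_mean)
    qed
    also have "\<dots> \<le> real d * T r + (?b r + H r)"
      using circle_mean_log_plus_b_le[OF r] proximity_le_T[OF mero r(1)] by (intro add_mono mult_left_mono) auto
    finally have p: "proximity P r \<le> real d * T r + (?b r + H r)" .
    have "Nsum (pole_order P) r \<le> Nsum (\<lambda>z. real d * (real k + 1) * pole_order f z + B z) r"
      using r by (intro Nsum_mono locally_finite_weight_add locally_finite_weight_cmult locally_finite_weight_pole_order
          mero mP locally_finite_B pole_order_P_le)
    also have "\<dots> = real d * (real k + 1) * Nsum (pole_order f) r + Nsum B r"
      by (simp only: Nsum_add[OF locally_finite_weight_cmult[OF locally_finite_weight_pole_order[OF mero]] locally_finite_B] Nsum_cmult)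
    also have "\<dots> \<le> real d * (real k + 1) * T r + ?b r"
      using r Nsum_B_le Nsum_pole_order_le[OF mero, of r] by (intro add_mono mult_left_mono) auto
    finally have "Nsum (pole_order P) r \<le> real d * (real k + 1) * T r + ?b r" .
    moreover have "nevanlinna_T P r = proximity P r + Nsum (pole_order P) r"
      using r by (intro nevanlinna_T_eq mP) auto
    ultimately show ?thesis using p by (simp only: distrib_right)
  qed
  have "small (\<lambda>r. 2 * ?b r + H r)" by (intro small_add small_cmult small_sum_b H) auto
  then have "eventually (\<lambda>r. 2 * ?b r + H r \<le> 1 * T r) off_E" unfolding small_def by (meson zero_less_one)
  moreover have "eventually (\<lambda>r. nevanlinna_T P r \<le> (real d + real d * (real k + 1)) * T r + (2 * ?b r + H r)) off_E"
    by (rule eventually_off_E[of 1]) (rule le)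
  ultimately have "eventually (\<lambda>r. nevanlinna_T P r \<le> (real d + real d * (real k + 1) + 1) * T r) off_E"
    by eventually_elim (simp only: distrib_right)
  then show ?thesis by blast
qed

text \<open>(1/f)^d = (P/f^d)(1/P) bounds d m(r,1/f) by m(r,1/P) up to small terms, and the first
  main theorem turns m(r,1/f) into T minus the count of the zeros of f.\<close>

lemma d_T_le:
  obtains X where "small X"
    "\<And>r. r \<ge> 1 \<Longrightarrow> r \<notin> E \<Longrightarrow> real d * T r \<le> circle_mean (\<lambda>z. log_plus (norm (1 / P z))) r
       + real d * Nsum (zero_order f) r + X r"
proof -
  obtain H where H: "small H" "\<And>r. r \<ge> 1 \<Longrightarrow> H r \<ge> 0"
    "\<And>r z. r \<ge> 1 \<Longrightarrow> r \<notin> E \<Longrightarrow> norm z = r \<Longrightarrow>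
       log_plus (norm (P z / f z ^ d)) \<le> (\<Sum>j=1..t. log_plus (norm (b j z))) + H r"
    using quotient_log_plus_le by blast
  let ?b = "\<lambda>r. \<Sum>j=1..t. nevanlinna_T (b j) r"
  define X where "X = (\<lambda>r. ?b r + H r + real d * ln (norm (zor_poly f 0 0)))"
  show ?thesis
  proof
    show "small X" unfolding X_def by (intro small_add small_sum_b small_const H)
    fix r assume r: "r \<ge> 1" "r \<notin> E"
    have cf: "continuous_on (sphere 0 r) f" by (rule regular_radius_continuous[OF regular[OF r]])
    have cP: "continuous_on (sphere 0 r) P" by (rule regular_radius_continuous[OF regular_P[OF r]])
    have nz: "f z \<noteq> 0" "P z \<noteq> 0" if "norm z = r" for z
      using regular[OF r] regular_P[OF r] that by (auto simp: regular_radius_def)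
    have cb: "continuous_on (sphere 0 r) (\<lambda>z. \<Sum>j=1..t. log_plus (norm (b j z)))"
      by (intro continuous_on_sum continuous_log_plus_b r)
    have c1: "continuous_on (sphere 0 r) (\<lambda>z. log_plus (norm (1 / f z)))"
      using nz by (intro continuous_intros cf) auto
    have c2: "continuous_on (sphere 0 r) (\<lambda>z. log_plus (norm (1 / P z)))"
      using nz by (intro continuous_intros cP) auto
    have c3: "continuous_on (sphere 0 r) (\<lambda>z. real d * log_plus (norm (1 / f z)))"
      by (intro continuous_on_mult continuous_on_const c1)
    have c4: "continuous_on (sphere 0 r) (\<lambda>z. ((\<Sum>j=1..t. log_plus (norm (b j z))) + H r) + log_plus (norm (1 / P z)))"
      by (intro continuous_on_add continuous_on_const cb c2)
    have "circle_mean (\<lambda>z. real d * log_plus (norm (1 / f z))) r \<le>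
      circle_mean (\<lambda>z. ((\<Sum>j=1..t. log_plus (norm (b j z))) + H r) + log_plus (norm (1 / P z))) r"
    proof (rule circle_mean_mono)
      fix z :: complex assume z: "norm z = r"
      have "norm (1 / f z) ^ d = norm (P z / f z ^ d) * norm (1 / P z)"
        using nz[OF z] by (simp add: norm_divide norm_power power_divide)
      then have "real d * log_plus (norm (1 / f z)) = log_plus (norm (P z / f z ^ d) * norm (1 / P z))"
        by (simp add: log_plus_power[symmetric])
      also have "\<dots> \<le> log_plus (norm (P z / f z ^ d)) + log_plus (norm (1 / P z))"
        by (intro log_plus_mult) auto
      finally show "real d * log_plus (norm (1 / f z)) \<le> ((\<Sum>j=1..t. log_plus (norm (b j z))) + H r) + log_plus (norm (1 / P z))"
        using H(3)[OF r z] by linarith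
    qed (rule c3, rule c4, use r in simp)
    also have "\<dots> = circle_mean (\<lambda>z. \<Sum>j=1..t. log_plus (norm (b j z))) r + H r + circle_mean (\<lambda>z. log_plus (norm (1 / P z))) r"
    proof -
      have "circle_mean (\<lambda>z. (\<Sum>j=1..t. log_plus (norm (b j z))) + H r) r =
          circle_mean (\<lambda>z. \<Sum>j=1..t. log_plus (norm (b j z))) r + H r"
        using r by (subst circle_mean_add[OF cb]) auto
      then show ?thesis
        using r by (subst circle_mean_add[OF continuous_on_add[OF cb continuous_on_const] c2]) auto
    qed
    also have "\<dots> \<le> ?b r + H r + circle_mean (\<lambda>z. log_plus (norm (1 / P z))) r"
      using circle_mean_log_plus_b_le[OF r] by simp
    finally have "real d * circle_mean (\<lambda>z. log_plus (norm (1 / f z))) r \<le>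
      ?b r + H r + circle_mean (\<lambda>z. log_plus (norm (1 / P z))) r"
      by (simp only: circle_mean_cmult)
    moreover have "real d * T r = real d * circle_mean (\<lambda>z. log_plus (norm (1 / f z))) r
       + real d * Nsum (zero_order f) r + real d * ln (norm (zor_poly f 0 0))"
      unfolding first_main_theorem[OF nonzero regular[OF r]] by (simp only: distrib_left)
    ultimately show "real d * T r \<le> circle_mean (\<lambda>z. log_plus (norm (1 / P z))) r
       + real d * Nsum (zero_order f) r + X r"
      by (simp add: X_def)
  qed
qed

abbreviation Nbar where "Nbar \<equiv> reduced_counting_N (\<lambda>z. 1 / (P z - 1))"

lemma one_points_mero: "(\<lambda>z. 1 / (P z - 1)) meromorphic_on UNIV"
  by (intro meromorphic_intros nonzero_mero_imp_meromorphic[OF P_nonzero])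

lemma Nbar_nonneg: "r \<ge> 1 \<Longrightarrow> Nbar r \<ge> 0"
  by (simp add: reduced_counting_N_eq_Nsum[OF one_points_mero] Nsum_nonneg)

lemma main_inequality_constant:
  assumes c: "\<forall>\<^sub>\<approx>z\<in>UNIV. P z = c"
  obtains X where "small X" "\<And>r. r \<ge> 1 \<Longrightarrow> r \<notin> E \<Longrightarrow> (real m - 2) * T r \<le> Nbar r + X r"
proof -
  obtain X where X: "small X"
    "\<And>r. r \<ge> 1 \<Longrightarrow> r \<notin> E \<Longrightarrow> real d * T r \<le> circle_mean (\<lambda>z. log_plus (norm (1 / P z))) r
       + real d * Nsum (zero_order f) r + X r"
    using d_T_le by blast
  have ev: "eventually (\<lambda>w. P w = c) (at z)" for z
    using c by (simp add: eventually_cosparse_open_eq)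
  have "c \<noteq> 0"
  proof
    assume "c = 0"
    with ev[of 0] nonzero_mero_frequently[OF P_nonzero, of 0] show False by (simp add: frequently_def)
  qed
  have zero: "zero_order f z \<le> B z" for z
  proof -
    have "zorder P z = zorder (\<lambda>_. c) z" by (rule zorder_cong) (use ev in auto)
    also have "\<dots> = 0" using \<open>c \<noteq> 0\<close> by (intro zorder_eq_0I) auto
    finally have "int m * max 0 (zorder f z) - int d * (int k + 1) * max 0 (- zorder f z)
     - (\<Sum>j=1..t. pole_multiplicity (b j) z) \<le> 0"
      using order_P[of z] by (simp add: order_ge_nonzero_mero[OF P_nonzero])
    moreover have "max 0 (zorder f z) \<le> int m * max 0 (zorder f z)"
      using m(1) mult_right_mono[of 1 "int m" "max 0 (zorder f z)"] by simp
    moreover have "max 0 (zorder f z) = 0 \<or> max 0 (- zorder f z) = 0" by auto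
    ultimately have "max 0 (zorder f z) \<le> (\<Sum>j=1..t. pole_multiplicity (b j) z)"
      using B_nonneg[of z] by auto
    then have "real_of_int (max 0 (zorder f z)) \<le> B z"
      unfolding B_eq by (simp only: of_int_le_iff)
    then show ?thesis by (simp add: zero_order_def of_int_max)
  qed
  let ?b = "\<lambda>r. \<Sum>j=1..t. nevanlinna_T (b j) r"
  show ?thesis
  proof
    show "small (\<lambda>r. log_plus (norm (1 / c)) + real d * ?b r + X r)"
      by (intro small_add small_const small_cmult small_sum_b X) auto
    fix r assume r: "r \<ge> 1" "r \<notin> E"
    \<comment> \<open>The equality is known off a sparse set only; analyticity on the regular circle
      extends it to every point there.\<close>
    have "P z = c" if "norm z = r" for z
    proof -
      have "P analytic_on {z}" using regular_P[OF r] that by (auto simp: regular_radius_def)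
      then have "P \<midarrow>z\<rightarrow> P z" using analytic_at_imp_isCont isContD by blast
      moreover have "P \<midarrow>z\<rightarrow> c" using ev tendsto_eventually by blast
      ultimately show ?thesis by (rule LIM_unique)
    qed
    then have "circle_mean (\<lambda>z. log_plus (norm (1 / P z))) r = circle_mean (\<lambda>z. log_plus (norm (1 / c))) r"
      using r by (intro circle_mean_cong) auto
    moreover have "Nsum (zero_order f) r \<le> ?b r"
      using Nsum_mono[OF locally_finite_weight_zero_order[OF nonzero] locally_finite_B zero r(1)] Nsum_B_le[OF r(1)]
      by simp
    then have "real d * Nsum (zero_order f) r \<le> real d * ?b r" by (intro mult_left_mono) auto
    ultimately have "real d * T r \<le> log_plus (norm (1 / c)) + real d * ?b r + X r"
      using X(2)[OF r] by simp
    moreover have "(real m - 2) * T r \<le> real d * T r"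
      using m_le_d nevanlinna_T_nonneg[OF mero r(1)] by (intro mult_right_mono) auto
    ultimately show "(real m - 2) * T r \<le> Nbar r + (log_plus (norm (1 / c)) + real d * ?b r + X r)"
      using Nbar_nonneg[OF r(1)] by linarith
  qed
qed

lemma main_inequality_nonconstant:
  assumes P1: "nonzero_mero (\<lambda>z. P z - 1)" "log_deriv_bounded (\<lambda>z. P z - 1) E"
    and P': "nonzero_mero (deriv P)" "\<And>r. r \<ge> 1 \<Longrightarrow> r \<notin> E \<Longrightarrow> regular_radius (deriv P) r"
  obtains X where "small X" "\<And>r. r \<ge> 1 \<Longrightarrow> r \<notin> E \<Longrightarrow> (real m - 2) * T r \<le> Nbar r + X r"
proof -
  obtain X where X: "small X"
    "\<And>r. r \<ge> 1 \<Longrightarrow> r \<notin> E \<Longrightarrow> real d * T r \<le> circle_mean (\<lambda>z. log_plus (norm (1 / P z))) r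
       + real d * Nsum (zero_order f) r + X r"
    using d_T_le by blast
  let ?P1 = "\<lambda>z. P z - 1"
  have mP: "P meromorphic_on UNIV" "?P1 meromorphic_on UNIV"
    by (rule nonzero_mero_imp_meromorphic[OF P_nonzero], rule nonzero_mero_imp_meromorphic[OF P1(1)])
  obtain C where C: "eventually (\<lambda>r. nevanlinna_T P r \<le> C * T r) off_E" using T_P_le by blast
  obtain L where L: "small L" "\<And>r. r \<ge> 1 \<Longrightarrow> L r \<ge> 0"
    "\<And>r z. r \<ge> 1 \<Longrightarrow> r \<notin> E \<Longrightarrow> norm z = r \<Longrightarrow> log_plus (norm (deriv P z / P z)) \<le> L r"
    using small_log_deriv[OF P_bounded C] by blast
  \<comment> \<open>P - 1 has the poles of P with the same orders, and log+ |P - 1| \<le> log+ |P| +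
    ln 2. The bound makes the logarithmic derivative of P - 1 negligible.\<close>
  have "\<exists>C. eventually (\<lambda>r. nevanlinna_T ?P1 r \<le> C * T r) off_E"
  proof -
    have "nevanlinna_T ?P1 r \<le> nevanlinna_T P r + ln 2" if r: "r \<ge> 1" "r \<notin> E" for r
    proof -
      have cP: "continuous_on (sphere 0 r) P" by (rule regular_radius_continuous[OF regular_P[OF r]])
      have "proximity ?P1 r \<le> circle_mean (\<lambda>z. log_plus (norm (P z)) + ln 2) r"
        unfolding proximity_eq_circle_mean
      proof (rule circle_mean_mono)
        fix z
        have "log_plus (norm (P z - 1)) \<le> log_plus (norm (P z) + 1)"
          using norm_triangle_ineq4[of "P z" 1] by (intro log_plus_mono) simp
        also have "\<dots> \<le> ln 2 + log_plus (norm (P z)) + log_plus 1" by (intro log_plus_add) auto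
        finally show "log_plus (norm (P z - 1)) \<le> log_plus (norm (P z)) + ln 2"
          by (simp add: log_plus_def)
      qed (use r in \<open>auto intro!: continuous_intros cP\<close>)
      also have "\<dots> = proximity P r + ln 2"
        unfolding proximity_eq_circle_mean using r by (subst circle_mean_add) (auto intro!: continuous_intros cP)
      finally have "proximity ?P1 r \<le> proximity P r + ln 2" .
      moreover have "pole_order ?P1 = pole_order P"
      proof
        fix z
        show "pole_order ?P1 z = pole_order P z"
        proof (cases "is_pole P z")
        case True
        then have p1: "is_pole ?P1 z" by (simp add: is_pole_minus_const_iff)
        have "zorder P z < 0" using isolated_pole_imp_neg_zorder[OF nonzero_mero_isolated(1)[OF P_nonzero] True] .
        then have "zorder (\<lambda>z. P z - 1) z = zorder P z"
          using zorder_eq_0I[of "\<lambda>_. 1" z]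
          by (intro zorder_diff1 nonzero_mero_imp_meromorphic nonzero_mero_frequently P_nonzero nonzero_mero_const) auto
        then show ?thesis using True p1 by (simp add: pole_order_def)
        qed (simp add: pole_order_def is_pole_minus_const_iff)
      qed
      ultimately show ?thesis using r mP by (simp add: nevanlinna_T_eq)
    qed
    then have 1: "eventually (\<lambda>r. nevanlinna_T ?P1 r \<le> nevanlinna_T P r + ln 2) off_E"
      by (rule eventually_off_E[of 1])
    have "eventually (\<lambda>r. ln 2 \<le> 1 * T r) off_E" using small_const[of "ln 2"] unfolding small_def by (meson zero_less_one)
    with C 1 have "eventually (\<lambda>r. nevanlinna_T ?P1 r \<le> (C + 1) * T r) off_E"
      by eventually_elim (simp only: distrib_right)
    then show ?thesis by blast
  qed
  then obtain C1 where C1: "eventually (\<lambda>r. nevanlinna_T ?P1 r \<le> C1 * T r) off_E" by blast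
  obtain L1 where L1: "small L1" "\<And>r. r \<ge> 1 \<Longrightarrow> L1 r \<ge> 0"
    "\<And>r z. r \<ge> 1 \<Longrightarrow> r \<notin> E \<Longrightarrow> norm z = r \<Longrightarrow> log_plus (norm (deriv ?P1 z / ?P1 z)) \<le> L1 r"
    using small_log_deriv[OF P1(2) C1] by blast
  define G where "G = (\<lambda>z. deriv P z / ?P1 z)"
  have G: "nonzero_mero G" unfolding G_def by (intro nonzero_mero_divide P' P1)
  have ordG: "zorder G z = zorder (deriv P) z - zorder ?P1 z" for z
    unfolding G_def by (intro zorder_divide nonzero_mero_imp_meromorphic nonzero_mero_frequently P' P1)
  define w where "w = (\<lambda>z. real d * zero_order f z - of_int (zorder G z))"
  define v where "v = (\<lambda>z. (real d - real m + 1) * zero_order f z + (if is_pole f z then 1 else 0)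
      + (if is_pole (\<lambda>z. 1 / (P z - 1)) z then 1 else 0) + (real d + 1) * B z)"
  have wv: "w z \<le> v z" for z
  proof -
    have "w z = real d * zero_order f z - of_int (zorder (deriv P) z) + of_int (zorder ?P1 z)"
      by (simp add: w_def ordG)
    then show ?thesis
      using local_order_inequality[OF nonzero P_nonzero P1(1) P'(1) order_P m(1) m_le_d B_nonneg, of z]
      unfolding v_def B_eq by (simp only:)
  qed
  have lf1: "locally_finite_weight (\<lambda>z. if is_pole f z then 1 else 0)"
    and lf2: "locally_finite_weight (\<lambda>z. if is_pole (\<lambda>z. 1 / (P z - 1)) z then 1 else 0)"
    by (rule locally_finite_weight_poles[OF mero], simp) (rule locally_finite_weight_poles[OF one_points_mero], simp)
  note lf0 = locally_finite_weight_zero_order[OF nonzero]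
  have lfw: "locally_finite_weight w"
    using locally_finite_weight_add[OF locally_finite_weight_cmult[OF lf0, of "real d"]
        locally_finite_weight_cmult[OF locally_finite_weight_zorder[OF G], of "-1"]]
    by (simp add: w_def)
  have lfv: "locally_finite_weight v"
    unfolding v_def by (intro locally_finite_weight_add locally_finite_weight_cmult lf0 lf1 lf2 locally_finite_B)
  let ?b = "\<lambda>r. \<Sum>j=1..t. nevanlinna_T (b j) r"
  let ?c = "(real d - real m + 1) * \<bar>ln (norm (zor_poly f 0 0))\<bar>"
  define Y where "Y = (\<lambda>r. X r + (ln 2 + L r + L1 r) + (- ln (norm (zor_poly G 0 0)) + ?c) + (real d + 1) * ?b r)"
  show ?thesis
  proof
    show "small Y" unfolding Y_def
      by (intro small_add small_const small_cmult small_sum_b X L L1) auto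
    fix r assume r: "r \<ge> 1" "r \<notin> E"
    have reg1: "regular_radius ?P1 r" by (rule log_deriv_bounded_regular[OF P1(2) r])
    have regG: "regular_radius G r"
      unfolding regular_radius_def G_def
      using r reg1 P'(2)[OF r] regular_P[OF r] by (auto simp: regular_radius_def intro!: analytic_intros)
    have cP: "continuous_on (sphere 0 r) P" by (rule regular_radius_continuous[OF regular_P[OF r]])
    have cG: "continuous_on (sphere 0 r) G" by (rule regular_radius_continuous[OF regG])
    have nz: "P z \<noteq> 0" "P z - 1 \<noteq> 0" "deriv P z \<noteq> 0" "G z \<noteq> 0" if "norm z = r" for z
      using regular_P[OF r] reg1 P'(2)[OF r] regG that by (auto simp: regular_radius_def)
    have "circle_mean (\<lambda>z. log_plus (norm (1 / P z))) r \<le> circle_mean (\<lambda>z. (ln 2 + L r + L1 r) - ln (norm (G z))) r"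
    proof (rule circle_mean_mono)
      fix z :: complex assume z: "norm z = r"
      have dP1: "deriv ?P1 z = deriv P z"
      proof -
        have "P analytic_on {z}" using regular_P[OF r] z by (auto simp: regular_radius_def)
        then have "P field_differentiable at z" by (rule analytic_on_imp_differentiable_at) simp
        then show ?thesis by (subst deriv_diff) auto
      qed
      \<comment> \<open>Holds because (P'/P)/G = (P - 1)/P.\<close>
      have "1 / P z = 1 + - (deriv P z / P z * (1 / G z))"
        using nz[OF z] by (simp add: G_def field_simps)
      then have "norm (1 / P z) \<le> 1 + norm (deriv P z / P z) * norm (1 / G z)"
        by (metis norm_minus_cancel norm_mult norm_one norm_triangle_ineq)
      then have "log_plus (norm (1 / P z)) \<le> log_plus (1 + norm (deriv P z / P z) * norm (1 / G z))"
        by (rule log_plus_mono)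
      also have "\<dots> \<le> ln 2 + log_plus 1 + log_plus (norm (deriv P z / P z) * norm (1 / G z))"
        by (intro log_plus_add) auto
      also have "log_plus 1 = 0" by (simp add: log_plus_def)
      also have "log_plus (norm (deriv P z / P z) * norm (1 / G z)) \<le> log_plus (norm (deriv P z / P z)) + log_plus (norm (1 / G z))"
        by (intro log_plus_mult) auto
      \<comment> \<open>log+ |G| is negligible, G being the logarithmic derivative of P - 1, and the
        mean of ln |G| is evaluated exactly by Jensen's formula.\<close>
      also have "log_plus (norm (1 / G z)) = log_plus (norm (G z)) - ln (norm (G z))"
        using ln_eq_log_plus_diff[of "norm (G z)"] nz[OF z] by (simp add: norm_divide)
      finally show "log_plus (norm (1 / P z)) \<le> (ln 2 + L r + L1 r) - ln (norm (G z))"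
        using L(3)[OF r z] L1(3)[OF r z] unfolding dP1 G_def[symmetric] by (simp add: G_def)
    qed (use r nz in \<open>auto intro!: continuous_intros cP cG\<close>)
    also have "\<dots> = (ln 2 + L r + L1 r) - circle_mean (\<lambda>z. ln (norm (G z))) r"
      using r nz by (subst circle_mean_diff) (auto intro!: continuous_intros cG)
    also have "circle_mean (\<lambda>z. ln (norm (G z))) r = ln (norm (zor_poly G 0 0)) + Nsum (\<lambda>a. of_int (zorder G a)) r"
      by (rule jensen_formula[OF G regG])
    finally have 1: "real d * T r \<le> real d * Nsum (zero_order f) r - Nsum (\<lambda>a. of_int (zorder G a)) r
        + (X r + (ln 2 + L r + L1 r) - ln (norm (zor_poly G 0 0)))"
      using X(2)[OF r] by linarith
    have "real d * Nsum (zero_order f) r - Nsum (\<lambda>a. of_int (zorder G a)) r = Nsum w r"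
      unfolding w_def
      by (simp only: Nsum_diff[OF locally_finite_weight_cmult[OF lf0] locally_finite_weight_zorder[OF G]] Nsum_cmult)
    also have "\<dots> \<le> Nsum v r" by (rule Nsum_mono[OF lfw lfv wv r(1)])
    also have "\<dots> = (real d - real m + 1) * Nsum (zero_order f) r + Nsum (\<lambda>z. if is_pole f z then 1 else 0) r
      + Nsum (\<lambda>z. if is_pole (\<lambda>z. 1 / (P z - 1)) z then 1 else 0) r + (real d + 1) * Nsum B r"
      unfolding v_def
      by (simp only: Nsum_add locally_finite_weight_add locally_finite_weight_cmult lf0 lf1 lf2 locally_finite_B Nsum_cmult)
    also have "Nsum (\<lambda>z. if is_pole (\<lambda>z. 1 / (P z - 1)) z then 1 else 0) r = Nbar r"
      using r by (simp add: reduced_counting_N_eq_Nsum[OF one_points_mero])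
    also have "Nsum (\<lambda>z. if is_pole f z then 1 else 0) r \<le> T r"
    proof -
      have "(if is_pole f z then 1 else 0) \<le> pole_order f z" for z
        using pole_order_pos[OF mero, of z] pole_order_nonneg[OF mero, of z] by auto
      then have "Nsum (\<lambda>z. if is_pole f z then 1 else 0) r \<le> Nsum (pole_order f) r"
        by (intro Nsum_mono lf1 locally_finite_weight_pole_order mero r)
      then show ?thesis using Nsum_pole_order_le[OF mero, of r] r by simp
    qed
    also have "(real d - real m + 1) * Nsum (zero_order f) r \<le>
        (real d - real m + 1) * (T r + \<bar>ln (norm (zor_poly f 0 0))\<bar>)"
      using m_le_d by (intro mult_left_mono Nsum_zero_order_le[OF nonzero regular[OF r]]) auto
    also have "(real d + 1) * Nsum B r \<le> (real d + 1) * ?b r"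
      using Nsum_B_le[OF r(1)] by (intro mult_left_mono) auto
    finally have "real d * Nsum (zero_order f) r - Nsum (\<lambda>a. of_int (zorder G a)) r \<le>
      (real d - real m + 1) * T r + ?c + T r + Nbar r + (real d + 1) * ?b r"
      by (simp add: distrib_left)
    \<comment> \<open>The coefficients of T combine to d - (d - m + 1) - 1 = m - 2.\<close>
    with 1 have "real d * T r - (real d - real m + 1) * T r - T r \<le> Nbar r + Y r"
      unfolding Y_def by linarith
    then show "(real m - 2) * T r \<le> Nbar r + Y r"
      by (simp add: algebra_simps)
  qed
qed

end

section \<open>Assembling the exceptional set and the constant\<close>

lemma degree_le_min_plus_weight:
  fixes q :: "nat \<Rightarrow> nat \<Rightarrow> nat"
  assumes t: "t \<ge> 1" and deg: "\<And>j. j \<in> {1..t} \<Longrightarrow> monomial_degree k (\<lambda>i. q i j) = d"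
  shows "d \<le> Min ((\<lambda>j. q 0 j) ` {1..t}) + Max ((\<lambda>j. \<Sum>i=1..k. i * q i j) ` {1..t})"
proof -
  have "Min ((\<lambda>j. q 0 j) ` {1..t}) \<in> (\<lambda>j. q 0 j) ` {1..t}" using t by (intro Min_in) auto
  then obtain j where j: "j \<in> {1..t}" "Min ((\<lambda>j. q 0 j) ` {1..t}) = q 0 j" by auto
  have "{..k} = insert 0 {1..k}" by auto
  then have "d = (\<Sum>i\<in>insert 0 {1..k}. q i j)"
    using deg[OF j(1)] by (simp only: monomial_degree_def)
  also have "\<dots> = q 0 j + (\<Sum>i=1..k. q i j)" by (subst sum.insert) auto
  also have "(\<Sum>i=1..k. q i j) \<le> (\<Sum>i=1..k. i * q i j)" by (intro sum_mono) auto
  also have "\<dots> \<le> Max ((\<lambda>j. \<Sum>i=1..k. i * q i j) ` {1..t})" using j by (intro Max_ge) auto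
  finally show ?thesis using j(2) by simp
qed

text \<open>If f^(l) vanished, so would f^(k), which is a factor of every monomial because
  \<open>q k j \<ge> 1\<close>; then P would vanish.\<close>

lemma higher_deriv_nonzero_mero:
  assumes f: "f meromorphic_on UNIV" and qk: "\<And>j. j \<in> {1..t} \<Longrightarrow> q k j \<ge> 1"
    and nz: "\<not> (\<forall>\<^sub>\<approx>z\<in>UNIV. diff_poly k t b q f z = 0)" and l: "l \<le> k"
  shows "nonzero_mero ((deriv ^^ l) f)"
proof (rule nonzero_meroI)
  show "(deriv ^^ l) f meromorphic_on UNIV" by (intro meromorphic_on_higher_deriv f)
  show "\<not> (\<forall>\<^sub>\<approx>z\<in>UNIV. (deriv ^^ l) f z = 0)"
  proof
    assume l0: "\<forall>\<^sub>\<approx>z\<in>UNIV. (deriv ^^ l) f z = 0"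
    have "\<forall>\<^sub>\<approx>z\<in>UNIV. (deriv ^^ n) f z = 0" if "l \<le> n" for n
      using that
    proof (induction n rule: dec_induct)
      case (step n)
      then show ?case using deriv_eventually_zero[of "(deriv ^^ n) f"] f by (simp add: meromorphic_on_higher_deriv)
    qed (rule l0)
    from this[OF l] have "\<forall>\<^sub>\<approx>z\<in>UNIV. diff_poly k t b q f z = 0"
    proof eventually_elim
      case (elim z)
      have "diff_monomial k (\<lambda>i. q i j) f z = 0" if "j \<in> {1..t}" for j
        unfolding diff_monomial_def using elim qk[OF that] by (intro prod_zero) (auto intro!: bexI[of _ k])
      then show ?case unfolding diff_poly_def by (intro sum.neutral) auto
    qed
    with nz show False by blast
  qed
qed

lemma diff_poly_meromorphic:
  assumes "f meromorphic_on UNIV" "\<And>j. j \<in> {1..t} \<Longrightarrow> b j meromorphic_on UNIV"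
  shows "diff_poly k t b q f meromorphic_on UNIV"
  unfolding diff_poly_def[abs_def] diff_monomial_def
  using assms by (intro meromorphic_intros) auto

lemma log_deriv_bounded_sets:
  assumes "\<And>i. i \<in> I \<Longrightarrow> nonzero_mero (g i)" "finite I"
  obtains E where "E \<in> lmeasurable" "\<And>i. i \<in> I \<Longrightarrow> log_deriv_bounded (g i) E"
proof -
  have "\<forall>i\<in>I. \<exists>E. E \<in> lmeasurable \<and> log_deriv_bounded (g i) E"
    using log_deriv_bounded_ex assms(1) by blast
  then obtain E where E: "\<And>i. i \<in> I \<Longrightarrow> E i \<in> lmeasurable" "\<And>i. i \<in> I \<Longrightarrow> log_deriv_bounded (g i) (E i)"
    using bchoice[of I "\<lambda>i E. E \<in> lmeasurable \<and> log_deriv_bounded (g i) E"] by blast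
  show ?thesis
  proof
    show "(\<Union>i\<in>I. E i) \<in> lmeasurable" using E(1) assms(2) by (intro fmeasurable.finite_UN) auto
    show "log_deriv_bounded (g i) (\<Union>i\<in>I. E i)" if "i \<in> I" for i
      by (rule log_deriv_bounded_mono[OF E(2)[OF that]]) (use that in auto)
  qed
qed

theorem diff_poly_one_points_inequality:
  assumes f: "transcendental_meromorphic f" and t: "t \<ge> 1"
    and b_mero: "\<And>j. j \<in> {1..t} \<Longrightarrow> b j meromorphic_on UNIV"
    and b_small: "\<And>j. j \<in> {1..t} \<Longrightarrow> small_quantity f (nevanlinna_T (b j))"
    and homogeneous: "\<And>j. j \<in> {1..t} \<Longrightarrow> monomial_degree k (\<lambda>i. q i j) = d"
    and m: "1 \<le> m" "\<And>j. j \<in> {1..t} \<Longrightarrow> m \<le> q 0 j"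
    and q_k: "\<And>j. j \<in> {1..t} \<Longrightarrow> q k j \<ge> 1"
    and P: "P = diff_poly k t b q f" and P0: "\<not> (\<forall>\<^sub>\<approx>z\<in>UNIV. P z = 0)"
  shows "\<exists>E X. E \<in> lmeasurable \<and> E \<subseteq> {0<..} \<and> exceptional_set f E \<and> exceptional_set.small f E X \<and>
    (\<forall>r\<ge>1. r \<notin> E \<longrightarrow> (real m - 2) * nevanlinna_T f r \<le> reduced_counting_N (\<lambda>z. 1 / (P z - 1)) r + X r)"
proof -
  note nzf = transcendental_imp_nonzero_mero[OF f]
  note mf = nonzero_mero_imp_meromorphic[OF nzf]
  have mP: "P meromorphic_on UNIV" unfolding P by (rule diff_poly_meromorphic[OF mf b_mero])
  have nzP: "nonzero_mero P" by (rule nonzero_meroI[OF mP P0])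
  define \<G> where "\<G> = insert P ((\<lambda>l. (deriv ^^ l) f) ` {..k} \<union> {g. (g = deriv P \<or> g = (\<lambda>z. P z - 1)) \<and> nonzero_mero g})"
  have "finite {g. (g = deriv P \<or> g = (\<lambda>z. P z - 1)) \<and> nonzero_mero g}"
    by (rule finite_subset[of _ "{deriv P, \<lambda>z. P z - 1}"]) auto
  then have fin: "finite \<G>" by (simp add: \<G>_def)
  have "nonzero_mero g" if "g \<in> \<G>" for g
    using that nzP higher_deriv_nonzero_mero[OF mf q_k P0[unfolded P]] by (auto simp: \<G>_def)
  then obtain E1 where E1: "E1 \<in> lmeasurable" "\<And>g. g \<in> \<G> \<Longrightarrow> log_deriv_bounded g E1"
    using log_deriv_bounded_sets[of \<G> "\<lambda>g. g"] fin by blast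
  define E2 where "E2 = (\<Union>j\<in>{1..t}. {r. r > 0 \<and> \<not> analytic_radius (b j) r})"
  have E2: "E2 \<in> lmeasurable"
    unfolding E2_def using b_mero
    by (intro countable_imp_lmeasurable countable_UN countable_nonanalytic_radii) auto
  obtain D where D: "\<And>j. j \<in> {1..t} \<Longrightarrow> D j \<in> lmeasurable" "\<And>j. j \<in> {1..t} \<Longrightarrow> D j \<subseteq> {0<..}"
    "\<And>j. j \<in> {1..t} \<Longrightarrow> nevanlinna_T (b j) \<in> o[inf at_top (principal (- D j))](nevanlinna_T f)"
    using b_small unfolding small_quantity_def by metis
  \<comment> \<open>\<open>small_quantity\<close> wants a subset of the positive reals. Cutting
    \<open>E1\<close> down to them is harmless, because \<open>log_deriv_bounded\<close> concerns
    radii from 1 on.\<close>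
  define E where "E = (E1 \<inter> {0<..}) \<union> E2 \<union> (\<Union>j\<in>{1..t}. D j)"
  have E: "E \<in> lmeasurable" "E \<subseteq> {0<..}"
  proof -
    have "E1 \<inter> {0<..} \<in> lmeasurable" by (rule fmeasurable_Int_fmeasurable[OF E1(1)]) auto
    moreover have "(\<Union>j\<in>{1..t}. D j) \<in> lmeasurable" using D(1) by (intro fmeasurable.finite_UN) auto
    ultimately show "E \<in> lmeasurable" unfolding E_def using E2 by (intro fmeasurable.Un)
    have "(\<Union>j\<in>{1..t}. D j) \<subseteq> {0<..}" using D(2) by (intro UN_least)
    then show "E \<subseteq> {0<..}" unfolding E_def E2_def by auto
  qed
  have ldb: "log_deriv_bounded g E" if "g \<in> \<G>" for g
    using E1(2)[OF that] by (rule log_deriv_bounded_mono) (auto simp: E_def)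
  have "f \<in> \<G>" by (auto simp: \<G>_def intro!: image_eqI[of _ _ 0])
  then interpret ex: exceptional_set f E
    by unfold_locales (use f log_deriv_bounded_regular[OF ldb] in auto)
  have small_b: "ex.small (nevanlinna_T (b j))" if j: "j \<in> {1..t}" for j
    unfolding ex.small_def
  proof (intro allI impI)
    fix \<epsilon> :: real assume "\<epsilon> > 0"
    have "eventually (\<lambda>r. norm (nevanlinna_T (b j) r) \<le> \<epsilon> * norm (nevanlinna_T f r)) (inf at_top (principal (- D j)))"
      by (rule landau_o.smallD[OF D(3)[OF j] \<open>\<epsilon> > 0\<close>])
    moreover have "inf at_top (principal (- E)) \<le> inf at_top (principal (- D j))"
      using j by (intro inf_mono) (auto simp: E_def)
    ultimately have "eventually (\<lambda>r. norm (nevanlinna_T (b j) r) \<le> \<epsilon> * norm (nevanlinna_T f r)) ex.off_E"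
      using filter_leD by blast
    moreover have "eventually (\<lambda>r. nevanlinna_T f r \<ge> 0) ex.off_E"
      by (rule ex.eventually_off_E[of 1]) (rule nevanlinna_T_nonneg[OF mf])
    ultimately show "eventually (\<lambda>r. nevanlinna_T (b j) r \<le> \<epsilon> * nevanlinna_T f r) ex.off_E"
      by eventually_elim auto
  qed
  interpret dp: diff_poly_setting f E b q k t d m P
  proof unfold_locales
    show "analytic_radius (b j) r" if "j \<in> {1..t}" "r \<ge> 1" "r \<notin> E" for j r
      using that by (auto simp: E_def E2_def)
    show "log_deriv_bounded ((deriv ^^ l) f) E" if "l < k" for l
      using that by (intro ldb) (auto simp: \<G>_def)
    show "log_deriv_bounded P E" by (intro ldb) (auto simp: \<G>_def)
  qed (use assms small_b nzP in auto)
  have "\<exists>X. ex.small X \<and> (\<forall>r\<ge>1. r \<notin> E \<longrightarrow> (real m - 2) * nevanlinna_T f r \<le> dp.Nbar r + X r)"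
  proof (cases "\<exists>c. \<forall>\<^sub>\<approx>z\<in>UNIV. P z = c")
    case True
    then show ?thesis using dp.main_inequality_constant by metis
  next
    case False
    have nz': "nonzero_mero (deriv P)" using False by (intro deriv_nonzero_mero[OF mP]) blast
    have nz1: "nonzero_mero (\<lambda>z. P z - 1)"
    proof (rule nonzero_meroI)
      show "(\<lambda>z. P z - 1) meromorphic_on UNIV" by (intro meromorphic_intros mP)
      show "\<not> (\<forall>\<^sub>\<approx>z\<in>UNIV. P z - 1 = 0)" using False by auto
    qed
    have "log_deriv_bounded (\<lambda>z. P z - 1) E" "log_deriv_bounded (deriv P) E"
      using nz' nz1 by (auto intro!: ldb simp: \<G>_def)
    then show ?thesis
      using dp.main_inequality_nonconstant[OF nz1 _ nz'] log_deriv_bounded_regular by metis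
  qed
  then show ?thesis using E ex.exceptional_set_axioms by blast
qed

theorem theorem2p3:
  fixes f :: "complex \<Rightarrow> complex"
    and b :: "nat \<Rightarrow> complex \<Rightarrow> complex"
    and q :: "nat \<Rightarrow> nat \<Rightarrow> nat"
    and k t d \<nu> q_min :: nat
    and P :: "complex \<Rightarrow> complex"
  assumes f: "transcendental_meromorphic f"
    and k: "k \<ge> 1"
    and t: "t \<ge> 1"
    and b_mero: "\<And>j. j \<in> {1..t} \<Longrightarrow> b j meromorphic_on UNIV"
    and b_small: "\<And>j. j \<in> {1..t} \<Longrightarrow> small_quantity f (nevanlinna_T (b j))"
    and P: "P = diff_poly k t b q f"
    and homogeneous: "\<And>j. j \<in> {1..t} \<Longrightarrow> monomial_degree k (\<lambda>i. q i j) = d"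
    and q_0: "\<And>j. j \<in> {1..t} \<Longrightarrow> q 0 j \<ge> 1"
    and q_k: "\<And>j. j \<in> {1..t} \<Longrightarrow> q k j \<ge> 1"
    and \<nu>: "\<nu> = Max ((\<lambda>j. \<Sum>i=1..k. i * q i j) ` {1..t})"
    and q_min: "q_min = Min ((\<lambda>j. q 0 j) ` {1..t})"
    and deg: "d + k * q_min > 2 * (k + 1) + \<nu>"
  shows "(\<forall>\<^sub>\<approx>z\<in>UNIV. P z = 0) \<or>
    (\<exists>S. small_quantity f S \<and>
      (\<forall>r>0. nevanlinna_T f r \<le>
         (real k + 1) / (real d + real k * real q_min - real \<nu> - 2 * (real k + 1)) *
           reduced_counting_N (\<lambda>z. 1 / (P z - 1)) r + S r))"
proof (cases "\<forall>\<^sub>\<approx>z\<in>UNIV. P z = 0")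
  case False
  have q_min_ge: "1 \<le> q_min"
    unfolding q_min using t q_0 by (subst Min_ge_iff) auto
  have q_min_le: "q_min \<le> q 0 j" if "j \<in> {1..t}" for j
    unfolding q_min using that by (intro Min_le) auto
  obtain E X where E: "E \<in> lmeasurable" "E \<subseteq> {0<..}" "exceptional_set f E" "exceptional_set.small f E X"
    and main: "\<And>r. r \<ge> 1 \<Longrightarrow> r \<notin> E \<Longrightarrow>
      (real q_min - 2) * nevanlinna_T f r \<le> reduced_counting_N (\<lambda>z. 1 / (P z - 1)) r + X r"
    using diff_poly_one_points_inequality[OF f t b_mero b_small homogeneous q_min_ge q_min_le q_k P False] by blast
  interpret exceptional_set f E by (rule E(3))
  define D where "D = real d + real k * real q_min - real \<nu> - 2 * (real k + 1)"
  have D: "D > 0"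
  proof -
    have "real (2 * (k + 1) + \<nu>) < real (d + k * q_min)" using deg by (simp only: of_nat_less_iff)
    then show ?thesis by (simp add: D_def)
  qed
  \<comment> \<open>With d \<le> q_min + \<nu>, D is at most q_min + k q_min - 2 (k + 1) = (k +
    1)(q_min - 2). As D > 0, this also makes q_min - 2 positive and gives c (q_min - 2) \<ge>
    1.\<close>
  have D_le: "D \<le> (real q_min - 2) * (real k + 1)"
  proof -
    have "d \<le> q_min + \<nu>" unfolding q_min \<nu> by (rule degree_le_min_plus_weight[OF t homogeneous])
    then have "real d \<le> real q_min + real \<nu>" by linarith
    then show ?thesis by (simp add: D_def algebra_simps)
  qed
  define c where "c = (real k + 1) / D"
  have c: "c > 0" using D by (simp add: c_def)
  let ?N = "reduced_counting_N (\<lambda>z. 1 / (P z - 1))"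
  \<comment> \<open>Taking the positive part of the defect makes the inequality hold at every
    radius, including those in E or below 1; only the size of \<open>S\<close> off E remains to be
    estimated.\<close>
  define S where "S = (\<lambda>r. max 0 (nevanlinna_T f r - c * ?N r))"
  have S_le: "S r \<le> max 0 (c * X r)" if r: "r \<ge> 1" "r \<notin> E" for r
  proof -
    have "1 \<le> c * (real q_min - 2)" using D D_le by (simp add: c_def field_simps)
    then have "1 * T r \<le> c * (real q_min - 2) * T r"
      by (intro mult_right_mono nevanlinna_T_nonneg mero r)
    also have "\<dots> \<le> c * (?N r + X r)"
      using main[OF r] c by (simp add: mult.assoc)
    finally show ?thesis by (simp add: S_def distrib_left)
  qed
  have "S \<in> o[off_E](T)"
  proof (rule landau_o.smallI)
    fix \<epsilon> :: real assume \<epsilon>: "\<epsilon> > 0"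
    have "small (\<lambda>r. c * X r)" using c E(4) by (intro small_cmult) auto
    then have "eventually (\<lambda>r. c * X r \<le> \<epsilon> * T r) off_E" using \<epsilon> by (simp add: small_def)
    moreover have "eventually (\<lambda>r. S r \<le> max 0 (c * X r)) off_E"
      by (rule eventually_off_E[of 1]) (rule S_le)
    moreover have "eventually (\<lambda>r. T r \<ge> 0) off_E"
      by (rule eventually_off_E[of 1]) (rule nevanlinna_T_nonneg[OF mero])
    ultimately show "eventually (\<lambda>r. norm (S r) \<le> \<epsilon> * norm (T r)) off_E"
    proof eventually_elim
      case (elim r)
      have "0 \<le> \<epsilon> * T r" using \<epsilon> elim by simp
      then show ?case using elim by (simp add: S_def)
    qed
  qed
  then have "small_quantity f S" using E(1,2) by (auto simp: small_quantity_def)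
  moreover have "T r \<le> c * ?N r + S r" for r by (simp add: S_def)
  ultimately show ?thesis unfolding c_def D_def by blast
qed simp

end
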